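(* Let $p\geq 5$ be prime. There is a 1-to-1 correspondence between the $PSL_2(p)$-orbit of the point $(1:0:\ldots:0)\in\mathbb{P}^{\frac{p-1}{2}}$ and the $PSL_2(p)$-orbit of the hyperplane $\{a_0=0\}\subset\mathbb{P}^{\frac{p-1}{2}}$. This correspondence is an isomorphism of $PSL_2(p)$-sets, and the action on these sets coincides with the canonical action of $PSL_2(p)$ on $\mathbb{P}^1_{\mathbb{F}_p}$ (i.e. both orbits are isomorphic, as $PSL_2(p)$-sets, to $\mathbb{P}^1_{\mathbb{F}_p}$).
   Context: Let $\omega=e^{2\pi i/p}$; indices of $x_i$ are in $\mathbb{Z}/p\mathbb{Z}$, and $\frac i2$ in an index means $i\cdot2^{-1}$ modulo $p$. $H_p=\langle e_1,e_2,z\mid e_1^p=e_2^p=z^p=1,\ [e_1,e_2]=z,\ e_1z=ze_1,\ e_2z=ze_2\rangle$ (with $[e_1,e_2]=e_1e_2e_1^{-1}e_2^{-1}$) is the Heisenberg group of order $p^3$; $H_p/\langle z\rangle=\mathbb{F}_p\times\mathbb{F}_p$ with $e_1\mapsto(1,0)$, $e_2\mapsto(0,1)$. It acts on $V=\mathbb{C}x_0+\ldots+\mathbb{C}x_{p-1}$ by $e_1\cdot x_i=x_{i-1}$, $e_2\cdot x_i=\omega^ix_i$. For $(a_0:\ldots:a_{\frac{p-1}{2}})\in \mathbb{P}^{\frac{p-1}{2}}$ (over $\mathbb{C}$), the $H_p$-Clifford algebra $\mathfrak{C}(a_0:\ldots:a_{\frac{p-1}{2}})$ is $\mathbb{C}\langle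 x_0,\ldots,x_{p-1}\rangle$ modulo $a_0(x_jx_{j+i}+x_{j+i}x_j)=a_i x_{j+\frac{i}{2}}^2$ ($j\in\mathbb{Z}/p\mathbb{Z}$, $1\le i\le \frac{p-1}{2}$) and (automatic if $a_0\ne0$) $a_m(x_{k-\frac i2}x_{k+\frac i2}+x_{k+\frac i2}x_{k-\frac i2})=a_i(x_{k-\frac m2}x_{k+\frac m2}+x_{k+\frac m2}x_{k-\frac m2})$ ($k\in\mathbb{Z}/p\mathbb{Z}$, $1\le i,m\le\frac{p-1}{2}$). $H_p$ acts on it by graded automorphisms. The (right) action of $PSL_2(p)$ on $\mathbb{P}^{\frac{p-1}{2}}$: for $\varphi\in SL_2(\mathbb{F}_p)$ (acting on column vectors in $\mathbb{F}_p\times\mathbb{F}_p$) choose an automorphism $\tilde\varphi$ of $H_p$ fixing $z$ and inducing $\varphi$ on $H_p/\langle z\rangle$. Let $y_0\in V$ be a nonzero vector with $\tilde\varphi(e_2)\cdot y_0=y_0$ (unique up to scalar) and $y_i=\tilde\varphi(e_1)^{-i}\cdot y_0$. Written in the generators $y_0,\ldots,y_{p-1}$, the relations of $\mathfrak{C}(a_0:\ldots:a_{\frac{p-1}{2}})$ take the same form with new parameters $(a_0':\ldots:a'_{\frac{p-1}{2}})$, and $\varphi$ sends $(a_0:\ldots:a_{\frac{p-1}{2}})$ to $(a_0':\ldots:a'_{\frac{p-1}{2}})$. This is independent of the choices, is given by projective linear maps, and $-I_2$ acts trivially. The canonical action of $PSL_2(p)$ on $\mathbb{P}^1_{\mathbb{F}_p}$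 is the one on lines in $\mathbb{F}_p^2$, viewed as a right action by letting $g$ act as $g^{-1}$. *)

theory Defs
  imports
    "HOL-Analysis.Analysis"
    "HOL-Algebra.Coset"
    "HOL-Algebra.QuotRing"
    "HOL-Library.Poly_Mapping"
    "Berlekamp_Zassenhaus.Finite_Field"
begin

text \<open>
  Throughout, the prime \<open>p\<close> is \<open>CARD('p)\<close> for a type \<open>'p\<close> of class \<^class>\<open>prime_card\<close>, and
  \<open>'p mod_ring\<close> is the field of integers modulo \<open>p\<close>. In particular \<open>i / 2\<close> on \<open>'p mod_ring\<close> is
  the product of \<open>i\<close> with the inverse of 2 modulo \<open>p\<close>.
\<close>

section \<open>The Heisenberg group\<close>

text \<open>The triple \<open>(a, b, c)\<close> stands for the normal form \<open>e1^a e2^b z^c\<close>; from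
  \<open>e1 e2 e1\<inverse> e2\<inverse> = z\<close> one gets \<open>e2^b e1^a = e1^a e2^b z^(-ab)\<close>, whence the multiplication.
  That this is the group with the usual presentation is lemma \<open>heis_presentation\<close>.\<close>

type_synonym 'p heis = "'p mod_ring \<times> 'p mod_ring \<times> 'p mod_ring"

definition heis :: "'p::prime_card heis monoid" where
  "heis = \<lparr>carrier = UNIV,
     monoid.mult = (\<lambda>(a, b, c) (a', b', c'). (a + a', b + b', c + c' - b * a')),
     one = (0, 0, 0)\<rparr>"

definition e1 :: "'p::prime_card heis" where "e1 = (1, 0, 0)"
definition e2 :: "'p::prime_card heis" where "e2 = (0, 1, 0)"
definition hz :: "'p::prime_card heis" where "hz = (0, 0, 1)"

text \<open>The quotient map by \<open>\<langle>z\<rangle>\<close>, with \<open>e1 \<mapsto> (1,0)\<close> and \<open>e2 \<mapsto> (0,1)\<close>.\<close>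

definition heis_ab :: "'p::prime_card heis \<Rightarrow> 'p mod_ring ^ 2" where
  "heis_ab h = (case h of (a, b, c) \<Rightarrow> vector [a, b])"

lemma heis_simps [simp]:
  "carrier heis = UNIV"
  "\<one>\<^bsub>heis\<^esub> = (0, 0, 0)"
  "(a, b, c) \<otimes>\<^bsub>heis\<^esub> (a', b', c') = (a + a', b + b', c + c' - b * a')"
  by (simp_all add: heis_def)

lemma heis_group: "group (heis :: 'p::prime_card heis monoid)"
proof (rule groupI)
  fix x :: "'p heis" assume "x \<in> carrier heis"
  obtain a b c where x: "x = (a, b, c)" by (cases x)
  show "\<exists>y\<in>carrier heis. y \<otimes>\<^bsub>heis\<^esub> x = \<one>\<^bsub>heis\<^esub>"
    by (rule bexI[of _ "(- a, - b, - c - b * a)"]) (simp_all add: x)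
qed (auto simp: algebra_simps)

lemma heis_pow:
  "(a, 0, 0) [^]\<^bsub>heis\<^esub> (n::nat) = (of_nat n * a, 0, 0 :: 'p::prime_card mod_ring)"
  "(0, b, 0) [^]\<^bsub>heis\<^esub> (n::nat) = (0, of_nat n * b, 0 :: 'p mod_ring)"
  "(0, 0, c) [^]\<^bsub>heis\<^esub> (n::nat) = (0, 0, of_nat n * c :: 'p mod_ring)"
  by (induction n) (auto simp: algebra_simps nat_pow_def heis_def)

lemma card_heis: "card (carrier (heis :: 'p::prime_card heis monoid)) = CARD('p) ^ 3"
  by (simp add: power3_eq_cube)

definition heis_relations :: "nat \<Rightarrow> ('g, 'm) monoid_scheme \<Rightarrow> 'g \<Rightarrow> 'g \<Rightarrow> 'g \<Rightarrow> bool" where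
  "heis_relations p G x y z \<longleftrightarrow>
     x \<in> carrier G \<and> y \<in> carrier G \<and> z \<in> carrier G \<and>
     x [^]\<^bsub>G\<^esub> p = \<one>\<^bsub>G\<^esub> \<and> y [^]\<^bsub>G\<^esub> p = \<one>\<^bsub>G\<^esub> \<and> z [^]\<^bsub>G\<^esub> p = \<one>\<^bsub>G\<^esub> \<and>
     x \<otimes>\<^bsub>G\<^esub> y \<otimes>\<^bsub>G\<^esub> inv\<^bsub>G\<^esub> x \<otimes>\<^bsub>G\<^esub> inv\<^bsub>G\<^esub> y = z \<and>
     x \<otimes>\<^bsub>G\<^esub> z = z \<otimes>\<^bsub>G\<^esub> x \<and> y \<otimes>\<^bsub>G\<^esub> z = z \<otimes>\<^bsub>G\<^esub> y"

lemma mod_ring_nat_cases: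
  obtains n where "(a :: 'p::prime_card mod_ring) = of_nat n"
proof
  have "0 \<le> to_int_mod_ring a" by transfer auto
  then show "a = of_nat (nat (to_int_mod_ring a))"
    by (simp add: of_nat_of_int_mod_ring)
qed

lemma of_nat_mod_ring_eq_iff:
  "(of_nat m = (of_nat n :: 'p::prime_card mod_ring)) \<longleftrightarrow> m mod CARD('p) = n mod CARD('p)"
proof -
  have "(of_nat m = (of_nat n :: 'p mod_ring)) \<longleftrightarrow> int m mod int CARD('p) = int n mod int CARD('p)"
    by transfer simp
  then show ?thesis by (metis of_nat_mod of_nat_eq_iff)
qed

lemma (in monoid) nat_pow_cong_mod:
  assumes u: "u \<in> carrier G" "u [^] (p::nat) = \<one>" and mn: "m mod p = (n::nat) mod p"
  shows "u [^] m = u [^] n"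
proof -
  have "u [^] k = u [^] (k mod p)" for k :: nat
  proof -
    have "u [^] k = u [^] (p * (k div p) + k mod p)" by simp
    also have "\<dots> = (u [^] p) [^] (k div p) \<otimes> u [^] (k mod p)"
      using u(1) by (simp only: nat_pow_mult[symmetric] nat_pow_pow)
    also have "\<dots> = u [^] (k mod p)" using u by simp
    finally show ?thesis .
  qed
  then show ?thesis using mn by metis
qed

lemma heis_inv: "inv\<^bsub>heis\<^esub> (a, b, c) = (- a, - b, - c - b * a)"
  by (rule group.inv_equality[OF heis_group]) (auto simp: algebra_simps)

lemma heis_relations_gens:
  "heis_relations CARD('p) heis e1 e2 (hz :: 'p::prime_card heis)"
  by (simp add: heis_relations_def e1_def e2_def hz_def heis_pow heis_inv)

lemma heis_normal_form:
  "(of_nat a, of_nat b, of_nat c) =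
     e1 [^]\<^bsub>heis\<^esub> a \<otimes>\<^bsub>heis\<^esub> e2 [^]\<^bsub>heis\<^esub> b \<otimes>\<^bsub>heis\<^esub> hz [^]\<^bsub>heis\<^esub> c"
  by (simp add: e1_def e2_def hz_def heis_pow)

lemma heis_commutation:
  assumes "group G" and rel: "heis_relations p G x y z"
  shows "y [^]\<^bsub>G\<^esub> (b::nat) \<otimes>\<^bsub>G\<^esub> x [^]\<^bsub>G\<^esub> (a::nat) \<otimes>\<^bsub>G\<^esub> z [^]\<^bsub>G\<^esub> (b * a) = x [^]\<^bsub>G\<^esub> a \<otimes>\<^bsub>G\<^esub> y [^]\<^bsub>G\<^esub> b"
proof -
  interpret group G by fact
  have c [simp]: "x \<in> carrier G" "y \<in> carrier G" "z \<in> carrier G"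
    using rel by (auto simp: heis_relations_def)
  have zx: "z [^]\<^bsub>G\<^esub> n \<otimes>\<^bsub>G\<^esub> x = x \<otimes>\<^bsub>G\<^esub> z [^]\<^bsub>G\<^esub> n" and zy: "z [^]\<^bsub>G\<^esub> n \<otimes>\<^bsub>G\<^esub> y = y \<otimes>\<^bsub>G\<^esub> z [^]\<^bsub>G\<^esub> n" for n :: nat
    using rel by (simp_all add: group_commutes_pow heis_relations_def)
  note [simp] = m_assoc
  have "z \<otimes>\<^bsub>G\<^esub> y \<otimes>\<^bsub>G\<^esub> x = (x \<otimes>\<^bsub>G\<^esub> y \<otimes>\<^bsub>G\<^esub> inv\<^bsub>G\<^esub> x \<otimes>\<^bsub>G\<^esub> inv\<^bsub>G\<^esub> y) \<otimes>\<^bsub>G\<^esub> y \<otimes>\<^bsub>G\<^esub> x"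
    using rel unfolding heis_relations_def by metis
  also have "\<dots> = x \<otimes>\<^bsub>G\<^esub> y" using l_inv[of x] l_inv[of y] m_assoc[of "inv\<^bsub>G\<^esub> y" y x] by simp
  finally have xy: "x \<otimes>\<^bsub>G\<^esub> y = y \<otimes>\<^bsub>G\<^esub> (x \<otimes>\<^bsub>G\<^esub> z)"
    using zx[of 1] zy[of 1] by (metis c m_assoc nat_pow_eone)
  have 1: "y [^]\<^bsub>G\<^esub> b \<otimes>\<^bsub>G\<^esub> (x \<otimes>\<^bsub>G\<^esub> z [^]\<^bsub>G\<^esub> b) = x \<otimes>\<^bsub>G\<^esub> y [^]\<^bsub>G\<^esub> b" for b :: nat
  proof (induction b)
    case (Suc b)
    have "y [^]\<^bsub>G\<^esub> Suc b \<otimes>\<^bsub>G\<^esub> (x \<otimes>\<^bsub>G\<^esub> z [^]\<^bsub>G\<^esub> Suc b)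
        = y [^]\<^bsub>G\<^esub> b \<otimes>\<^bsub>G\<^esub> ((y \<otimes>\<^bsub>G\<^esub> (x \<otimes>\<^bsub>G\<^esub> z)) \<otimes>\<^bsub>G\<^esub> z [^]\<^bsub>G\<^esub> b)"
      using nat_pow_comm[of z b 1] by simp
    also have "\<dots> = y [^]\<^bsub>G\<^esub> b \<otimes>\<^bsub>G\<^esub> (x \<otimes>\<^bsub>G\<^esub> (z [^]\<^bsub>G\<^esub> b \<otimes>\<^bsub>G\<^esub> y))"
      by (simp add: xy[symmetric] zy)
    also have "\<dots> = (y [^]\<^bsub>G\<^esub> b \<otimes>\<^bsub>G\<^esub> (x \<otimes>\<^bsub>G\<^esub> z [^]\<^bsub>G\<^esub> b)) \<otimes>\<^bsub>G\<^esub> y" by simp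
    also have "\<dots> = x \<otimes>\<^bsub>G\<^esub> y [^]\<^bsub>G\<^esub> Suc b" by (simp only: Suc.IH) simp
    finally show ?case .
  qed simp
  show ?thesis
  proof (induction a)
    case (Suc a)
    have "y [^]\<^bsub>G\<^esub> b \<otimes>\<^bsub>G\<^esub> x [^]\<^bsub>G\<^esub> Suc a \<otimes>\<^bsub>G\<^esub> z [^]\<^bsub>G\<^esub> (b * Suc a)
        = y [^]\<^bsub>G\<^esub> b \<otimes>\<^bsub>G\<^esub> x [^]\<^bsub>G\<^esub> a \<otimes>\<^bsub>G\<^esub> (x \<otimes>\<^bsub>G\<^esub> z [^]\<^bsub>G\<^esub> (b * a)) \<otimes>\<^bsub>G\<^esub> z [^]\<^bsub>G\<^esub> b"
      by (simp add: nat_pow_mult add.commute)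
    also have "\<dots> = (y [^]\<^bsub>G\<^esub> b \<otimes>\<^bsub>G\<^esub> x [^]\<^bsub>G\<^esub> a \<otimes>\<^bsub>G\<^esub> z [^]\<^bsub>G\<^esub> (b * a)) \<otimes>\<^bsub>G\<^esub> x \<otimes>\<^bsub>G\<^esub> z [^]\<^bsub>G\<^esub> b"
      by (simp add: zx[symmetric])
    also have "\<dots> = x [^]\<^bsub>G\<^esub> a \<otimes>\<^bsub>G\<^esub> (y [^]\<^bsub>G\<^esub> b \<otimes>\<^bsub>G\<^esub> (x \<otimes>\<^bsub>G\<^esub> z [^]\<^bsub>G\<^esub> b))"
      by (simp only: Suc.IH) simp
    also have "\<dots> = x [^]\<^bsub>G\<^esub> Suc a \<otimes>\<^bsub>G\<^esub> y [^]\<^bsub>G\<^esub> b" by (simp only: 1) simp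
    finally show ?case .
  qed simp
qed

text \<open>The universal property of the group presented by generators \<open>e1\<close>, \<open>e2\<close>, \<open>z\<close> and the
  relations in \<open>heis_relations\<close>.\<close>

theorem heis_presentation:
  assumes "group G" and rel: "heis_relations CARD('p::prime_card) G x y z"
  shows "\<exists>!f. f \<in> hom (heis :: 'p heis monoid) G \<and> f e1 = x \<and> f e2 = y \<and> f hz = z"
proof -
  interpret G: group G by fact
  interpret H: group "heis :: 'p heis monoid" by (rule heis_group)
  have c [simp]: "x \<in> carrier G" "y \<in> carrier G" "z \<in> carrier G"
    and pw: "x [^]\<^bsub>G\<^esub> CARD('p) = \<one>\<^bsub>G\<^esub>" "y [^]\<^bsub>G\<^esub> CARD('p) = \<one>\<^bsub>G\<^esub>" "z [^]\<^bsub>G\<^esub> CARD('p) = \<one>\<^bsub>G\<^esub>"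
    and zx: "x \<otimes>\<^bsub>G\<^esub> z = z \<otimes>\<^bsub>G\<^esub> x" and zy: "y \<otimes>\<^bsub>G\<^esub> z = z \<otimes>\<^bsub>G\<^esub> y"
    using rel by (auto simp: heis_relations_def)
  define N :: "'p mod_ring \<Rightarrow> nat" where "N a = nat (to_int_mod_ring a)" for a
  define f where "f h = (case h of (a :: 'p mod_ring, b :: 'p mod_ring, k :: 'p mod_ring) \<Rightarrow>
    x [^]\<^bsub>G\<^esub> N a \<otimes>\<^bsub>G\<^esub> y [^]\<^bsub>G\<^esub> N b \<otimes>\<^bsub>G\<^esub> z [^]\<^bsub>G\<^esub> N k)" for h
  have N: "of_nat (N a) = a" for a
  proof -
    have "0 \<le> to_int_mod_ring a" by transfer auto
    then show ?thesis by (simp add: N_def of_nat_of_int_mod_ring)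
  qed
  have Nm: "N (of_nat n) mod CARD('p) = n mod CARD('p)" for n
    using N[of "of_nat n"] by (simp only: of_nat_mod_ring_eq_iff)
  have f: "f (of_nat a, of_nat b, of_nat k) = x [^]\<^bsub>G\<^esub> a \<otimes>\<^bsub>G\<^esub> y [^]\<^bsub>G\<^esub> b \<otimes>\<^bsub>G\<^esub> z [^]\<^bsub>G\<^esub> k" for a b k
    using G.nat_pow_cong_mod[OF c(1) pw(1) Nm] G.nat_pow_cong_mod[OF c(2) pw(2) Nm]
      G.nat_pow_cong_mod[OF c(3) pw(3) Nm] by (simp add: f_def)
  have "f \<in> hom heis G"
  proof (rule homI)
    fix g h :: "'p heis"
    obtain a b k where g: "g = (of_nat a, of_nat b, of_nat k)"
      by (cases g) (metis mod_ring_nat_cases)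
    obtain a' b' k' where h: "h = (of_nat a', of_nat b', of_nat k')"
      by (cases h) (metis mod_ring_nat_cases)
    obtain l where l: "(of_nat k + of_nat k' - of_nat b * of_nat a' :: 'p mod_ring) = of_nat l"
      by (rule mod_ring_nat_cases)
    then have "of_nat (k + k') = (of_nat (b * a' + l) :: 'p mod_ring)"
      by (simp add: algebra_simps)
    then have zl: "z [^]\<^bsub>G\<^esub> (k + k') = z [^]\<^bsub>G\<^esub> (b * a' + l)"
      unfolding of_nat_mod_ring_eq_iff by (rule G.nat_pow_cong_mod[OF c(3) pw(3)])
    have zx': "z [^]\<^bsub>G\<^esub> n \<otimes>\<^bsub>G\<^esub> x [^]\<^bsub>G\<^esub> m = x [^]\<^bsub>G\<^esub> m \<otimes>\<^bsub>G\<^esub> z [^]\<^bsub>G\<^esub> n" for n m :: nat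
      using G.group_commutes_pow[OF G.group_commutes_pow[OF zx, THEN sym]] by simp
    have zy': "z [^]\<^bsub>G\<^esub> n \<otimes>\<^bsub>G\<^esub> y [^]\<^bsub>G\<^esub> m = y [^]\<^bsub>G\<^esub> m \<otimes>\<^bsub>G\<^esub> z [^]\<^bsub>G\<^esub> n" for n m :: nat
      using G.group_commutes_pow[OF G.group_commutes_pow[OF zy, THEN sym]] by simp
    have "f g \<otimes>\<^bsub>G\<^esub> f h = x [^]\<^bsub>G\<^esub> a \<otimes>\<^bsub>G\<^esub> y [^]\<^bsub>G\<^esub> b \<otimes>\<^bsub>G\<^esub> (z [^]\<^bsub>G\<^esub> k \<otimes>\<^bsub>G\<^esub> x [^]\<^bsub>G\<^esub> a') \<otimes>\<^bsub>G\<^esub> y [^]\<^bsub>G\<^esub> b' \<otimes>\<^bsub>G\<^esub> z [^]\<^bsub>G\<^esub> k'"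
      unfolding g h f by (simp add: G.m_assoc)
    also have "\<dots> = x [^]\<^bsub>G\<^esub> a \<otimes>\<^bsub>G\<^esub> y [^]\<^bsub>G\<^esub> b \<otimes>\<^bsub>G\<^esub> x [^]\<^bsub>G\<^esub> a' \<otimes>\<^bsub>G\<^esub> (z [^]\<^bsub>G\<^esub> k \<otimes>\<^bsub>G\<^esub> y [^]\<^bsub>G\<^esub> b') \<otimes>\<^bsub>G\<^esub> z [^]\<^bsub>G\<^esub> k'"
      unfolding zx' by (simp add: G.m_assoc)
    also have "\<dots> = x [^]\<^bsub>G\<^esub> a \<otimes>\<^bsub>G\<^esub> y [^]\<^bsub>G\<^esub> b \<otimes>\<^bsub>G\<^esub> x [^]\<^bsub>G\<^esub> a' \<otimes>\<^bsub>G\<^esub> y [^]\<^bsub>G\<^esub> b' \<otimes>\<^bsub>G\<^esub> z [^]\<^bsub>G\<^esub> (b * a' + l)"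
      unfolding zy' zl[symmetric] by (simp add: G.m_assoc G.nat_pow_mult)
    also have "\<dots> = x [^]\<^bsub>G\<^esub> a \<otimes>\<^bsub>G\<^esub> y [^]\<^bsub>G\<^esub> b \<otimes>\<^bsub>G\<^esub> x [^]\<^bsub>G\<^esub> a' \<otimes>\<^bsub>G\<^esub> (y [^]\<^bsub>G\<^esub> b' \<otimes>\<^bsub>G\<^esub> z [^]\<^bsub>G\<^esub> (b * a')) \<otimes>\<^bsub>G\<^esub> z [^]\<^bsub>G\<^esub> l"
      by (simp add: G.m_assoc G.nat_pow_mult)
    also have "\<dots> = x [^]\<^bsub>G\<^esub> a \<otimes>\<^bsub>G\<^esub> (y [^]\<^bsub>G\<^esub> b \<otimes>\<^bsub>G\<^esub> x [^]\<^bsub>G\<^esub> a' \<otimes>\<^bsub>G\<^esub> z [^]\<^bsub>G\<^esub> (b * a')) \<otimes>\<^bsub>G\<^esub> y [^]\<^bsub>G\<^esub> b' \<otimes>\<^bsub>G\<^esub> z [^]\<^bsub>G\<^esub> l"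
      unfolding zy'[symmetric] by (simp add: G.m_assoc)
    also have "\<dots> = x [^]\<^bsub>G\<^esub> (a + a') \<otimes>\<^bsub>G\<^esub> y [^]\<^bsub>G\<^esub> (b + b') \<otimes>\<^bsub>G\<^esub> z [^]\<^bsub>G\<^esub> l"
      unfolding heis_commutation[OF assms]
      by (simp add: G.m_assoc G.nat_pow_mult[symmetric])
    also have "\<dots> = f (g \<otimes>\<^bsub>heis\<^esub> h)"
      by (simp add: g h l f[symmetric])
    finally show "f (g \<otimes>\<^bsub>heis\<^esub> h) = f g \<otimes>\<^bsub>G\<^esub> f h" ..
  qed (auto simp: f_def split: prod.splits)
  moreover have "f e1 = x" "f e2 = y" "f hz = z"
    using f[of 1 0 0] f[of 0 1 0] f[of 0 0 1] by (simp_all add: e1_def e2_def hz_def)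
  moreover have "g = f" if g: "g \<in> hom heis G" "g e1 = x" "g e2 = y" "g hz = z" for g
  proof
    fix h :: "'p heis"
    obtain a b k where h: "h = (of_nat a, of_nat b, of_nat k)"
      by (cases h) (metis mod_ring_nat_cases)
    interpret g: group_hom heis G g by unfold_locales (rule g(1))
    have "g h = x [^]\<^bsub>G\<^esub> a \<otimes>\<^bsub>G\<^esub> y [^]\<^bsub>G\<^esub> b \<otimes>\<^bsub>G\<^esub> z [^]\<^bsub>G\<^esub> k"
      unfolding h heis_normal_form by (simp add: g.hom_nat_pow g.hom_mult g(2-4) del: heis_simps(3))
    then show "g h = f h" by (simp add: h f)
  qed
  ultimately show ?thesis by blast
qed


section \<open>The representation on \<open>V\<close>\<close>

definition omega_pow :: "'p::prime_card mod_ring \<Rightarrow> complex" where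
  "omega_pow i = exp (2 * of_real pi * \<i> / of_nat CARD('p)) powi to_int_mod_ring i"

text \<open>With \<open>\<omega>^i\<close> as \<open>omega_pow i\<close>, and \<open>V\<close> as \<open>complex ^ ('p mod_ring)\<close> with \<open>x_i = axis i 1\<close>, the formula is
  \<open>e1^a e2^b z^c x_i = \<omega>^(c + b i) x_(i - a)\<close>; it is forced by \<open>heis_rep_gens\<close> and
  \<open>heis_rep_mult\<close>.\<close>

definition heis_rep ::
    "'p::prime_card heis \<Rightarrow> complex ^ ('p mod_ring) \<Rightarrow> complex ^ ('p mod_ring)" where
  "heis_rep h v = (case h of (a, b, c) \<Rightarrow> \<chi> j. omega_pow (c + b * (j + a)) * v $ (j + a))"

lemma omega_pow_of_nat:
  "omega_pow (of_nat n :: 'p::prime_card mod_ring) = exp (2 * of_real pi * \<i> / of_nat CARD('p)) ^ n"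
proof -
  let ?w = "exp (2 * of_real pi * \<i> / of_nat CARD('p))"
  have w: "?w ^ CARD('p) = 1"
    by (simp add: exp_of_nat_mult[symmetric])
  have "to_int_mod_ring (of_nat n :: 'p mod_ring) = int (n mod CARD('p))"
    by transfer (simp add: of_nat_mod)
  then have "omega_pow (of_nat n :: 'p mod_ring) = ?w ^ (n mod CARD('p))"
    by (simp add: omega_pow_def)
  also have "\<dots> = (?w ^ CARD('p)) ^ (n div CARD('p)) * ?w ^ (n mod CARD('p))"
    by (simp only: w) simp
  also have "\<dots> = ?w ^ n"
    by (simp only: power_mult[symmetric] power_add[symmetric]) simp
  finally show ?thesis .
qed

lemma omega_pow_simps:
  "omega_pow (0 :: 'p::prime_card mod_ring) = 1"
  "omega_pow (a + b :: 'p mod_ring) = omega_pow a * omega_pow b"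
proof -
  show "omega_pow (0 :: 'p mod_ring) = 1" using omega_pow_of_nat[of 0] by simp
  obtain m n where "a = of_nat m" "b = of_nat n" by (metis mod_ring_nat_cases)
  then show "omega_pow (a + b :: 'p mod_ring) = omega_pow a * omega_pow b"
    by (simp add: omega_pow_of_nat power_add of_nat_add[symmetric] del: of_nat_add)
qed

lemma heis_rep_gens:
  "heis_rep e1 (axis i 1) = axis (i - 1) 1"
  "heis_rep e2 (axis i 1) = omega_pow i *s axis i 1"
  "heis_rep hz v = omega_pow (1 :: 'p::prime_card mod_ring) *s (v :: complex ^ ('p mod_ring))"
  by (auto simp: heis_rep_def e1_def e2_def hz_def vec_eq_iff axis_def omega_pow_simps)

lemma heis_rep_mult: "heis_rep (g \<otimes>\<^bsub>heis\<^esub> h) v = heis_rep g (heis_rep h v)"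
  by (cases g; cases h)
     (simp add: heis_rep_def vec_eq_iff omega_pow_simps(2)[symmetric] algebra_simps)

lemma heis_rep_one: "heis_rep (\<one>\<^bsub>heis\<^esub>) v = v"
  by (simp add: heis_rep_def vec_eq_iff omega_pow_simps)


section \<open>Heisenberg--Clifford algebras\<close>

datatype 'a free_monoid = Word "'a list"

instantiation free_monoid :: (type) monoid_add
begin

definition zero_free_monoid :: "'a free_monoid" where "0 = Word []"

fun plus_free_monoid :: "'a free_monoid \<Rightarrow> 'a free_monoid \<Rightarrow> 'a free_monoid" where
  "Word u + Word v = Word (u @ v)"

instance
proof
  fix a b c :: "'a free_monoid"
  show "a + b + c = a + (b + c)" by (cases a; cases b; cases c) simp
  show "0 + a = a" "a + 0 = a" by (cases a; simp add: zero_free_monoid_def)+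
qed

end

text \<open>The free associative algebra over the complex numbers, as the monoid algebra of the free
  monoid; its ring structure is that of \<^theory>\<open>HOL-Library.Poly_Mapping\<close>.\<close>

type_synonym 'a free_alg = "'a free_monoid \<Rightarrow>\<^sub>0 complex"

definition scalar :: "complex \<Rightarrow> 'a free_alg" where
  "scalar c = Poly_Mapping.single 0 c"

definition xgen :: "'a \<Rightarrow> 'a free_alg" where
  "xgen i = Poly_Mapping.single (Word [i]) 1"

definition lin_form :: "complex ^ 'a::finite \<Rightarrow> 'a free_alg" where
  "lin_form v = (\<Sum>i\<in>UNIV. scalar (v $ i) * xgen i)"

definition free_alg_ring :: "'a free_alg ring" where
  "free_alg_ring = \<lparr>carrier = UNIV, monoid.mult = (*), one = 1, zero = 0, add = (+)\<rparr>"

text \<open>The relations with parameters \<open>(a_0, \<dots>, a_((p-1)/2))\<close>, written in a family \<open>g\<close> of elements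
  of the free algebra in place of the generators \<open>x_i\<close>.\<close>

definition clifford_relators ::
    "(nat \<Rightarrow> complex) \<Rightarrow> ('p::prime_card mod_ring \<Rightarrow> 'p mod_ring free_alg) \<Rightarrow> 'p mod_ring free_alg set"
  where
  "clifford_relators a g =
     {scalar (a 0) * (g j * g (j + of_nat i) + g (j + of_nat i) * g j)
        - scalar (a i) * g (j + of_nat i / 2) ^ 2 | i j. i \<in> {1..(CARD('p) - 1) div 2}} \<union>
     {scalar (a m) * (g (k - of_nat i / 2) * g (k + of_nat i / 2) + g (k + of_nat i / 2) * g (k - of_nat i / 2))
        - scalar (a i) * (g (k - of_nat m / 2) * g (k + of_nat m / 2) + g (k + of_nat m / 2) * g (k - of_nat m / 2))
        | i m k. i \<in> {1..(CARD('p) - 1) div 2} \<and> m \<in> {1..(CARD('p) - 1) div 2}}"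

definition clifford_presented ::
    "(nat \<Rightarrow> complex) \<Rightarrow> ('p::prime_card mod_ring \<Rightarrow> 'p mod_ring free_alg) \<Rightarrow> 'p mod_ring free_alg set ring"
  where
  "clifford_presented a g = free_alg_ring Quot (Idl\<^bsub>free_alg_ring\<^esub> (clifford_relators a g))"

definition heis_clifford_algebra ::
    "(nat \<Rightarrow> complex) \<Rightarrow> 'p::prime_card mod_ring free_alg set ring" where
  "heis_clifford_algebra a = clifford_presented a xgen"


section \<open>Projective space\<close>

text \<open>Points of complex projective \<open>n\<close>-space are the classes \<open>proj_pt a\<close> of coordinate vectors
  \<open>(a_0, \<dots>, a_n)\<close>, which are extended by zero beyond \<open>n\<close>.\<close>

definition coord_vecs :: "nat \<Rightarrow> (nat \<Rightarrow> complex) set" where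
  "coord_vecs n = {a. (\<exists>i. a i \<noteq> 0) \<and> (\<forall>i>n. a i = 0)}"

definition proj_pt :: "(nat \<Rightarrow> complex) \<Rightarrow> (nat \<Rightarrow> complex) set" where
  "proj_pt a = {(\<lambda>i. c * a i) | c. c \<noteq> 0}"

definition base_pt :: "(nat \<Rightarrow> complex) set" where
  "base_pt = proj_pt (\<lambda>i. if i = 0 then 1 else 0)"

definition base_hyperplane :: "nat \<Rightarrow> (nat \<Rightarrow> complex) set set" where
  "base_hyperplane n = proj_pt ` {a \<in> coord_vecs n. a 0 = 0}"


section \<open>Right actions\<close>

definition right_action :: "('g, 'm) monoid_scheme \<Rightarrow> 'x set \<Rightarrow> ('x \<Rightarrow> 'g \<Rightarrow> 'x) \<Rightarrow> bool" where
  "right_action G X act \<longleftrightarrow> group G \<and>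
     (\<forall>x\<in>X. \<forall>g\<in>carrier G. act x g \<in> X) \<and>
     (\<forall>x\<in>X. act x \<one>\<^bsub>G\<^esub> = x) \<and>
     (\<forall>x\<in>X. \<forall>g\<in>carrier G. \<forall>h\<in>carrier G. act x (g \<otimes>\<^bsub>G\<^esub> h) = act (act x g) h)"

definition right_orbit :: "('g, 'm) monoid_scheme \<Rightarrow> ('x \<Rightarrow> 'g \<Rightarrow> 'x) \<Rightarrow> 'x \<Rightarrow> 'x set" where
  "right_orbit G act x = {act x g | g. g \<in> carrier G}"

definition gset_iso ::
    "('g, 'm) monoid_scheme \<Rightarrow> 'x set \<Rightarrow> ('x \<Rightarrow> 'g \<Rightarrow> 'x) \<Rightarrow> 'y set \<Rightarrow> ('y \<Rightarrow> 'g \<Rightarrow> 'y) \<Rightarrow> ('x \<Rightarrow> 'y) \<Rightarrow> bool"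
  where
  "gset_iso G X actX Y actY f \<longleftrightarrow>
     right_action G X actX \<and> right_action G Y actY \<and> bij_betw f X Y \<and>
     (\<forall>x\<in>X. \<forall>g\<in>carrier G. f (actX x g) = actY (f x) g)"


section \<open>\<open>PSL_2(p)\<close> and its actions\<close>

definition SL2 :: "('p::prime_card mod_ring ^ 2 ^ 2) monoid" where
  "SL2 = \<lparr>carrier = {A. det A = 1}, monoid.mult = (**), one = mat 1\<rparr>"

definition PSL2 :: "('p::prime_card mod_ring ^ 2 ^ 2) set monoid" where
  "PSL2 = SL2 Mod {mat 1, - mat 1}"

definition heis_lifts :: "'p::prime_card mod_ring ^ 2 ^ 2 \<Rightarrow> ('p heis \<Rightarrow> 'p heis) set" where
  "heis_lifts A = {f \<in> iso heis heis. f hz = hz \<and> (\<forall>h. heis_ab (f h) = A *v heis_ab h)}"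

text \<open>\<open>sl2_moves A P Q\<close>: for some choice of the automorphism \<open>f\<close> of \<^const>\<open>heis\<close> lifting \<open>A\<close> and of
  the vector \<open>y_0\<close>, rewriting the algebra with parameters \<open>P\<close> in the generators
  \<open>y_i = f(e1)^(-i) y_0\<close> gives parameters \<open>Q\<close>. Both sides of the last conjunct are quotients of the
  same free algebra, so that their equality means that the two sets of relations generate the
  same ideal.\<close>

definition sl2_moves ::
    "'p::prime_card mod_ring ^ 2 ^ 2 \<Rightarrow> (nat \<Rightarrow> complex) set \<Rightarrow> (nat \<Rightarrow> complex) set \<Rightarrow> bool" where
  "sl2_moves A P Q \<longleftrightarrow>
     (\<exists>a\<in>coord_vecs ((CARD('p) - 1) div 2). \<exists>a'\<in>coord_vecs ((CARD('p) - 1) div 2).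
        P = proj_pt a \<and> Q = proj_pt a' \<and>
        (\<exists>f\<in>heis_lifts A. \<exists>y0. y0 \<noteq> 0 \<and> heis_rep (f e2) y0 = y0 \<and>
           heis_clifford_algebra a =
             clifford_presented a'
               (\<lambda>i. lin_form (heis_rep (f e1 [^]\<^bsub>heis\<^esub> (- to_int_mod_ring i)) y0))))"

text \<open>The new parameters do not depend on the choices nor on the representative \<open>A\<close> in the
  coset \<open>g\<close>, hence the definite description.\<close>

definition pt_act :: "(nat \<Rightarrow> complex) set \<Rightarrow> ('p::prime_card mod_ring ^ 2 ^ 2) set \<Rightarrow> (nat \<Rightarrow> complex) set" where
  "pt_act P g = (THE Q. \<exists>A\<in>g. sl2_moves A P Q)"

definition hyperplane_act ::
    "(nat \<Rightarrow> complex) set set \<Rightarrow> ('p::prime_card mod_ring ^ 2 ^ 2) set \<Rightarrow> (nat \<Rightarrow> complex) set set" where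
  "hyperplane_act H g = (\<lambda>P. pt_act P g) ` H"

definition proj_line :: "('p::prime_card mod_ring ^ 2) set set" where
  "proj_line = {L. vec.subspace L \<and> vec.dim L = 1}"

definition line_left_act ::
    "('p::prime_card mod_ring ^ 2 ^ 2) set \<Rightarrow> ('p mod_ring ^ 2) set \<Rightarrow> ('p mod_ring ^ 2) set" where
  "line_left_act g L = (THE M. \<exists>A\<in>g. M = (*v) A ` L)"

definition line_act ::
    "('p::prime_card mod_ring ^ 2) set \<Rightarrow> ('p mod_ring ^ 2 ^ 2) set \<Rightarrow> ('p mod_ring ^ 2) set" where
  "line_act L g = line_left_act (inv\<^bsub>PSL2\<^esub> g) L"

end

theory Submission
  imports Defs
begin

text \<open>
  Let \<open>V\<close> be the given representation of the Heisenberg group \<open>H\<close>. A quadratic form in the \<open>x_i\<close> is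
  written as a matrix \<open>M\<close>, and the parameters \<open>a\<close> are extended to an even function \<open>b\<close> on \<open>\<int>/p\<close> with
  \<open>b(0) = 2 a_0\<close> and \<open>b(\<plusminus> i) = a_i\<close>. In the algebra, all the \<open>x_(k-i/2) x_(k+i/2) + x_(k+i/2) x_(k-i/2)\<close>
  with a fixed \<open>k\<close> are proportional, in the ratio \<open>b(i)\<close>. Hence the relations in degree two are exactly
  the symmetric matrices in the kernel of the map \<open>contract b\<close>, whose \<open>l\<close>-th coordinate is the sum
  over \<open>m\<close> of \<open>b(m)\<close> times the coefficient of \<open>x_(l-m/2) x_(l+m/2)\<close>. As the ideal is generated in degree two, it
  determines this kernel, and the kernel determines \<open>b\<close> up to a scalar.

  The point of this description is that \<open>contract b\<close> is an \<open>H\<close>-equivariant map from \<open>V \<otimes> V\<close> to the irreducible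
  representation \<open>V'\<close> on which \<open>z\<close> acts by \<open>\<omega>\<^sup>2\<close> (\<open>contract_hrep\<close>). An automorphism \<open>f\<close> of \<open>H\<close> that fixes \<open>z\<close> has
  intertwiners \<open>T\<close> on \<open>V\<close> and \<open>T'\<close> on \<open>V'\<close>; each is determined up to a scalar by a vector fixed by \<open>f(e2)\<close>,
  and these vectors form a line. By Schur's lemma, made explicit on eigenvectors of \<open>f(e2)\<close>,
  \<open>contract b\<close> after \<open>T \<otimes> T\<close> equals \<open>T'\<close> after \<open>contract b'\<close> for an even \<open>b'\<close> that is unique up to a scalar
  (\<open>moves_exists\<close>, \<open>moves_unique\<close>). Since the generators \<open>y_i\<close> are the vectors \<open>T x_i\<close>, this \<open>b'\<close> gives the new
  parameters (\<open>clifford_presentations_agree_iff\<close>). Composing intertwiners shows that a right action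
  results, once lifts of \<open>\<plusminus> 1\<close> are seen to act trivially (\<open>moves_lift_of_sign\<close>, \<open>right_action_pt_act\<close>).

  It remains to compare stabilisers, because transitive right actions with the same point stabiliser
  are isomorphic (\<open>orbits_iso_of_equal_stabilizers\<close>). The base point, the base hyperplane and the line
  spanned by \<open>(0,1)\<close> are all stabilised by exactly those matrices whose upper right entry vanishes.
  If \<open>A\<close> has this property then \<open>f(e2)\<close> lies in \<open>\<langle>e2, z\<rangle>\<close>, so that \<open>T\<close> is monomial and permutes the lines
  spanned by the \<open>x_i\<close>; this preserves the point, whose algebra has anticommuting generators,
  and the hyperplane, on which the generators square to zero. Otherwise no entry of \<open>T\<close> vanishes, and
  neither property survives.
\<close>

section \<open>Representations of the Heisenberg group\<close>

text \<open>The Heisenberg representation with central character \<open>z \<mapsto> \<omega>^s\<close>. The case \<open>s = 1\<close> is \<^const>\<open>heis_rep\<close>; the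
  case \<open>s = 2\<close> is the target of the contractions of quadratic forms.\<close>

definition hrep :: "'p::prime_card mod_ring \<Rightarrow> 'p heis \<Rightarrow> complex ^ 'p mod_ring \<Rightarrow> complex ^ 'p mod_ring"
  where "hrep s h v = (case h of (a, b, c) \<Rightarrow> \<chi> j. omega_pow (s * (c + b * (j + a))) * v $ (j + a))"

lemma hrep_nth [simp]: "hrep s (a, b, c) v $ j = omega_pow (s * (c + b * (j + a))) * v $ (j + a)"
  by (simp add: hrep_def)

lemma heis_rep_eq_hrep: "heis_rep = hrep 1"
  by (intro ext) (simp add: heis_rep_def hrep_def)

lemma hrep_mult: "hrep s (g \<otimes>\<^bsub>heis\<^esub> h) v = hrep s g (hrep s h v)"
  by (cases g; cases h)
     (simp add: vec_eq_iff omega_pow_simps(2)[symmetric] algebra_simps)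

lemma hrep_scale: "hrep s h (c *s v) = c *s hrep s h v"
  by (cases h) (simp add: vec_eq_iff)

lemma hrep_zero [simp]: "hrep s h 0 = 0"
  by (cases h) (simp add: vec_eq_iff)

lemma hrep_sum: "hrep s h (\<Sum>i\<in>I. v i) = (\<Sum>i\<in>I. hrep s h (v i))"
  by (cases h) (simp add: vec_eq_iff sum_distrib_left)

lemma hrep_central: "hrep s (0, 0, c) v = omega_pow (s * c) *s v"
  by (simp add: vec_eq_iff)

lemma hrep_shift_axis: "hrep s (- k, 0, 0) (axis 0 1) = axis k 1"
  by (auto simp: vec_eq_iff axis_def omega_pow_simps)

lemma hrep_one [simp]: "hrep s (0, 0, 0) v = v"
  by (simp add: vec_eq_iff omega_pow_simps)

lemma omega_pow_nonzero [simp]: "omega_pow i \<noteq> 0"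
  by (simp add: omega_pow_def)

lemma omega_pow_eq_1_iff: "omega_pow (i :: 'p::prime_card mod_ring) = 1 \<longleftrightarrow> i = 0"
proof -
  obtain n where n: "i = of_nat n" by (rule mod_ring_nat_cases)
  have p: "1 \<le> CARD('p)" using finite_UNIV_card_ge_0[where 'a='p] by simp
  have "omega_pow i = exp (2 * of_real pi * \<i> * of_nat n / of_nat CARD('p))"
    by (simp add: n omega_pow_of_nat exp_of_nat_mult[symmetric] mult_ac)
  then have "omega_pow i = 1 \<longleftrightarrow> CARD('p) dvd n"
    using complex_root_unity_eq_1[OF p] by simp
  also have "\<dots> \<longleftrightarrow> i = 0"
    using of_nat_mod_ring_eq_iff[of n 0, where 'p='p] n by (simp add: dvd_eq_mod_eq_0)
  finally show ?thesis .
qed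

lemma sum_omega_pow:
  assumes "(i :: 'p::prime_card mod_ring) \<noteq> 0"
  shows "(\<Sum>b\<in>UNIV. omega_pow (i * b)) = 0"
proof -
  let ?S = "\<Sum>b\<in>UNIV. omega_pow (i * b)"
  have "?S = (\<Sum>b\<in>UNIV. omega_pow (i * (b + 1)))"
    by (rule sum.reindex_bij_witness[of _ "\<lambda>b. b + 1" "\<lambda>b. b - 1"]) auto
  also have "\<dots> = omega_pow i * ?S"
    by (simp add: distrib_left omega_pow_simps sum_distrib_left mult.commute)
  finally have "(1 - omega_pow i) * ?S = 0"
    by (simp add: algebra_simps)
  then show ?thesis
    using assms by (simp add: omega_pow_eq_1_iff)
qed

section \<open>Automorphisms that fix the centre\<close>

definition heis_auts :: "('p::prime_card heis \<Rightarrow> 'p heis) set" where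
  "heis_auts = {f \<in> iso heis heis. f hz = hz}"

lemma heis_lifts_auts: "f \<in> heis_lifts A \<Longrightarrow> f \<in> heis_auts"
  by (simp add: heis_lifts_def heis_auts_def)

lemma heis_aut_mult:
  "f \<in> heis_auts \<Longrightarrow> f (g \<otimes>\<^bsub>heis\<^esub> h) = f g \<otimes>\<^bsub>heis\<^esub> f h"
  using hom_mult[of f heis heis g h] by (simp add: heis_auts_def iso_def del: heis_simps(3))

lemma heis_aut_bij: "f \<in> heis_auts \<Longrightarrow> bij f"
  by (simp add: heis_auts_def iso_def)

lemma heis_aut_hom: "f \<in> heis_auts \<Longrightarrow> group_hom heis heis f"
  by (simp add: group_hom_def group_hom_axioms_def heis_group heis_auts_def iso_def)

lemma heis_aut_central:
  assumes "f \<in> heis_auts" shows "f (0, 0, c) = (0, 0, c)"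
proof -
  interpret group_hom heis heis f by (rule heis_aut_hom[OF assms])
  obtain n where n: "c = of_nat n" by (rule mod_ring_nat_cases)
  have "(0, 0, c) = hz [^]\<^bsub>heis\<^esub> n" by (simp add: n hz_def heis_pow)
  then show ?thesis using assms by (simp add: hom_nat_pow heis_auts_def)
qed

lemma heis_aut_e2_noncentral:
  assumes "f \<in> heis_auts" "f e2 = (a, b, c)" shows "a \<noteq> 0 \<or> b \<noteq> 0"
proof (rule ccontr)
  assume "\<not> ?thesis"
  then have "f e2 = f (0, 0, c)" using assms by (simp add: heis_aut_central)
  then have "e2 = (0, 0, c)" using heis_aut_bij[OF assms(1)] by (simp add: bij_def inj_eq)
  then show False by (simp add: e2_def)
qed

section \<open>Vectors fixed by a noncentral element\<close>

text \<open>A nonzero \<open>a\<close> generates the additive group of integers modulo \<open>p\<close>.\<close>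

lemma shift_invariant_const:
  fixes a :: "'p::prime_card mod_ring"
  assumes "a \<noteq> 0" "\<And>j. Q (j + a) = Q j"
  shows "Q j = Q 0"
proof -
  obtain n where n: "j / a = of_nat n" by (rule mod_ring_nat_cases)
  have "Q (of_nat n * a) = Q 0"
  proof (induction n)
    case (Suc n)
    then show ?case using assms(2)[of "of_nat n * a"] by (simp add: algebra_simps)
  qed simp
  then show ?thesis using n assms(1) by (metis nonzero_eq_divide_eq)
qed

lemma fixed_vec_nowhere_zero:
  assumes "a \<noteq> 0" "hrep s (a, b, c) t = t" "t \<noteq> 0"
  shows "t $ j \<noteq> 0"
proof
  assume j: "t $ j = 0"
  have "(t $ (i + a) = 0) = (t $ i = 0)" for i
  proof -
    have "t $ i = omega_pow (s * (c + b * (i + a))) * t $ (i + a)"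
      using assms(2) by (metis hrep_nth)
    then show ?thesis by simp
  qed
  from shift_invariant_const[of a "\<lambda>i. t $ i = 0", OF assms(1) this]
  have "t $ i = 0" for i using j by metis
  then show False using assms(3) by (simp add: vec_eq_iff)
qed

lemma fixed_vec_support:
  assumes "s \<noteq> 0" "hrep s (0, b, c) t = t" "t $ j \<noteq> 0"
  shows "b * j = - c"
proof -
  have "t $ j = omega_pow (s * (c + b * j)) * t $ j"
    using assms(2) by (metis add.right_neutral hrep_nth)
  then have "omega_pow (s * (c + b * j)) = 1" using assms(3) by simp
  then show ?thesis using assms(1) by (simp add: omega_pow_eq_1_iff eq_neg_iff_add_eq_0 add.commute)
qed

text \<open>If \<open>a = 0\<close> the element acts diagonally and one coordinate vector is fixed. Otherwise the coordinates
  \<open>\<omega>^(s q(j))\<close> with a quadratic polynomial \<open>q\<close> are fixed if \<open>q\<close> solves the difference equation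
  \<open>q(j) = c + b (j + a) + q(j + a)\<close>.\<close>

lemma fixed_vec_exists:
  fixes s :: "'p::prime_card mod_ring"
  assumes two: "(2 :: 'p mod_ring) \<noteq> 0" and "a \<noteq> 0 \<or> b \<noteq> 0"
  shows "\<exists>t. t \<noteq> 0 \<and> hrep s (a, b, c) t = t"
proof (cases "a = 0")
  case True
  then have b: "b \<noteq> 0" using assms by simp
  show ?thesis
  proof (intro exI conjI)
    show "axis (- c / b) 1 \<noteq> (0 :: complex ^ 'p mod_ring)" by (simp add: axis_eq_0_iff)
    show "hrep s (a, b, c) (axis (- c / b) 1) = axis (- c / b) 1"
      using True b by (auto simp: vec_eq_iff axis_def omega_pow_simps)
  qed
next
  case False
  \<comment> \<open>Comparing coefficients of \<open>j\<close> in the difference equation gives \<open>\<alpha>\<close>, the constant term gives \<open>\<beta>\<close>.\<close>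
  define \<alpha> where "\<alpha> = - b / (2 * a)"
  define \<beta> where "\<beta> = - c / a - b / 2"
  have \<alpha>: "2 * (\<alpha> * a) = - b" using False two by (simp add: \<alpha>_def)
  have a2: "\<alpha> * a = - b / 2" using False by (simp add: \<alpha>_def)
  have b2: "b / 2 + b / 2 = b" using two by (simp add: field_simps)
  have \<beta>: "\<beta> * a = - c - b * a / 2" using False two by (simp add: \<beta>_def field_simps)
  define q where "q j = \<alpha> * j\<^sup>2 + \<beta> * j" for j
  have q: "c + b * (j + a) + q (j + a) = q j" for j
  proof -
    have "q (j + a) - q j = 2 * (\<alpha> * a) * j + (\<alpha> * a) * a + \<beta> * a"
      by (simp add: q_def power2_eq_square algebra_simps)
    also have "\<dots> = - b * j - (b / 2 + b / 2) * a - c"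
      unfolding \<alpha> a2 \<beta> using two by (simp add: algebra_simps)
    finally show ?thesis unfolding b2 by (simp add: algebra_simps)
  qed
  show ?thesis
  proof (intro exI conjI)
    let ?t = "(\<chi> j. omega_pow (s * q j)) :: complex ^ 'p mod_ring"
    have "?t $ 0 \<noteq> 0" by simp
    then show "?t \<noteq> 0" by (metis zero_index)
    show "hrep s (a, b, c) ?t = ?t"
      unfolding vec_eq_iff hrep_nth vec_lambda_beta omega_pow_simps(2)[symmetric] distrib_left[symmetric] q
      by simp
  qed
qed

text \<open>If \<open>a = 0\<close> a fixed vector is supported in a single coordinate. Otherwise the element shifts the
  coordinates, up to factors that cancel in the quotient of two fixed vectors, so that this quotient
  is constant.\<close>

lemma fixed_vec_unique:
  assumes s: "s \<noteq> 0" and nc: "a \<noteq> 0 \<or> b \<noteq> 0" and t: "t \<noteq> 0" "hrep s (a, b, c) t = t"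
    and u: "hrep s (a, b, c) u = u"
  shows "\<exists>k. u = k *s t"
proof (cases "a = 0")
  case True
  then have b: "b \<noteq> 0" using nc by simp
  have supp: "v $ j = 0" if "hrep s (a, b, c) v = v" "j \<noteq> - c / b" for v j
    using fixed_vec_support[of s b c v j] that b s True by (auto simp: field_simps)
  have nz: "t $ (- c / b) \<noteq> 0"
  proof
    assume "t $ (- c / b) = 0"
    then have "t $ j = 0" for j using supp[OF t(2), of j] by (cases "j = - c / b") auto
    then show False using t(1) by (simp add: vec_eq_iff)
  qed
  define k where "k = u $ (- c / b) / t $ (- c / b)"
  have "u $ j = k * t $ j" for j
  proof (cases "j = - c / b")
    case True
    show ?thesis unfolding True k_def using nz by simp
  next
    case False
    show ?thesis unfolding supp[OF u False] supp[OF t(2) False] by simp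
  qed
  then have "u = k *s t" by (simp add: vec_eq_iff)
  then show ?thesis ..
next
  case False
  note nz = fixed_vec_nowhere_zero[OF False t(2,1)]
  have "u $ (j + a) / t $ (j + a) = u $ j / t $ j" for j
  proof -
    have "u $ j = omega_pow (s * (c + b * (j + a))) * u $ (j + a)"
      "t $ j = omega_pow (s * (c + b * (j + a))) * t $ (j + a)"
      using u t(2) by (metis hrep_nth)+
    then show ?thesis by simp
  qed
  then have "u $ j / t $ j = u $ 0 / t $ 0" for j
    by (rule shift_invariant_const[OF False, where Q = "\<lambda>j. u $ j / t $ j"])
  moreover define k where "k = u $ 0 / t $ 0"
  ultimately have "u $ j = k * t $ j" for j
    using nz[of j] by (metis nonzero_eq_divide_eq)
  then have "u = k *s t" by (simp add: vec_eq_iff)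
  then show ?thesis ..
qed

section \<open>Intertwining operators\<close>

definition intertwiner ::
    "'p::prime_card mod_ring \<Rightarrow> ('p heis \<Rightarrow> 'p heis) \<Rightarrow> complex ^ 'p mod_ring ^ 'p mod_ring \<Rightarrow> bool"
  where "intertwiner s f T \<longleftrightarrow> T \<noteq> 0 \<and> (\<forall>h v. T *v hrep s h v = hrep s (f h) (T *v v))"

lemma intertwiner_axis:
  assumes "intertwiner s f T"
  shows "T *v axis k 1 = hrep s (f (- k, 0, 0)) (T *v axis 0 1)"
  using assms hrep_shift_axis[of s k] unfolding intertwiner_def by metis

lemma matrix_vec_axis: "(T *v axis k 1) $ j = (T :: complex ^ 'a::finite ^ 'b) $ j $ k"
  by (simp add: matrix_vector_mult_def axis_def if_distrib cong: if_cong)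

lemma intertwiner_axis_0:
  assumes "intertwiner s f T"
  shows "T *v axis 0 1 \<noteq> 0" "hrep s (f e2) (T *v axis 0 1) = T *v axis 0 1"
proof
  assume 0: "T *v axis 0 1 = 0"
  have "T *v axis k 1 = 0" for k
    unfolding intertwiner_axis[OF assms, of k] 0 by simp
  then have "T $ j $ k = 0" for j k by (metis matrix_vec_axis zero_index)
  then show False using assms by (auto simp: intertwiner_def vec_eq_iff)
next
  have "hrep s e2 (axis 0 1) = axis 0 1"
    by (auto simp: e2_def vec_eq_iff axis_def omega_pow_simps)
  then show "hrep s (f e2) (T *v axis 0 1) = T *v axis 0 1"
    using assms unfolding intertwiner_def by metis
qed

text \<open>The columns \<open>y_k = f(e1)^(-k) t\<close> are the new generators of the algebra, so the matrix of the change of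
  generators intertwines the representation with its twist by \<open>f\<close>. Every element of \<open>H\<close> times \<open>e1^(-k)\<close> can be
  rewritten as \<open>e1^(a-k) e2^b z^(c+bk)\<close>, and the image of the second factor under \<open>f\<close> fixes \<open>t\<close>.\<close>

lemma intertwiner_from_fixed_vec:
  fixes f :: "'p::prime_card heis \<Rightarrow> 'p heis"
  assumes f: "f \<in> heis_auts" and t: "t \<noteq> 0" "hrep s (f e2) t = t"
  shows "intertwiner s f (\<chi> j k. hrep s (f (- k, 0, 0)) t $ j)" (is "intertwiner s f ?T")
  unfolding intertwiner_def
proof (intro conjI allI)
  interpret group_hom heis heis f by (rule heis_aut_hom[OF f])
  have f0: "f (0, 0, 0) = (0, 0, 0)" using heis_aut_central[OF f] .
  have "?T $ j $ 0 = t $ j" for j by (simp add: f0)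
  then show "?T \<noteq> 0" using t(1) by (metis vec_eq_iff zero_index)
  have Tv: "?T *v v = (\<Sum>k\<in>UNIV. v $ k *s hrep s (f (- k, 0, 0)) t)" for v
    by (simp add: vec_eq_iff matrix_vector_mult_def mult.commute)
  have t_b: "hrep s (f (0, b, 0)) t = t" for b
  proof -
    obtain n where n: "b = of_nat n" by (rule mod_ring_nat_cases)
    have "hrep s (f (0, of_nat n, 0)) t = t"
    proof (induction n)
      case (Suc n)
      have "((0, of_nat (Suc n), 0) :: 'p heis) = e2 \<otimes>\<^bsub>heis\<^esub> (0, of_nat n, 0)" by (simp add: e2_def)
      then have "hrep s (f (0, of_nat (Suc n), 0)) t = hrep s (f e2) (hrep s (f (0, of_nat n, 0)) t)"
        by (simp only: heis_aut_mult[OF f] hrep_mult)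
      then show ?case using Suc t(2) by simp
    qed (simp add: f0)
    then show ?thesis by (simp add: n)
  qed
  fix h :: "'p heis" and v
  obtain a b c where h: "h = (a, b, c)" by (cases h)
  have y: "hrep s (f h) (hrep s (f (- k, 0, 0)) t) = omega_pow (s * (c + b * k)) *s hrep s (f (a - k, 0, 0)) t" for k
  proof -
    have "h \<otimes>\<^bsub>heis\<^esub> (- k, 0, 0) = (a - k, 0, 0) \<otimes>\<^bsub>heis\<^esub> ((0, b, 0) \<otimes>\<^bsub>heis\<^esub> (0, 0, c + b * k))"
      by (simp add: h)
    then have "hrep s (f (h \<otimes>\<^bsub>heis\<^esub> (- k, 0, 0))) t
        = hrep s (f ((a - k, 0, 0) \<otimes>\<^bsub>heis\<^esub> ((0, b, 0) \<otimes>\<^bsub>heis\<^esub> (0, 0, c + b * k)))) t"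
      by (simp only:)
    then show ?thesis
      unfolding heis_aut_mult[OF f] hrep_mult heis_aut_central[OF f] hrep_central hrep_scale t_b .
  qed
  have "hrep s (f h) (?T *v v) = (\<Sum>k\<in>UNIV. (v $ k * omega_pow (s * (c + b * k))) *s hrep s (f (a - k, 0, 0)) t)"
    unfolding Tv hrep_sum hrep_scale y by simp
  also have "\<dots> = (\<Sum>j\<in>UNIV. (v $ (j + a) * omega_pow (s * (c + b * (j + a)))) *s hrep s (f (- j, 0, 0)) t)"
    by (rule sum.reindex_bij_witness[of _ "\<lambda>j. j + a" "\<lambda>k. k - a"]) auto
  also have "\<dots> = ?T *v hrep s h v"
    unfolding Tv by (simp add: h mult.commute)
  finally show "?T *v hrep s h v = hrep s (f h) (?T *v v)" ..
qed

lemma intertwiner_exists: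
  fixes s :: "'p::prime_card mod_ring"
  assumes "(2 :: 'p mod_ring) \<noteq> 0" "f \<in> heis_auts"
  shows "\<exists>T. intertwiner s f T"
proof -
  obtain a b c where e2: "f e2 = (a, b, c)" by (cases "f e2")
  from fixed_vec_exists[OF assms(1) heis_aut_e2_noncentral[OF assms(2) e2]]
  obtain t where "t \<noteq> 0" "hrep s (f e2) t = t" unfolding e2 by blast
  then show ?thesis using intertwiner_from_fixed_vec[OF assms(2)] by blast
qed

lemma intertwiner_unique:
  assumes s: "s \<noteq> 0" and f: "f \<in> heis_auts" and T: "intertwiner s f T" and S: "intertwiner s f S"
  shows "\<exists>c. c \<noteq> 0 \<and> (\<forall>j k. S $ j $ k = c * T $ j $ k)"
proof -
  obtain a b c where e2: "f e2 = (a, b, c)" by (cases "f e2")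
  obtain d where d: "S *v axis 0 1 = d *s (T *v axis 0 1)"
    using fixed_vec_unique[OF s heis_aut_e2_noncentral[OF f e2] intertwiner_axis_0[OF T, unfolded e2]
      intertwiner_axis_0(2)[OF S, unfolded e2]] by blast
  have "d \<noteq> 0" using d intertwiner_axis_0(1)[OF S] by auto
  moreover have "S *v axis k 1 = d *s (T *v axis k 1)" for k
    unfolding intertwiner_axis[OF S, of k] intertwiner_axis[OF T, of k] d hrep_scale ..
  then have "S $ j $ k = d * T $ j $ k" for j k
    by (metis matrix_vec_axis vector_smult_component)
  ultimately show ?thesis by blast
qed

text \<open>Summing over the powers of \<open>e2\<close>, with suitable scalars, is \<open>p\<close> times the projection to one eigenline;
  this is what makes the representation irreducible.\<close>

lemma isotypic_component:
  fixes v :: "complex ^ 'p::prime_card mod_ring"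
  assumes "s \<noteq> 0"
  shows "(\<Sum>b\<in>UNIV. hrep s (0, b, - b * k) v) = (of_nat CARD('p) * v $ k) *s axis k 1"
proof -
  have "(\<Sum>b\<in>UNIV. omega_pow (s * (- b * k + b * (j + 0)))) = (if j = k then of_nat CARD('p) else 0)" for j
  proof (cases "j = k")
    case False
    have "(\<Sum>b\<in>UNIV. omega_pow (s * (- b * k + b * (j + 0)))) = (\<Sum>b\<in>UNIV. omega_pow (s * (j - k) * b))"
      by (simp add: algebra_simps)
    then show ?thesis using sum_omega_pow[of "s * (j - k)"] False assms by simp
  qed (simp add: omega_pow_simps)
  then show ?thesis
    by (auto simp: vec_eq_iff axis_def simp flip: sum_distrib_right)
qed

text \<open>The kernel is invariant under \<open>H\<close>, so a nonzero vector in it would put some \<open>x_k\<close>, and then all of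
  them, into it.\<close>

lemma intertwiner_inj:
  assumes s: "s \<noteq> 0" and T: "intertwiner s f T" and v: "T *v v = 0"
  shows "v = 0"
proof (rule ccontr)
  assume "v \<noteq> 0"
  then obtain k where k: "v $ k \<noteq> 0" by (auto simp: vec_eq_iff)
  have "T *v (\<Sum>b\<in>UNIV. hrep s (0, b, - b * k) v) = (\<Sum>b\<in>UNIV. T *v hrep s (0, b, - b * k) v)"
    by (rule vec.linear_sum[OF matrix_vector_mul_linear_gen])
  also have "\<dots> = 0" using T v by (simp add: intertwiner_def)
  finally have "T *v axis k 1 = 0"
    using k unfolding isotypic_component[OF s] by (simp add: vector_scalar_commute)
  moreover have "axis 0 1 = hrep s (k, 0, 0) (axis k 1)"
    by (auto simp: vec_eq_iff axis_def omega_pow_simps)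
  ultimately have "T *v axis 0 1 = 0" using T by (simp add: intertwiner_def)
  then show False using intertwiner_axis_0(1)[OF T] by simp
qed

lemma intertwiner_invertible:
  assumes "s \<noteq> 0" "intertwiner s f T" shows "invertible T"
  using intertwiner_inj[OF assms] matrix_left_invertible_ker invertible_left_inverse by metis

lemma intertwiner_comp:
  assumes "s \<noteq> 0" "intertwiner s f T" "intertwiner s g S"
  shows "intertwiner s (f \<circ> g) (T ** S)"
proof -
  have "(T ** S) *v axis 0 1 \<noteq> 0"
    using intertwiner_inj[OF assms(1,2)] intertwiner_axis_0(1)[OF assms(3)]
    by (metis matrix_vector_mul_assoc)
  then have "T ** S \<noteq> 0" by auto
  moreover have "(T ** S) *v hrep s h v = hrep s ((f \<circ> g) h) ((T ** S) *v v)" for h v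
    using assms(2,3) unfolding intertwiner_def matrix_vector_mul_assoc[symmetric] o_def by metis
  ultimately show ?thesis by (simp add: intertwiner_def)
qed

section \<open>Contraction of quadratic forms\<close>

text \<open>The tensor \<open>v \<otimes> w\<close> as a matrix; \<open>T \<otimes> T\<close> then becomes the congruence by \<open>T\<close>.\<close>

definition outer :: "complex ^ 'n \<Rightarrow> complex ^ 'n \<Rightarrow> complex ^ 'n ^ 'n" where
  "outer v w = (\<chi> i j. v $ i * w $ j)"

lemma congruence_outer: "T ** outer v w ** transpose T = outer (T *v v) (T *v w)"
  by (simp add: vec_eq_iff matrix_matrix_mult_def matrix_vector_mult_def outer_def transpose_def
      sum_product sum_distrib_left sum_distrib_right mult_ac)

text \<open>The coefficients of a quadratic form are indexed by midpoint \<open>l\<close> and difference \<open>m\<close>. Contraction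
  replaces each \<open>x_(l-m/2) x_(l+m/2)\<close> by \<open>b(m)\<close> times one new basis vector \<open>X_l\<close>.\<close>

definition contract ::
    "('p::prime_card mod_ring \<Rightarrow> complex) \<Rightarrow> complex ^ 'p mod_ring ^ 'p mod_ring \<Rightarrow> complex ^ 'p mod_ring"
  where "contract b M = (\<chi> l. \<Sum>m\<in>UNIV. b m * M $ (l - m / 2) $ (l + m / 2))"

lemma contract_outer_scale: "contract b (outer (c *s v) (d *s w)) = (c * d) *s contract b (outer v w)"
  by (simp add: contract_def outer_def vec_eq_iff sum_distrib_left mult_ac)

lemma half_add_half: "(2 :: 'p::prime_card mod_ring) \<noteq> 0 \<Longrightarrow> i / 2 + i / 2 = (i :: 'p mod_ring)"
  by (simp add: field_simps)

text \<open>The factors that an element \<open>e1^a e2^b z^c\<close> contributes at \<open>l - m/2\<close> and at \<open>l + m/2\<close> multiply to a power of \<open>\<omega>\<close> that does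
  not depend on \<open>m\<close>.\<close>

lemma contract_hrep:
  shows "contract b (outer (hrep 1 h v) (hrep 1 h w)) = hrep (2 :: 'p::prime_card mod_ring) h (contract b (outer v w))"
proof -
  obtain x y z where h: "h = (x, y, z)" by (cases h)
  have "omega_pow (z + y * (l - m / 2 + x)) * v $ (l - m / 2 + x) *
      (omega_pow (z + y * (l + m / 2 + x)) * w $ (l + m / 2 + x)) =
    omega_pow (2 * (z + y * (l + x))) * (v $ (l + x - m / 2) * w $ (l + x + m / 2))" for l m
  proof -
    have sh: "l - m / 2 + x = l + x - m / 2" "l + m / 2 + x = l + x + m / 2" by simp_all
    have "z + y * (l + x - m / 2) + (z + y * (l + x + m / 2)) = 2 * (z + y * (l + x))"
      by (simp add: algebra_simps)
    then have "omega_pow (z + y * (l + x - m / 2)) * omega_pow (z + y * (l + x + m / 2)) = omega_pow (2 * (z + y * (l + x)))"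
      by (simp only: omega_pow_simps(2)[symmetric])
    from this[symmetric] show ?thesis unfolding sh by (simp only: mult_ac)
  qed
  then show ?thesis
    by (simp add: h vec_eq_iff contract_def outer_def sum_distrib_left mult.left_commute)
qed

lemma contract_commute:
  assumes "\<And>i. b (- i) = b i"
  shows "contract b (outer v w) = contract b (outer w v)"
  unfolding contract_def outer_def vec_eq_iff
  by (auto intro!: sum.reindex_bij_witness[of _ uminus uminus] simp: assms mult.commute)

lemma midpoint_eq_iff:
  fixes l m :: "'p::prime_card mod_ring"
  assumes two: "(2 :: 'p mod_ring) \<noteq> 0"
  shows "l - m / 2 = k - i / 2 \<and> l + m / 2 = k + i / 2 \<longleftrightarrow> l = k \<and> m = i"
proof
  assume *: "l - m / 2 = k - i / 2 \<and> l + m / 2 = k + i / 2"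
  have "m = (l + m / 2) - (l - m / 2)" using half_add_half[OF two, of m] by simp
  also have "\<dots> = (k + i / 2) - (k - i / 2)" using * by simp
  also have "\<dots> = i" using half_add_half[OF two, of i] by simp
  finally show "l = k \<and> m = i" using * by simp
qed simp

lemma contract_axis:
  assumes two: "(2 :: 'p::prime_card mod_ring) \<noteq> 0"
  shows "contract b (outer (axis (k - i / 2) 1) (axis (k + i / 2) 1)) = b i *s axis (k :: 'p mod_ring) 1"
proof -
  have "b m * (axis (k - i / 2) 1 $ (l - m / 2) * axis (k + i / 2) 1 $ (l + m / 2)) =
      (if m = i then b i * axis k 1 $ l else 0)" for l m
    using midpoint_eq_iff[OF two, of l m k i] by (auto simp: axis_def)
  then show ?thesis by (simp add: contract_def outer_def vec_eq_iff)
qed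

lemma sum_midpoint:
  fixes g :: "'p::prime_card mod_ring \<Rightarrow> 'p mod_ring \<Rightarrow> 'c::comm_monoid_add"
  assumes two: "(2 :: 'p mod_ring) \<noteq> 0"
  shows "(\<Sum>u\<in>UNIV. \<Sum>v\<in>UNIV. g u v) = (\<Sum>k\<in>UNIV. \<Sum>i\<in>UNIV. g (k - i / 2) (k + i / 2))"
proof -
  have 1: "(u + v) / 2 - (v - u) / 2 = u" and 2: "(u + v) / 2 + (v - u) / 2 = v" for u v :: "'p mod_ring"
    using two by (simp_all add: field_simps)
  have 3: "(k - i / 2 + (k + i / 2)) / 2 = k" for k i :: "'p mod_ring"
  proof -
    have "k - i / 2 + (k + i / 2) = k * 2" by simp
    then show ?thesis using two by simp
  qed
  have 4: "k + i / 2 - (k - i / 2) = i" for k i :: "'p mod_ring"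
  proof -
    have "k + i / 2 - (k - i / 2) = i / 2 + i / 2" by simp
    then show ?thesis unfolding half_add_half[OF two] .
  qed
  show ?thesis
    unfolding sum.cartesian_product
    by (rule sum.reindex_bij_witness[of _ "\<lambda>(k, i). (k - i / 2, k + i / 2)" "\<lambda>(u, v). ((u + v) / 2, v - u)"])
       (auto simp: 1 2 3 4 two)
qed

lemma matrix_vector_axis_expand: "T *v v = (\<Sum>k\<in>UNIV. v $ k *s (T *v axis k 1))"
  for T :: "complex ^ 'n::finite ^ 'm"
  by (simp add: vec_eq_iff matrix_vec_axis matrix_vector_mult_def[of T v] mult.commute)

lemma congruence_nth:
  fixes T :: "complex ^ 'n::finite ^ 'm"
  shows "(T ** M ** transpose T) $ i $ j = (\<Sum>u\<in>UNIV. \<Sum>v\<in>UNIV. M $ u $ v * (T $ i $ u * T $ j $ v))"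
  unfolding matrix_matrix_mult_def transpose_def
  by (subst sum.swap) (simp add: sum_distrib_left sum_distrib_right mult_ac)

lemma contract_congruence:
  fixes T :: "complex ^ 'p::prime_card mod_ring ^ 'p mod_ring"
  shows "contract b (T ** M ** transpose T) =
    (\<Sum>u\<in>UNIV. \<Sum>v\<in>UNIV. M $ u $ v *s contract b (outer (T *v axis u 1) (T *v axis v 1)))"
proof -
  have "(\<Sum>m\<in>UNIV. b m * (\<Sum>u\<in>UNIV. \<Sum>v\<in>UNIV. M $ u $ v * (T $ (l - m / 2) $ u * T $ (l + m / 2) $ v)))
    = (\<Sum>u\<in>UNIV. \<Sum>v\<in>UNIV. M $ u $ v * (\<Sum>m\<in>UNIV. b m * (T $ (l - m / 2) $ u * T $ (l + m / 2) $ v)))" for l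
    unfolding sum_distrib_left
    by (subst sum.swap, rule sum.cong[OF refl], subst sum.swap) (simp add: mult_ac)
  then show ?thesis
    by (simp add: contract_def outer_def vec_eq_iff matrix_vec_axis congruence_nth)
qed

section \<open>The transformation of parameters\<close>

text \<open>The parameters \<open>b\<close> become \<open>b'\<close> in the generators \<open>y_k = T x_k\<close>. Quantifying over both intertwiners makes
  the relation independent of the choice of \<open>y_0\<close> and makes composition immediate.\<close>

definition moves ::
    "('p::prime_card heis \<Rightarrow> 'p heis) \<Rightarrow> ('p mod_ring \<Rightarrow> complex) \<Rightarrow> ('p mod_ring \<Rightarrow> complex) \<Rightarrow> bool"
  where "moves f b b' \<longleftrightarrow> (\<exists>T T'. intertwiner 1 f T \<and> intertwiner 2 f T' \<and>
    (\<forall>M. contract b (T ** M ** transpose T) = T' *v contract b' M))"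

text \<open>Besides unfolding the definition, this evaluates it on the monomials \<open>x_(-i/2) x_(i/2)\<close>, which already
  determine \<open>b'\<close>.\<close>

lemma movesE:
  assumes two: "(2 :: 'p::prime_card mod_ring) \<noteq> 0" and "moves f b b'"
  obtains T T' where "intertwiner (1 :: 'p mod_ring) f T" "intertwiner 2 f T'"
    "\<And>M. contract b (T ** M ** transpose T) = T' *v contract b' M"
    "\<And>i. contract b (outer (T *v axis (- i / 2) 1) (T *v axis (i / 2) 1)) = b' i *s (T' *v axis 0 1)"
proof -
  from assms(2) obtain T T' where T: "intertwiner (1 :: 'p mod_ring) f T" "intertwiner 2 f T'"
    and c: "\<And>M. contract b (T ** M ** transpose T) = T' *v contract b' M"
    unfolding moves_def by blast
  have "contract b (outer (T *v axis (- i / 2) 1) (T *v axis (i / 2) 1)) = b' i *s (T' *v axis 0 1)" for i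
    using c[of "outer (axis (- i / 2) 1) (axis (i / 2) 1)"] contract_axis[OF two, of b' 0 i]
    by (simp add: congruence_outer vector_scalar_commute)
  then show ?thesis using that T c by blast
qed

lemma intertwiner_e2_axis:
  assumes "intertwiner s f T"
  shows "hrep s (f e2) (T *v axis k 1) = omega_pow (s * k) *s (T *v axis k 1)"
proof -
  have "hrep s e2 (axis k 1) = omega_pow (s * k) *s axis k 1"
    by (auto simp: e2_def vec_eq_iff axis_def)
  then show ?thesis using assms unfolding intertwiner_def by (metis vector_scalar_commute)
qed

text \<open>The contraction of \<open>y_(-i/2) \<otimes> y_(i/2)\<close> is fixed by \<open>f(e2)\<close>, because the eigenvalues \<open>\<omega>^(-i/2)\<close> and \<open>\<omega>^(i/2)\<close>
  cancel. Hence it is a multiple of the vector \<open>t\<close> that spans the fixed line in \<open>V'\<close>, and the factor is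
  taken as \<open>b'(i)\<close>. Translation by \<open>f(e1)\<close> gives the other midpoints, and bilinearity the rest.\<close>

lemma moves_exists:
  assumes two: "(2 :: 'p::prime_card mod_ring) \<noteq> 0" and f: "f \<in> heis_auts"
    and even: "\<And>i :: 'p mod_ring. b (- i) = b i" and nz: "\<exists>i. b i \<noteq> 0"
  obtains b' where "\<And>i. b' (- i) = b' i" "\<exists>i. b' i \<noteq> 0" "moves f b b'"
proof -
  obtain T where T: "intertwiner (1 :: 'p mod_ring) f T" using intertwiner_exists[OF two f] by blast
  obtain T' where T': "intertwiner (2 :: 'p mod_ring) f T'" using intertwiner_exists[OF two f] by blast
  define y where "y k = T *v axis k 1" for k
  define t where "t = T' *v axis 0 1"
  obtain a' b' c' where e2: "f e2 = (a', b', c')" by (cases "f e2")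
  have "\<exists>c. contract b (outer (y (- i / 2)) (y (i / 2))) = c *s t" for i
  proof -
    have "hrep 2 (f e2) (contract b (outer (y (- i / 2)) (y (i / 2))))
        = (omega_pow (- i / 2) * omega_pow (i / 2)) *s contract b (outer (y (- i / 2)) (y (i / 2)))"
      unfolding contract_hrep[symmetric] y_def intertwiner_e2_axis[OF T] contract_outer_scale by simp
    also have "\<dots> = contract b (outer (y (- i / 2)) (y (i / 2)))"
      by (simp add: omega_pow_simps(1) omega_pow_simps(2)[symmetric])
    finally show ?thesis
      using fixed_vec_unique[OF two heis_aut_e2_noncentral[OF f e2] intertwiner_axis_0[OF T', unfolded e2]]
      unfolding t_def e2 by blast
  qed
  then obtain \<beta> where \<beta>: "\<And>i. contract b (outer (y (- i / 2)) (y (i / 2))) = \<beta> i *s t" by metis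
  have t0: "t \<noteq> 0" using intertwiner_axis_0(1)[OF T'] by (simp add: t_def)
  have "\<beta> (- i) *s t = \<beta> i *s t" for i
    using \<beta>[of i, symmetric] \<beta>[of "- i", symmetric]
      contract_commute[of b "y (i / 2)" "y (- i / 2)", OF even] by simp
  then have \<beta>_even: "\<beta> (- i) = \<beta> i" for i using t0 by simp
  have y_shift: "y (k + j) = hrep 1 (f (- k, 0, 0)) (y j)" for k j
  proof -
    have "axis (k + j) 1 = hrep 1 (- k, 0, 0) (axis j 1)"
      by (auto simp: vec_eq_iff axis_def omega_pow_simps)
    then show ?thesis using T unfolding y_def intertwiner_def by metis
  qed
  have gen: "contract b (outer (y (k - i / 2)) (y (k + i / 2))) = \<beta> i *s (T' *v axis k 1)" for k i
    using \<beta>[of i] y_shift[of k "- i / 2"] y_shift[of k "i / 2"]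
    by (simp add: contract_hrep hrep_scale t_def intertwiner_axis[OF T', of k])
  have key: "contract b (T ** M ** transpose T) = T' *v contract \<beta> M" for M
  proof -
    have "contract b (T ** M ** transpose T) =
        (\<Sum>k\<in>UNIV. \<Sum>i\<in>UNIV. M $ (k - i / 2) $ (k + i / 2) *s (\<beta> i *s (T' *v axis k 1)))"
      unfolding contract_congruence y_def[symmetric] gen[symmetric]
      by (rule sum_midpoint[OF two])
    also have "\<dots> = T' *v contract \<beta> M"
      unfolding matrix_vector_axis_expand[of T' "contract \<beta> M"]
      by (simp add: contract_def vec_eq_iff sum_distrib_left mult_ac)
    finally show ?thesis .
  qed
  have "\<exists>i. \<beta> i \<noteq> 0"
  proof (rule ccontr)
    assume "\<not> ?thesis"
    then have "contract \<beta> M = 0" for M by (simp add: contract_def vec_eq_iff)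
    then have 0: "contract b (T ** M ** transpose T) = 0" for M by (simp add: key)
    obtain i where i: "b i \<noteq> 0" using nz by blast
    obtain S where S: "T ** S = mat 1"
      using intertwiner_invertible[OF _ T] by (auto simp: invertible_def)
    have "b i *s axis 0 1 = (0 :: complex ^ 'p mod_ring)"
      using 0[of "outer (S *v axis (0 - i / 2) 1) (S *v axis (0 + i / 2) 1)"]
      unfolding congruence_outer matrix_vector_mul_assoc S matrix_vector_mul_lid contract_axis[OF two] .
    then show False using i by (simp add: axis_eq_0_iff)
  qed
  then show ?thesis using that \<beta>_even T T' key unfolding moves_def by blast
qed

lemma matrix_entries_scale:
  fixes S T :: "complex ^ 'n::finite ^ 'm"
  assumes "\<forall>j k. S $ j $ k = c * T $ j $ k"
  shows "S *v v = c *s (T *v v)"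
  by (simp add: vec_eq_iff matrix_vector_mult_def assms sum_distrib_left mult_ac)

lemma moves_unique:
  assumes two: "(2 :: 'p::prime_card mod_ring) \<noteq> 0" and f: "f \<in> heis_auts"
    and "moves f b b1" "moves f b b2"
  shows "\<exists>c. c \<noteq> 0 \<and> (\<forall>i :: 'p mod_ring. b2 i = c * b1 i)"
proof -
  obtain T T' where T: "intertwiner (1 :: 'p mod_ring) f T" "intertwiner 2 f T'"
    "\<And>i. contract b (outer (T *v axis (- i / 2) 1) (T *v axis (i / 2) 1)) = b1 i *s (T' *v axis 0 1)"
    using movesE[OF two assms(3)] by metis
  obtain S S' where S: "intertwiner (1 :: 'p mod_ring) f S" "intertwiner 2 f S'"
    "\<And>i. contract b (outer (S *v axis (- i / 2) 1) (S *v axis (i / 2) 1)) = b2 i *s (S' *v axis 0 1)"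
    using movesE[OF two assms(4)] by metis
  obtain c where c: "c \<noteq> 0" "\<forall>j k. S $ j $ k = c * T $ j $ k"
    using intertwiner_unique[OF _ f T(1) S(1)] by auto
  obtain d where d: "d \<noteq> 0" "\<forall>j k. S' $ j $ k = d * T' $ j $ k"
    using intertwiner_unique[OF two f T(2) S(2)] by blast
  have "(c * c * b1 i) *s (T' *v axis 0 1) = (b2 i * d) *s (T' *v axis 0 1)" for i
    using S(3)[of i] unfolding matrix_entries_scale[OF c(2)] matrix_entries_scale[OF d(2)]
      contract_outer_scale T(3) by (simp add: mult_ac)
  then have "c * c * b1 i = b2 i * d" for i using intertwiner_axis_0(1)[OF T(2)] by simp
  then have "b2 i = (c * c / d) * b1 i" for i using d(1) by (simp add: field_simps)
  then show ?thesis using c(1) d(1) by (intro exI[of _ "c * c / d"]) simp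
qed

lemma moves_comp:
  assumes two: "(2 :: 'p::prime_card mod_ring) \<noteq> 0"
    and "moves f b b1" "moves g b1 (b2 :: 'p mod_ring \<Rightarrow> complex)"
  shows "moves (f \<circ> g) b b2"
proof -
  obtain T T' where T: "intertwiner (1 :: 'p mod_ring) f T" "intertwiner 2 f T'"
    "\<And>M. contract b (T ** M ** transpose T) = T' *v contract b1 M"
    using assms(2) unfolding moves_def by blast
  obtain S S' where S: "intertwiner (1 :: 'p mod_ring) g S" "intertwiner 2 g S'"
    "\<And>M. contract b1 (S ** M ** transpose S) = S' *v contract b2 M"
    using assms(3) unfolding moves_def by blast
  have "contract b ((T ** S) ** M ** transpose (T ** S)) = (T' ** S') *v contract b2 M" for M
    using T(3)[of "S ** M ** transpose S"] S(3)[of M]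
    by (simp add: matrix_transpose_mul matrix_mul_assoc matrix_vector_mul_assoc)
  then show ?thesis
    unfolding moves_def using intertwiner_comp[OF _ T(1) S(1)] intertwiner_comp[OF two T(2) S(2)] by auto
qed

lemma contract_param_scale: "contract (\<lambda>i. c * b i) M = c *s contract b M"
  by (simp add: contract_def vec_eq_iff sum_distrib_left mult_ac)

lemma moves_scale:
  assumes "moves f b b'" "c \<noteq> 0" "d \<noteq> 0"
  shows "moves f (\<lambda>i. c * b i) (\<lambda>i. d * b' i)"
proof -
  obtain T T' where T: "intertwiner 1 f T" "intertwiner 2 f T'"
    "\<And>M. contract b (T ** M ** transpose T) = T' *v contract b' M"
    using assms(1) unfolding moves_def by blast
  define S where "S = (\<chi> i j. c / d * T' $ i $ j)"
  have S: "S *v v = (c / d) *s (T' *v v)" for v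
    by (rule matrix_entries_scale) (simp add: S_def)
  have "S \<noteq> 0" using T(2) assms(2,3) by (auto simp: intertwiner_def S_def vec_eq_iff)
  then have "intertwiner 2 f S" using T(2) by (simp add: intertwiner_def S hrep_scale)
  moreover have "contract (\<lambda>i. c * b i) (T ** M ** transpose T) = S *v contract (\<lambda>i. d * b' i) M" for M
    using assms(3) by (simp add: contract_param_scale T(3) S vector_scalar_commute)
  ultimately show ?thesis unfolding moves_def using T(1) by blast
qed

section \<open>The effect on the base point and the base hyperplane\<close>

text \<open>Column \<open>k\<close> is an eigenvector of \<open>f(e2)\<close>, which acts diagonally with pairwise distinct eigenvalues.\<close>

lemma intertwiner_monomial:
  assumes T: "intertwiner (1 :: 'p::prime_card mod_ring) f T" and e2: "f e2 = (0, b, c)"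
    and nz: "(T *v axis k 1) $ j \<noteq> 0"
  shows "b * j = k - c"
proof -
  have "omega_pow (c + b * j) * (T *v axis k 1) $ j = omega_pow k * (T *v axis k 1) $ j"
    using intertwiner_e2_axis[OF T, of k] unfolding e2 vec_eq_iff by simp
  then have "omega_pow (c + b * j) = omega_pow k" using nz by simp
  then have "omega_pow (c + b * j - k) * omega_pow k = omega_pow k"
    by (simp add: omega_pow_simps(2)[symmetric])
  then have "c + b * j - k = 0" by (simp add: omega_pow_eq_1_iff)
  then show ?thesis by (simp add: algebra_simps)
qed

text \<open>Here \<open>f(e2)\<close> moves the coordinates cyclically, so that its eigenvectors have no vanishing coordinate.\<close>

lemma intertwiner_nowhere_zero:
  assumes T: "intertwiner (1 :: 'p::prime_card mod_ring) f T" and e2: "f e2 = (a, b, c)" "a \<noteq> 0"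
  shows "(T *v axis k 1) $ j \<noteq> 0"
proof -
  obtain x y z where "f (- k, 0, 0) = (x, y, z)" by (cases "f (- k, 0, 0)")
  then show ?thesis
    using fixed_vec_nowhere_zero[OF e2(2) intertwiner_axis_0(2,1)[OF T, unfolded e2(1)]]
    unfolding intertwiner_axis[OF T, of k] by simp
qed

lemma contract_base:
  assumes "\<And>i. i \<noteq> 0 \<Longrightarrow> b i = 0"
  shows "contract b (outer v w) $ l = b 0 * v $ l * w $ l"
proof -
  have "b m * (v $ (l - m / 2) * w $ (l + m / 2)) = (if m = 0 then b 0 * v $ l * w $ l else 0)" for m
    using assms[of m] by auto
  then show ?thesis by (simp add: contract_def outer_def)
qed

text \<open>For this \<open>b\<close> contraction is \<open>b(0)\<close> times the coordinatewise product, and distinct columns of a monomial matrix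
  have disjoint supports.\<close>

lemma moves_base_monomial:
  assumes two: "(2 :: 'p::prime_card mod_ring) \<noteq> 0" and mv: "moves f b b'" and e2: "f e2 = (0, x, y)"
    and b: "\<And>i. i \<noteq> 0 \<Longrightarrow> b i = 0" and i: "(i :: 'p mod_ring) \<noteq> 0"
  shows "b' i = 0"
proof -
  obtain T T' where T: "intertwiner (1 :: 'p mod_ring) f T" "intertwiner 2 f T'"
    "\<And>i. contract b (outer (T *v axis (- i / 2) 1) (T *v axis (i / 2) 1)) = b' i *s (T' *v axis 0 1)"
    using movesE[OF two mv] by metis
  have "(T *v axis (- i / 2) 1) $ l * (T *v axis (i / 2) 1) $ l = 0" for l
  proof (rule ccontr)
    assume "\<not> ?thesis"
    then have "x * l = - i / 2 - y" "x * l = i / 2 - y"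
      using intertwiner_monomial[OF T(1) e2] by auto
    then have "i / 2 + i / 2 = 0" by simp
    then show False using i half_add_half[OF two, of i] by simp
  qed
  then have "contract b (outer (T *v axis (- i / 2) 1) (T *v axis (i / 2) 1)) = 0"
    by (simp add: vec_eq_iff contract_base[of b, OF b])
  then show ?thesis using T(3)[of i] intertwiner_axis_0(1)[OF T(2)] by simp
qed

lemma moves_base_nonmonomial:
  assumes two: "(2 :: 'p::prime_card mod_ring) \<noteq> 0" and mv: "moves f b b'" and e2: "f e2 = (a, x, y)" "a \<noteq> 0"
    and b: "\<And>i. i \<noteq> 0 \<Longrightarrow> b i = 0" "b 0 \<noteq> 0"
  shows "b' (i :: 'p mod_ring) \<noteq> 0"
proof
  assume 0: "b' i = 0"
  obtain T T' where T: "intertwiner (1 :: 'p mod_ring) f T" "intertwiner 2 f T'"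
    "\<And>i. contract b (outer (T *v axis (- i / 2) 1) (T *v axis (i / 2) 1)) = b' i *s (T' *v axis 0 1)"
    using movesE[OF two mv] by metis
  have "contract b (outer (T *v axis (- i / 2) 1) (T *v axis (i / 2) 1)) $ 0 = 0" using T(3)[of i] 0 by simp
  then show False
    using b(2) intertwiner_nowhere_zero[OF T(1) e2] by (simp add: contract_base[of b, OF b(1)])
qed

text \<open>The new value at \<open>0\<close> comes from contracting \<open>y_0 \<otimes> y_0\<close>, which is a multiple of a square \<open>x_j\<^sup>2\<close> and sees
  only \<open>b(0)\<close>.\<close>

lemma moves_hyperplane_monomial:
  assumes two: "(2 :: 'p::prime_card mod_ring) \<noteq> 0" and f: "f \<in> heis_auts" and mv: "moves f b b'"
    and e2: "f e2 = (0, x, y)" and b: "b 0 = 0"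
  shows "b' (0 :: 'p mod_ring) = 0"
proof -
  obtain T T' where T: "intertwiner (1 :: 'p mod_ring) f T" "intertwiner 2 f T'"
    "\<And>i. contract b (outer (T *v axis (- i / 2) 1) (T *v axis (i / 2) 1)) = b' i *s (T' *v axis 0 1)"
    using movesE[OF two mv] by metis
  have x: "x \<noteq> 0" using heis_aut_e2_noncentral[OF f e2] by simp
  have vanish: "b m * ((T *v axis 0 1) $ (l - m / 2) * (T *v axis 0 1) $ (l + m / 2)) = 0" for l m
  proof (rule ccontr)
    assume *: "\<not> ?thesis"
    then have "x * (l - m / 2) = 0 - y" "x * (l + m / 2) = 0 - y"
      using intertwiner_monomial[OF T(1) e2] by auto
    then have "l - m / 2 = l + m / 2" using x by (metis mult_cancel_left)
    then have "m / 2 + m / 2 = 0" by (simp add: algebra_simps)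
    then have "m = 0" unfolding half_add_half[OF two] .
    then show False using b * by simp
  qed
  have "contract b (outer (T *v axis 0 1) (T *v axis 0 1)) = 0"
    by (simp add: vec_eq_iff contract_def outer_def vanish del: mult_eq_0_iff)
  then show ?thesis using T(3)[of 0] intertwiner_axis_0(1)[OF T(2)] by simp
qed

text \<open>A point of the hyperplane for which the contraction of \<open>y_0 \<otimes> y_0\<close> has coordinates that are twice
  a single product of coordinates of \<open>y_0\<close>, so that no cancellation can occur.\<close>

lemma moves_hyperplane_nonmonomial:
  assumes two: "(2 :: 'p::prime_card mod_ring) \<noteq> 0" and mv: "moves f b b'" and e2: "f e2 = (a, x, y)" "a \<noteq> 0"
    and b: "\<And>i. b i = (if i = 1 \<or> i = - 1 then 1 else 0)"
  shows "b' (0 :: 'p mod_ring) \<noteq> 0"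
proof
  assume 0: "b' 0 = 0"
  obtain T T' where T: "intertwiner (1 :: 'p mod_ring) f T" "intertwiner 2 f T'"
    "\<And>i. contract b (outer (T *v axis (- i / 2) 1) (T *v axis (i / 2) 1)) = b' i *s (T' *v axis 0 1)"
    using movesE[OF two mv] by metis
  define t where "t = T *v axis 0 1"
  have "(1 :: 'p mod_ring) + 1 \<noteq> 0" using two by simp
  then have ne: "(1 :: 'p mod_ring) \<noteq> - 1" by (metis add.right_inverse)
  have "contract b (outer t t) $ 0 = (\<Sum>m\<in>UNIV. b m * (t $ (- m / 2) * t $ (m / 2)))"
    by (simp add: contract_def outer_def)
  also have "\<dots> = (\<Sum>m\<in>{1, - 1}. b m * (t $ (- m / 2) * t $ (m / 2)))"
    by (rule sum.mono_neutral_right) (auto simp: b)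
  also have "\<dots> = 2 * (t $ (- 1 / 2) * t $ (1 / 2))" using ne by (simp add: b)
  finally show False
    using T(3)[of 0] 0 intertwiner_nowhere_zero[OF T(1) e2, of 0] by (simp add: t_def)
qed

text \<open>Such an \<open>f\<close> sends \<open>e2\<close> to a power of itself times a central element, so that \<open>y_k\<close> is a multiple of a
  coordinate vector with index \<open>j_0 \<plusminus> k\<close>. The multiples for \<open>\<plusminus> k\<close> have a product independent of \<open>k\<close>, and the
  sign disappears because \<open>b\<close> is even.\<close>

lemma moves_lift_of_sign:
  assumes two: "(2 :: 'p::prime_card mod_ring) \<noteq> 0" and f: "f \<in> heis_auts"
    and \<epsilon>: "\<epsilon> = 1 \<or> \<epsilon> = - 1" and ab: "\<And>a b c. \<exists>c'. f (a, b, c) = (\<epsilon> * a, \<epsilon> * b, c')"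
    and even: "\<And>i :: 'p mod_ring. b (- i) = b i" and nz: "\<exists>i. b i \<noteq> 0"
  shows "moves f b b"
proof -
  obtain b' where b': "\<exists>i. b' i \<noteq> 0" "moves f b b'" using moves_exists[OF two f even nz] by metis
  obtain T T' where T: "intertwiner (1 :: 'p mod_ring) f T" "intertwiner 2 f T'"
    "\<And>i. contract b (outer (T *v axis (- i / 2) 1) (T *v axis (i / 2) 1)) = b' i *s (T' *v axis 0 1)"
    using movesE[OF two b'(2)] by metis
  obtain n where e2: "f e2 = (0, \<epsilon>, n)" using ab[of 0 1 0] by (auto simp: e2_def)
  have \<epsilon>2: "\<epsilon> * \<epsilon> = 1" using \<epsilon> by auto
  define j0 where "j0 = - \<epsilon> * n"
  define \<kappa> where "\<kappa> = (T *v axis 0 1) $ j0"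
  define t where "t = T' *v axis 0 1"
  have "(T *v axis 0 1) $ j = 0" if "j \<noteq> j0" for j
  proof (rule ccontr)
    assume "(T *v axis 0 1) $ j \<noteq> 0"
    then have "\<epsilon> * j = - n" using intertwiner_monomial[OF T(1) e2] by auto
    then have "\<epsilon> * (\<epsilon> * j) = j0" by (simp add: j0_def)
    then show False using that \<epsilon>2 by (simp add: mult.assoc[symmetric])
  qed
  then have y0: "T *v axis 0 1 = \<kappa> *s axis j0 1"
    by (auto simp: vec_eq_iff \<kappa>_def axis_def)
  then have \<kappa>: "\<kappa> \<noteq> 0" using intertwiner_axis_0(1)[OF T(1)] by auto
  have "\<exists>c'. f (- k, 0, 0) = (- \<epsilon> * k, 0, c')" for k using ab[of "- k" 0 0] by simp
  then obtain \<mu> where \<mu>: "\<And>k. f (- k, 0, 0) = (- \<epsilon> * k, 0, \<mu> k)" by metis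
  \<comment> \<open>The elements \<open>f(k, 0, 0)\<close> and \<open>f(- k, 0, 0)\<close> are inverse to each other.\<close>
  have \<mu>_odd: "\<mu> (- k) + \<mu> k = 0" for k
  proof -
    have "f ((k, 0, 0) \<otimes>\<^bsub>heis\<^esub> (- k, 0, 0)) = f (k, 0, 0) \<otimes>\<^bsub>heis\<^esub> f (- k, 0, 0)"
      by (rule heis_aut_mult[OF f])
    then show ?thesis using \<mu>[of "- k"] \<mu>[of k] heis_aut_central[OF f, of 0] by simp
  qed
  have y: "T *v axis k 1 = (\<kappa> * omega_pow (\<mu> k)) *s axis (j0 + \<epsilon> * k) 1" for k
    unfolding intertwiner_axis[OF T(1), of k] y0 \<mu> by (auto simp: vec_eq_iff axis_def algebra_simps)
  have val: "b' i *s t = (\<kappa> * \<kappa> * b i) *s axis j0 1" for i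
  proof -
    have "contract b (outer (axis (j0 + \<epsilon> * (- i / 2)) 1) (axis (j0 + \<epsilon> * (i / 2)) 1)) = b (\<epsilon> * i) *s axis j0 1"
      using contract_axis[OF two, of b j0 "\<epsilon> * i"] by simp
    moreover have "omega_pow (\<mu> (- i / 2)) * omega_pow (\<mu> (i / 2)) = 1"
      using \<mu>_odd[of "i / 2"] by (simp add: omega_pow_simps(2)[symmetric] omega_pow_simps(1))
    moreover have "b (\<epsilon> * i) = b i" using \<epsilon> even by auto
    ultimately show ?thesis
      using T(3)[of i] unfolding y contract_outer_scale t_def by (simp add: mult_ac)
  qed
  obtain i where i: "b' i \<noteq> 0" using b' by blast
  have t0: "t $ j0 \<noteq> 0"
  proof
    assume "t $ j0 = 0"
    then have "\<kappa> * \<kappa> * b i = 0" using val[of i] by (simp add: vec_eq_iff) (metis axis_nth mult_eq_0_iff mult_1_right)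
    then have "b' i *s t = 0" using val[of i] by simp
    then show False using i intertwiner_axis_0(1)[OF T(2)] by (simp add: t_def)
  qed
  have "b' i * t $ j0 = \<kappa> * \<kappa> * b i" for i
    using arg_cong[OF val[of i], of "\<lambda>v. v $ j0"] by (simp add: axis_def)
  then have "(t $ j0 / (\<kappa> * \<kappa>)) * b' i = b i" for i using \<kappa> by (simp add: field_simps)
  then have "b = (\<lambda>i. (t $ j0 / (\<kappa> * \<kappa>)) * b' i)" by simp
  then show ?thesis
    using moves_scale[OF b'(2), of 1 "t $ j0 / (\<kappa> * \<kappa>)"] t0 \<kappa> by simp
qed

section \<open>Quadratic elements of the free algebra\<close>

lemma scalar_simps:
  "scalar (a + b) = scalar a + scalar b" "scalar (a * b) = scalar a * scalar b"
  "scalar 0 = 0" "scalar 1 = 1" "scalar (a - b) = scalar a - scalar b"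
  by (simp_all add: scalar_def single_add mult_single single_diff)

lemma scalar_left_commute: "scalar c * (scalar d * x) = scalar d * (scalar c * x)"
proof -
  have "scalar c * (scalar d * x) = scalar (c * d) * x" for c d
    by (simp only: scalar_simps(2) mult.assoc)
  from this[of c d] this[of d c] show ?thesis by (simp only: mult.commute[of d c])
qed

lemma scalar_sum: "scalar (\<Sum>i\<in>I. f i) = (\<Sum>i\<in>I. scalar (f i))"
  by (induction I rule: infinite_finite_induct) (simp_all add: scalar_simps)

definition quad :: "('a::finite \<Rightarrow> 'b free_alg) \<Rightarrow> complex ^ 'a ^ 'a \<Rightarrow> 'b free_alg" where
  "quad g M = (\<Sum>u\<in>UNIV. \<Sum>v\<in>UNIV. scalar (M $ u $ v) * (g u * g v))"

lemma quad_add: "quad g (M + N) = quad g M + quad g N"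
  by (simp add: quad_def scalar_simps sum.distrib distrib_right)

lemma quad_diff: "quad g (M - N) = quad g M - quad g N"
  by (simp add: quad_def scalar_simps sum_subtractf left_diff_distrib)

lemma quad_outer_axis: "quad g (outer (c *s axis u 1) (axis v 1)) = scalar c * (g u * g v)"
proof -
  have "scalar (outer (c *s axis u 1) (axis v 1) $ i $ j) * (g i * g j) =
      (if i = u then if j = v then scalar c * (g u * g v) else 0 else 0)" for i j
    by (auto simp: outer_def axis_def scalar_simps)
  moreover have "(\<Sum>j\<in>UNIV. if i = u then if j = v then scalar c * (g u * g v) else 0 else 0)
      = (if i = u then scalar c * (g u * g v) else 0)" for i by simp
  ultimately show ?thesis by (simp add: quad_def)
qed

text \<open>The relations in degree two, as matrices of quadratic forms.\<close>

definition quad_relations :: "('p::prime_card mod_ring \<Rightarrow> complex) \<Rightarrow> (complex ^ 'p mod_ring ^ 'p mod_ring) set" where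
  "quad_relations b = {M. transpose M = M \<and> contract b M = 0}"

lemma contract_linear:
  "contract b (M + N) = contract b M + contract b N" "contract b (M - N) = contract b M - contract b N"
  "contract b 0 = 0"
  by (simp_all add: contract_def vec_eq_iff algebra_simps sum.distrib sum_subtractf)

lemma transpose_linear:
  "transpose (M + N) = transpose M + transpose N" "transpose (M - N) = transpose M - transpose N"
  "transpose (0 :: 'a::ab_group_add ^ 'n ^ 'm) = 0"
  by (simp_all add: transpose_def vec_eq_iff)

lemma transpose_outer: "transpose (outer v w) = outer w v"
  by (simp add: outer_def transpose_def vec_eq_iff mult.commute)

text \<open>The symmetrised products, indexed like the entries of a quadratic form by midpoint and difference.\<close>

definition anticomm :: "('p::prime_card mod_ring \<Rightarrow> 'b free_alg) \<Rightarrow> 'p mod_ring \<Rightarrow> 'p mod_ring \<Rightarrow> 'b free_alg" where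
  "anticomm g k i = g (k - i / 2) * g (k + i / 2) + g (k + i / 2) * g (k - i / 2)"

lemma anticomm_minus: "anticomm g k (- i) = anticomm g k i"
  by (simp add: anticomm_def add.commute)

definition anticomm_matrix :: "complex \<Rightarrow> 'p::prime_card mod_ring \<Rightarrow> 'p mod_ring \<Rightarrow> complex ^ 'p mod_ring ^ 'p mod_ring" where
  "anticomm_matrix c k i = outer (c *s axis (k - i / 2) 1) (axis (k + i / 2) 1)
     + outer (c *s axis (k + i / 2) 1) (axis (k - i / 2) 1)"

lemma quad_anticomm_matrix: "quad g (anticomm_matrix c k i) = scalar c * anticomm g k i"
  by (simp add: anticomm_matrix_def quad_add quad_outer_axis anticomm_def distrib_left)

lemma outer_scale_commute: "outer (c *s v) w = outer v (c *s w)"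
  by (simp add: outer_def vec_eq_iff mult_ac)

lemma transpose_anticomm_matrix: "transpose (anticomm_matrix c k i) = anticomm_matrix c k i"
  by (simp add: anticomm_matrix_def transpose_linear transpose_outer outer_scale_commute add.commute)

lemma contract_anticomm_matrix:
  assumes two: "(2 :: 'p::prime_card mod_ring) \<noteq> 0" and even: "\<And>i :: 'p mod_ring. b (- i) = b i"
  shows "contract b (anticomm_matrix c k i) = (2 * c * b i) *s axis k 1"
proof -
  have 1: "contract b (outer (c *s axis (k - i / 2) 1) (axis (k + i / 2) 1)) = c *s (b i *s axis k 1)" for i
    using contract_outer_scale[of b c _ 1] contract_axis[OF two, of b k i] by simp
  show ?thesis
    unfolding anticomm_matrix_def contract_linear 1[of i] using 1[of "- i"]
    by (simp add: even vec_eq_iff)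
qed

lemma anticomm_relation:
  assumes "(2 :: 'p::prime_card mod_ring) \<noteq> 0" and "\<And>i :: 'p mod_ring. b (- i) = b i"
    and "c * b i = d * b m"
  shows "scalar c * anticomm g k i - scalar d * anticomm g k m \<in> quad g ` quad_relations b"
proof (rule image_eqI)
  show "scalar c * anticomm g k i - scalar d * anticomm g k m = quad g (anticomm_matrix c k i - anticomm_matrix d k m)"
    by (simp add: quad_diff quad_anticomm_matrix)
  show "anticomm_matrix c k i - anticomm_matrix d k m \<in> quad_relations b"
    using assms(3)
    by (simp add: quad_relations_def transpose_linear transpose_anticomm_matrix contract_linear
        contract_anticomm_matrix[of b, OF assms(1,2)] mult.assoc)
qed

section \<open>Parameters as even functions\<close>

text \<open>The representative of \<open>\<plusminus> x\<close> in \<open>{0..(p-1)/2}\<close>, the range of the indices of the parameters.\<close>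

definition half_abs :: "'p::prime_card mod_ring \<Rightarrow> nat" where
  "half_abs x = min (nat (to_int_mod_ring x)) (nat (to_int_mod_ring (- x)))"

lemma half_abs_minus [simp]: "half_abs (- x) = half_abs x"
  by (simp add: half_abs_def min.commute)

lemma odd_card:
  assumes "(2 :: 'p::prime_card mod_ring) \<noteq> 0" shows "odd CARD('p)"
proof
  assume "even CARD('p)"
  then have "CARD('p) = 2"
    using prime_card[where 'a='p] by (metis two_is_prime_nat primes_dvd_imp_eq)
  then have "(of_nat 2 :: 'p mod_ring) = of_nat 0" unfolding of_nat_mod_ring_eq_iff by simp
  then show False using assms by simp
qed

lemma half_abs_of_nat:
  assumes n: "n \<in> {1..(CARD('p::prime_card) - 1) div 2}"
  shows "half_abs (of_nat n :: 'p mod_ring) = n"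
proof -
  have to_int: "to_int_mod_ring (of_nat m :: 'p mod_ring) = int (m mod CARD('p))" for m
    by transfer (simp add: of_nat_mod)
  have "(- of_nat n :: 'p mod_ring) = of_nat (CARD('p) - n)"
  proof -
    have "n \<le> CARD('p)" using n by auto
    then have "(of_nat (CARD('p) - n) + of_nat n :: 'p mod_ring) = of_nat CARD('p)"
      by (simp only: of_nat_add[symmetric]) simp
    also have "\<dots> = of_nat 0" unfolding of_nat_mod_ring_eq_iff by simp
    finally show ?thesis by (simp add: eq_neg_iff_add_eq_0 eq_commute[of "- _"])
  qed
  then show ?thesis using n by (auto simp: half_abs_def to_int min_def simp del: of_nat_diff)
qed

lemma half_abs_cases:
  fixes x :: "'p::prime_card mod_ring"
  assumes two: "(2 :: 'p mod_ring) \<noteq> 0" and x: "x \<noteq> 0"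
  obtains n where "n \<in> {1..(CARD('p) - 1) div 2}" "x = of_nat n \<or> x = - of_nat n"
proof -
  define m where "m = nat (to_int_mod_ring x)"
  have "0 \<le> to_int_mod_ring x \<and> to_int_mod_ring x < int CARD('p)" by transfer auto
  then have m: "x = of_nat m" "m < CARD('p)"
    by (auto simp: m_def of_nat_of_int_mod_ring)
  have m0: "m \<noteq> 0" using m x by (cases m) auto
  show ?thesis
  proof (cases "m \<le> (CARD('p) - 1) div 2")
    case True
    then show ?thesis using that[of m] m m0 by auto
  next
    case False
    have "(of_nat (CARD('p) - m) + of_nat m :: 'p mod_ring) = of_nat CARD('p)"
      using m by (simp only: of_nat_add[symmetric]) simp
    also have "\<dots> = of_nat 0" unfolding of_nat_mod_ring_eq_iff by simp
    finally have "x = - of_nat (CARD('p) - m)" using m(1) by (simp add: eq_neg_iff_add_eq_0 add.commute)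
    moreover have "CARD('p) - m \<in> {1..(CARD('p) - 1) div 2}"
      using False m(2) odd_card[OF two] by (auto elim!: oddE)
    ultimately show ?thesis using that by blast
  qed
qed

text \<open>The factor 2 reflects that \<open>anticomm g k 0\<close> is twice the square of \<open>g k\<close>, whereas the relations of the
  algebra are stated with the square itself.\<close>

definition even_param :: "(nat \<Rightarrow> complex) \<Rightarrow> 'p::prime_card mod_ring \<Rightarrow> complex" where
  "even_param a x = (if x = 0 then 2 * a 0 else a (half_abs x))"

lemma even_param_minus: "even_param a (- x) = even_param a x"
  by (simp add: even_param_def)

lemma even_param_0: "even_param a 0 = 2 * a 0"
  by (simp add: even_param_def)

lemma of_nat_half_range_nonzero:
  assumes "n \<in> {1..(CARD('p::prime_card) - 1) div 2}"
  shows "(of_nat n :: 'p mod_ring) \<noteq> 0"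
proof
  assume "(of_nat n :: 'p mod_ring) = 0"
  then have "n mod CARD('p) = 0" using of_nat_mod_ring_eq_iff[of n 0, where 'p='p] by simp
  moreover have "n < CARD('p)" using assms by auto
  ultimately show False using assms by simp
qed

lemma even_param_of_nat:
  assumes "n \<in> {1..(CARD('p::prime_card) - 1) div 2}"
  shows "even_param a (of_nat n :: 'p mod_ring) = a n"
  using assms by (simp add: even_param_def half_abs_of_nat of_nat_half_range_nonzero)

text \<open>Reduction of a claim on all differences modulo \<open>p\<close> to the indices that occur in the relations.\<close>

lemma even_fun_cases:
  fixes b :: "'p::prime_card mod_ring \<Rightarrow> 'c"
  assumes two: "(2 :: 'p mod_ring) \<noteq> 0"
    and "\<And>i. b (- i) = b i" and "P (b 0)" and "\<And>n. n \<in> {1..(CARD('p) - 1) div 2} \<Longrightarrow> P (b (of_nat n))"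
  shows "P (b x)"
proof (cases "x = 0")
  case False
  then show ?thesis using half_abs_cases[OF two False] assms(2,4) by metis
qed (simp add: assms(3))

lemma even_param_surj:
  fixes b :: "'p::prime_card mod_ring \<Rightarrow> complex"
  assumes two: "(2 :: 'p mod_ring) \<noteq> 0" and even: "\<And>i. b (- i) = b i" and nz: "\<exists>i. b i \<noteq> 0"
  obtains a where "a \<in> coord_vecs ((CARD('p) - 1) div 2)" "even_param a = b"
proof -
  define h where "h = (CARD('p) - 1) div 2"
  define a where "a n = (if n = 0 then b 0 / 2 else if n \<le> h then b (of_nat n) else 0)" for n
  have "even_param a x = b x" for x
  proof (cases "x = 0")
    case False
    then obtain n where n: "n \<in> {1..(CARD('p) - 1) div 2}" "x = of_nat n \<or> x = - of_nat n"
      using half_abs_cases[OF two] by blast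
    then have "even_param a x = a n"
      using even_param_of_nat[OF n(1), of a] even_param_minus[of a "of_nat n :: 'p mod_ring"] by auto
    also have "\<dots> = b x" using n even by (auto simp: a_def h_def)
    finally show ?thesis .
  qed (simp add: even_param_0 a_def)
  then have b: "even_param a = b" by blast
  obtain i :: "'p mod_ring" where "even_param a i \<noteq> 0" using nz b by auto
  then have "\<exists>n. a n \<noteq> 0" by (auto simp: even_param_def split: if_splits)
  then have "a \<in> coord_vecs ((CARD('p) - 1) div 2)" by (auto simp: coord_vecs_def a_def h_def)
  then show ?thesis using that b by blast
qed

lemma even_param_nonzero:
  assumes two: "(2 :: 'p::prime_card mod_ring) \<noteq> 0" and a: "a \<in> coord_vecs ((CARD('p) - 1) div 2)"
  shows "\<exists>i :: 'p mod_ring. even_param a i \<noteq> 0"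
proof -
  obtain n where n: "a n \<noteq> 0" "n \<le> (CARD('p) - 1) div 2"
    using a by (auto simp: coord_vecs_def not_le[symmetric])
  show ?thesis
  proof (cases "n = 0")
    case True
    then show ?thesis using n even_param_0[of a, where 'a='p] by (intro exI[of _ 0]) auto
  next
    case False
    then show ?thesis using n even_param_of_nat[where 'p = 'p, of n a] by (intro exI[of _ "of_nat n"]) auto
  qed
qed

lemma even_param_proportional:
  assumes two: "(2 :: 'p::prime_card mod_ring) \<noteq> 0"
    and a: "a \<in> coord_vecs ((CARD('p) - 1) div 2)" "a' \<in> coord_vecs ((CARD('p) - 1) div 2)"
    and c: "\<And>i :: 'p mod_ring. even_param a' i = c * even_param a i"
  shows "a' n = c * a n"
proof (cases "n = 0")
  case True
  then show ?thesis using c[of 0] by (simp add: even_param_0)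
next
  case False
  show ?thesis
  proof (cases "n \<le> (CARD('p) - 1) div 2")
    case True
    then show ?thesis using c[of "of_nat n"] False even_param_of_nat[where 'p = 'p, of n] by simp
  next
    case False
    then show ?thesis using a by (simp add: coord_vecs_def)
  qed
qed

lemma proj_pt_eq_iff:
  "proj_pt a = proj_pt a' \<longleftrightarrow> (\<exists>c. c \<noteq> 0 \<and> (\<forall>n. a' n = c * a n))"
proof
  assume "proj_pt a = proj_pt a'"
  moreover have "a' \<in> proj_pt a'" unfolding proj_pt_def by (auto intro!: exI[of _ 1])
  ultimately have "a' \<in> proj_pt a" by simp
  then show "\<exists>c. c \<noteq> 0 \<and> (\<forall>n. a' n = c * a n)" by (auto simp: proj_pt_def)
next
  assume "\<exists>c. c \<noteq> 0 \<and> (\<forall>n. a' n = c * a n)"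
  then obtain c where c: "c \<noteq> 0" "a' = (\<lambda>n. c * a n)" by blast
  show "proj_pt a = proj_pt a'"
  proof (intro equalityI subsetI)
    fix x assume "x \<in> proj_pt a"
    then obtain d where d: "d \<noteq> 0" "x = (\<lambda>i. d * a i)" by (auto simp: proj_pt_def)
    then show "x \<in> proj_pt a'" using c unfolding proj_pt_def by (auto intro!: exI[of _ "d / c"])
  next
    fix x assume "x \<in> proj_pt a'"
    then obtain d where d: "d \<noteq> 0" "x = (\<lambda>i. d * a' i)" by (auto simp: proj_pt_def)
    then show "x \<in> proj_pt a" using c unfolding proj_pt_def by (auto intro!: exI[of _ "d * c"] simp: mult_ac)
  qed
qed

section \<open>The ideal of relations\<close>

lemma ring_free_alg: "ring (free_alg_ring :: 'a free_alg ring)"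
proof (intro ringI abelian_groupI monoidI)
  fix x :: "'a free_alg"
  show "\<exists>y\<in>carrier free_alg_ring. y \<oplus>\<^bsub>free_alg_ring\<^esub> x = \<zero>\<^bsub>free_alg_ring\<^esub>"
    by (rule bexI[of _ "- x"]) (simp_all add: free_alg_ring_def)
qed (simp_all add: free_alg_ring_def algebra_simps)

lemma free_alg_idealD:
  assumes "ideal I (free_alg_ring :: 'a free_alg ring)"
  shows "0 \<in> I" "x \<in> I \<Longrightarrow> y \<in> I \<Longrightarrow> x + y \<in> I" "x \<in> I \<Longrightarrow> r * x \<in> I"
proof -
  interpret ideal I "free_alg_ring :: 'a free_alg ring" by fact
  show "0 \<in> I" 
    using additive_subgroup.zero_closed[OF ideal.axioms(1)[OF assms]] by (simp add: free_alg_ring_def)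
  show "x + y \<in> I" if "x \<in> I" "y \<in> I" 
    using additive_subgroup.a_closed[OF ideal.axioms(1)[OF assms] that] by (simp add: free_alg_ring_def)
  show "r * x \<in> I" if "x \<in> I" using I_l_closed[OF that, of r] by (simp add: free_alg_ring_def)
qed

lemma free_alg_ideal_sum:
  assumes "ideal I (free_alg_ring :: 'a free_alg ring)" "\<And>k. k \<in> K \<Longrightarrow> x k \<in> I"
  shows "(\<Sum>k\<in>K. x k) \<in> I"
  using assms(2) by (induction K rule: infinite_finite_induct) (auto intro: free_alg_idealD[OF assms(1)])

lemma clifford_relators_in_quad:
  fixes g :: "'p::prime_card mod_ring \<Rightarrow> 'p mod_ring free_alg"
  assumes two: "(2 :: 'p mod_ring) \<noteq> 0"
  shows "clifford_relators a g \<subseteq> quad g ` quad_relations (even_param a)"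
proof
  fix r assume "r \<in> clifford_relators a g"
  then consider (square) i j where "i \<in> {1..(CARD('p) - 1) div 2}"
      "r = scalar (a 0) * (g j * g (j + of_nat i) + g (j + of_nat i) * g j) - scalar (a i) * g (j + of_nat i / 2) ^ 2"
    | (mixed) i m k where "i \<in> {1..(CARD('p) - 1) div 2}" "m \<in> {1..(CARD('p) - 1) div 2}"
      "r = scalar (a m) * anticomm g k (of_nat i) - scalar (a i) * anticomm g k (of_nat m)"
    unfolding clifford_relators_def anticomm_def by blast
  then show "r \<in> quad g ` quad_relations (even_param a)"
  proof cases
    case square
    define k where "k = j + of_nat i / 2"
    have j: "j = k - of_nat i / 2" "j + of_nat i = k + of_nat i / 2"
      using half_add_half[OF two, of "of_nat i"] by (simp_all add: k_def add.assoc)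
    have "(scalar (a i) :: 'p mod_ring free_alg) = scalar (a i / 2) + scalar (a i / 2)"
      by (simp add: scalar_simps(1)[symmetric])
    then have "r = scalar (a 0) * anticomm g k (of_nat i) - scalar (a i / 2) * anticomm g k 0"
      unfolding square(2) k_def[symmetric] j(2) unfolding j(1) anticomm_def
      by (simp add: power2_eq_square distrib_left distrib_right)
    then show ?thesis
      using anticomm_relation[of "even_param a", OF two even_param_minus, of "a 0" "of_nat i" "a i / 2" 0 g k]
        even_param_of_nat[OF square(1), of a] by (simp add: even_param_0)
  next
    case mixed
    then show ?thesis
      using anticomm_relation[of "even_param a", OF two even_param_minus, of "a m" "of_nat i" "a i" "of_nat m" g k]
        even_param_of_nat[OF mixed(1), of a] even_param_of_nat[OF mixed(2), of a]
      by (simp add: mult.commute)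
  qed
qed

text \<open>The two families of relators, and their consequences for differences of either sign and for a
  vanishing difference, in one symmetric form.\<close>

lemma anticomm_relation_in_ideal:
  fixes g :: "'p::prime_card mod_ring \<Rightarrow> 'p mod_ring free_alg"
  assumes two: "(2 :: 'p mod_ring) \<noteq> 0" and I: "ideal I free_alg_ring" "clifford_relators a g \<subseteq> I"
  shows "scalar (even_param a m) * anticomm g k i - scalar (even_param a i) * anticomm g k m \<in> I"
proof -
  let ?b = "even_param a :: 'p mod_ring \<Rightarrow> complex"
  note I' = free_alg_idealD[OF I(1)]
  have neg: "x - y \<in> I" if "y - x \<in> I" for x y
    using I'(3)[OF that, of "- 1"] by simp
  have square: "scalar (?b 0) * anticomm g k (of_nat n) - scalar (?b (of_nat n)) * anticomm g k 0 \<in> I"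
    if n: "n \<in> {1..(CARD('p) - 1) div 2}" for n
  proof -
    have eq: "k - of_nat n / 2 + of_nat n = k + of_nat n / 2"
    proof -
      have "k - of_nat n / 2 + (of_nat n / 2 + of_nat n / 2) = k + of_nat n / 2" by simp
      then show ?thesis unfolding half_add_half[OF two] .
    qed
    have "scalar (a 0) * (g (k - of_nat n / 2) * g (k - of_nat n / 2 + of_nat n) + g (k - of_nat n / 2 + of_nat n) * g (k - of_nat n / 2))
        - scalar (a n) * g (k - of_nat n / 2 + of_nat n / 2) ^ 2 \<in> I"
      using I(2) n unfolding clifford_relators_def by blast
    then have r: "scalar (a 0) * anticomm g k (of_nat n) - scalar (a n) * g k ^ 2 \<in> I"
      unfolding eq anticomm_def diff_add_cancel .
    have "scalar (?b 0) * anticomm g k (of_nat n) - scalar (?b (of_nat n)) * anticomm g k 0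
      = (scalar (a 0) * anticomm g k (of_nat n) - scalar (a n) * g k ^ 2)
        + (scalar (a 0) * anticomm g k (of_nat n) - scalar (a n) * g k ^ 2)"
    proof -
      have "anticomm g k 0 = g k ^ 2 + g k ^ 2" by (simp add: anticomm_def power2_eq_square)
      moreover have "(scalar (?b 0) :: 'p mod_ring free_alg) = scalar (a 0) + scalar (a 0)"
        unfolding even_param_0 mult_2 by (rule scalar_simps(1))
      ultimately show ?thesis
        unfolding even_param_of_nat[OF n] by (simp only: distrib_left distrib_right) simp
    qed
    then show ?thesis using I'(2)[OF r r] by simp
  qed
  have mixed: "scalar (?b (of_nat m)) * anticomm g k (of_nat n) - scalar (?b (of_nat n)) * anticomm g k (of_nat m) \<in> I"
    if "n \<in> {1..(CARD('p) - 1) div 2}" "m \<in> {1..(CARD('p) - 1) div 2}" for n m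
    using I(2) that unfolding clifford_relators_def anticomm_def even_param_of_nat[OF that(1)] even_param_of_nat[OF that(2)]
    by blast
  define P where "P i m \<longleftrightarrow> scalar (?b m) * anticomm g k i - scalar (?b i) * anticomm g k m \<in> I" for i m
  have "P i m"
  proof (rule even_fun_cases[OF two, where b = "\<lambda>i. P i m" and P = "\<lambda>x. x"])
    show "P (- i) m = P i m" for i by (simp add: P_def anticomm_minus even_param_minus)
    show "P 0 m"
    proof (rule even_fun_cases[OF two, where b = "\<lambda>m. P 0 m" and P = "\<lambda>x. x"])
      show "P 0 (- m) = P 0 m" for m by (simp add: P_def anticomm_minus even_param_minus)
      show "P 0 0" using I'(1) by (simp add: P_def)
      show "P 0 (of_nat n)" if "n \<in> {1..(CARD('p) - 1) div 2}" for n
        using neg[OF square[OF that]] by (simp add: P_def)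
    qed
    show "P (of_nat n) m" if n: "n \<in> {1..(CARD('p) - 1) div 2}" for n
    proof (rule even_fun_cases[OF two, where b = "\<lambda>m. P (of_nat n) m" and P = "\<lambda>x. x"])
      show "P (of_nat n) (- m) = P (of_nat n) m" for m by (simp add: P_def anticomm_minus even_param_minus)
      show "P (of_nat n) 0" using square[OF n] by (simp add: P_def)
      show "P (of_nat n) (of_nat m)" if "m \<in> {1..(CARD('p) - 1) div 2}" for m
        using mixed[OF n that] by (simp add: P_def)
    qed
  qed
  then show ?thesis by (simp add: P_def)
qed

text \<open>Fix \<open>m\<close> with \<open>b(m) \<noteq> 0\<close>. Modulo the relators each \<open>anticomm g k i\<close> is \<open>b(i)/b(m)\<close> times \<open>anticomm g k m\<close>.
  So a symmetric quadratic form reduces to a combination of the \<open>anticomm g k m\<close> whose coefficients are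
  proportional to the coordinates of its contraction.\<close>

lemma quad_relations_in_ideal:
  fixes g :: "'p::prime_card mod_ring \<Rightarrow> 'p mod_ring free_alg"
  assumes two: "(2 :: 'p mod_ring) \<noteq> 0" and I: "ideal I free_alg_ring" "clifford_relators a g \<subseteq> I"
    and a: "\<exists>i :: 'p mod_ring. even_param a i \<noteq> 0" and M: "M \<in> quad_relations (even_param a)"
  shows "quad g M \<in> I"
proof -
  let ?b = "even_param a :: 'p mod_ring \<Rightarrow> complex"
  obtain m where m: "?b m \<noteq> 0" using a by blast
  define N where "N k i = M $ (k - i / 2) $ (k + i / 2)" for k i
  have sym: "M $ u $ v = M $ v $ u" for u v
    using M by (auto simp: quad_relations_def transpose_def vec_eq_iff)
  have zero: "(\<Sum>i\<in>UNIV. N k i * ?b i) = 0" for k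
    using M by (simp add: quad_relations_def contract_def vec_eq_iff N_def mult.commute)
  have "quad g M + quad g M = (\<Sum>u\<in>UNIV. \<Sum>v\<in>UNIV. scalar (M $ u $ v) * (g u * g v + g v * g u))"
  proof -
    have "quad g M = (\<Sum>u\<in>UNIV. \<Sum>v\<in>UNIV. scalar (M $ u $ v) * (g v * g u))"
      unfolding quad_def by (subst sum.swap) (simp add: sym)
    then show ?thesis by (simp add: quad_def distrib_left sum.distrib)
  qed
  also have "\<dots> = (\<Sum>k\<in>UNIV. \<Sum>i\<in>UNIV. scalar (N k i) * anticomm g k i)"
    unfolding N_def anticomm_def by (rule sum_midpoint[OF two])
  finally have q: "quad g M + quad g M = (\<Sum>k\<in>UNIV. \<Sum>i\<in>UNIV. scalar (N k i) * anticomm g k i)" .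
  have "(\<Sum>k\<in>UNIV. \<Sum>i\<in>UNIV. scalar (N k i) * (scalar (?b m) * anticomm g k i - scalar (?b i) * anticomm g k m))
      = (\<Sum>k\<in>UNIV. \<Sum>i\<in>UNIV. scalar (?b m) * (scalar (N k i) * anticomm g k i))
        - (\<Sum>k\<in>UNIV. scalar (\<Sum>i\<in>UNIV. N k i * ?b i) * anticomm g k m)"
    unfolding scalar_sum sum_distrib_right sum_subtractf[symmetric] right_diff_distrib
      scalar_left_commute[of _ "?b m"] scalar_simps(2) mult.assoc ..
  also have "\<dots> = scalar (?b m) * (quad g M + quad g M)"
    unfolding zero q by (simp add: scalar_simps sum_distrib_left)
  finally have "scalar (?b m) * (quad g M + quad g M) \<in> I"
    using free_alg_ideal_sum[OF I(1)] free_alg_idealD(3)[OF I(1)] anticomm_relation_in_ideal[OF two I]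
    by (metis (no_types, lifting))
  then have "scalar (1 / (2 * ?b m)) * (scalar (?b m) * (quad g M + quad g M)) \<in> I"
    by (rule free_alg_idealD(3)[OF I(1)])
  also have "scalar (1 / (2 * ?b m)) * (scalar (?b m) * (quad g M + quad g M)) = (scalar (1 / 2) + scalar (1 / 2)) * quad g M"
    using m by (simp add: mult.assoc[symmetric] scalar_simps(2)[symmetric] distrib_left distrib_right)
  also have "\<dots> = quad g M" by (simp add: scalar_simps(1)[symmetric] scalar_simps(4))
  finally show ?thesis .
qed

lemma genideal_clifford_relators:
  fixes g :: "'p::prime_card mod_ring \<Rightarrow> 'p mod_ring free_alg"
  assumes two: "(2 :: 'p mod_ring) \<noteq> 0" and a: "\<exists>i :: 'p mod_ring. even_param a i \<noteq> 0"
  shows "Idl\<^bsub>free_alg_ring\<^esub> (clifford_relators a g) = Idl\<^bsub>free_alg_ring\<^esub> (quad g ` quad_relations (even_param a))"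
proof -
  interpret R: ring "free_alg_ring :: 'p mod_ring free_alg ring" by (rule ring_free_alg)
  have c: "S \<subseteq> carrier (free_alg_ring :: 'p mod_ring free_alg ring)" for S by (simp add: free_alg_ring_def)
  show ?thesis
  proof
    show "Idl\<^bsub>free_alg_ring\<^esub> (clifford_relators a g) \<subseteq> Idl\<^bsub>free_alg_ring\<^esub> (quad g ` quad_relations (even_param a))"
      using clifford_relators_in_quad[OF two, of a g] R.genideal_self[OF c]
      by (intro R.genideal_minimal[OF R.genideal_ideal[OF c]]) blast
    show "Idl\<^bsub>free_alg_ring\<^esub> (quad g ` quad_relations (even_param a)) \<subseteq> Idl\<^bsub>free_alg_ring\<^esub> (clifford_relators a g)"
      using quad_relations_in_ideal[OF two R.genideal_ideal[OF c] R.genideal_self[OF c] a]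
      by (intro R.genideal_minimal[OF R.genideal_ideal[OF c]]) blast
  qed
qed

lemma lin_form_eq: "lin_form v = (\<Sum>i\<in>UNIV. Poly_Mapping.single (Word [i]) (v $ i))"
  by (simp add: lin_form_def scalar_def xgen_def mult_single)

lemma quad_xgen: "quad xgen M = (\<Sum>i\<in>UNIV. \<Sum>j\<in>UNIV. Poly_Mapping.single (Word [i, j]) (M $ i $ j))"
  by (simp add: quad_def scalar_def xgen_def mult_single)

lemma single_sum: "Poly_Mapping.single k (\<Sum>i\<in>I. f i) = (\<Sum>i\<in>I. Poly_Mapping.single k (f i))"
  by (induction I rule: infinite_finite_induct) (simp_all add: single_add)

text \<open>A linear change of generators acts on quadratic forms by congruence.\<close>

lemma quad_lin_form:
  "quad (\<lambda>k. lin_form (T *v axis k 1)) M = quad xgen (T ** M ** transpose T)"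
proof -
  have "quad xgen (T ** M ** transpose T) =
     (\<Sum>i\<in>UNIV. \<Sum>j\<in>UNIV. \<Sum>u\<in>UNIV. \<Sum>v\<in>UNIV. Poly_Mapping.single (Word [i, j]) (M $ u $ v * (T $ i $ u * T $ j $ v)))"
    by (simp add: quad_xgen single_sum congruence_nth)
  also have "\<dots> = (\<Sum>u\<in>UNIV. \<Sum>v\<in>UNIV. \<Sum>i\<in>UNIV. \<Sum>j\<in>UNIV. Poly_Mapping.single (Word [i, j]) (M $ u $ v * (T $ i $ u * T $ j $ v)))"
    unfolding sum.cartesian_product
    by (rule sum.reindex_bij_witness[of _ "\<lambda>(u, v, i, j). (i, j, u, v)" "\<lambda>(i, j, u, v). (u, v, i, j)"]) auto
  also have "\<dots> = quad (\<lambda>k. lin_form (T *v axis k 1)) M"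
    unfolding quad_def lin_form_eq scalar_def sum_product
    by (simp add: mult_single matrix_vec_axis sum_distrib_left)
  finally show ?thesis ..
qed

section \<open>The degree two part of the ideal\<close>

lemma Word_add_eq_iff: "Word l = Word u + q \<longleftrightarrow> (\<exists>v. q = Word v \<and> l = u @ v)"
  by (cases q) auto

text \<open>If \<open>x\<close> has no terms of degree below two, only the constant term of the other factor can contribute to
  the terms of degree at most two.\<close>

lemma lookup_mult_low_right:
  assumes x: "\<And>l. length l < 2 \<Longrightarrow> Poly_Mapping.lookup x (Word l) = 0" and l: "length l \<le> 2"
  shows "Poly_Mapping.lookup (f * x) (Word l) = Poly_Mapping.lookup f 0 * Poly_Mapping.lookup x (Word l)"
proof -
  have "(\<Sum>q. Poly_Mapping.lookup x q when Word l = u + q) = (Poly_Mapping.lookup x (Word l) when u = 0)" for u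
  proof (cases u)
    case (Word us)
    show ?thesis
    proof (cases us)
      case Nil
      then have "u = 0" by (simp add: Word zero_free_monoid_def)
      then show ?thesis by simp
    next
      case (Cons y ys)
      have "(Poly_Mapping.lookup x q when Word l = u + q) = 0" for q
        using x l by (auto simp: Word Cons Word_add_eq_iff when_def)
      then show ?thesis by (simp add: Word Cons zero_free_monoid_def)
    qed
  qed
  then show ?thesis by (simp add: lookup_mult mult_when)
qed

lemma lookup_mult_low_left:
  assumes x: "\<And>l. length l < 2 \<Longrightarrow> Poly_Mapping.lookup x (Word l) = 0" and l: "length l \<le> 2"
  shows "Poly_Mapping.lookup (x * f) (Word l) = Poly_Mapping.lookup x (Word l) * Poly_Mapping.lookup f 0"
proof -
  have "Poly_Mapping.lookup x u * (\<Sum>q. Poly_Mapping.lookup f q when Word l = u + q) = (Poly_Mapping.lookup x (Word l) * Poly_Mapping.lookup f 0 when u = Word l)" for u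
  proof (cases "u = Word l")
    case True
    have "(Poly_Mapping.lookup f q when Word l = u + q) = (Poly_Mapping.lookup f 0 when q = 0)" for q
      by (auto simp: True Word_add_eq_iff zero_free_monoid_def when_def)
    then show ?thesis by (simp add: True)
  next
    case False
    show ?thesis
    proof (cases "Poly_Mapping.lookup x u = 0")
      case nz: False
      obtain us where us: "u = Word us" by (cases u)
      have "length us \<ge> 2" using nz x us by (meson not_le)
      have "\<not> Word l = u + q" for q
      proof
        assume "Word l = u + q"
        then obtain v where v: "l = us @ v" by (auto simp: us Word_add_eq_iff)
        then have "v = []" using l \<open>length us \<ge> 2\<close> by (cases v) auto
        then show False using False v us by simp
      qed
      then show ?thesis using False by simp
    qed (simp add: False)
  qed
  then show ?thesis by (simp add: lookup_mult)
qed

text \<open>An ideal that contains everything of degree at least three, but in degree two only the relations.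
  It separates the relations from the other quadratic forms.\<close>

definition low_degree_ideal :: "('p::prime_card mod_ring \<Rightarrow> complex) \<Rightarrow> 'p mod_ring free_alg set" where
  "low_degree_ideal b = {x. (\<forall>l. length l < 2 \<longrightarrow> Poly_Mapping.lookup x (Word l) = 0) \<and>
     (\<chi> i j. Poly_Mapping.lookup x (Word [i, j])) \<in> quad_relations b}"

lemma quad_relations_linear:
  "0 \<in> quad_relations b" "M \<in> quad_relations b \<Longrightarrow> N \<in> quad_relations b \<Longrightarrow> M + N \<in> quad_relations b"
  "M \<in> quad_relations b \<Longrightarrow> (\<chi> i j. c * M $ i $ j) \<in> quad_relations b"
proof -
  show "0 \<in> quad_relations b" by (simp add: quad_relations_def transpose_linear contract_linear)
  show "M \<in> quad_relations b \<Longrightarrow> N \<in> quad_relations b \<Longrightarrow> M + N \<in> quad_relations b"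
    by (simp add: quad_relations_def transpose_linear contract_linear)
  show "(\<chi> i j. c * M $ i $ j) \<in> quad_relations b" if "M \<in> quad_relations b"
  proof -
    have "contract b (\<chi> i j. c * M $ i $ j) = c *s contract b M"
      by (simp add: contract_def vec_eq_iff sum_distrib_left mult_ac)
    then show ?thesis using that by (auto simp: quad_relations_def transpose_def vec_eq_iff)
  qed
qed

lemma low_degree_ideal_lin:
  "0 \<in> low_degree_ideal b"
  "x \<in> low_degree_ideal b \<Longrightarrow> y \<in> low_degree_ideal b \<Longrightarrow> x + y \<in> low_degree_ideal b"
  "x \<in> low_degree_ideal b \<Longrightarrow> r * x \<in> low_degree_ideal b"
  "x \<in> low_degree_ideal b \<Longrightarrow> x * r \<in> low_degree_ideal b"
proof -
  have "(\<chi> i j. 0) = (0 :: complex ^ 'a mod_ring ^ 'a mod_ring)" by (simp add: vec_eq_iff)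
  then show "0 \<in> low_degree_ideal b" using quad_relations_linear(1)[of b] by (simp add: low_degree_ideal_def)
  show "x + y \<in> low_degree_ideal b" if "x \<in> low_degree_ideal b" "y \<in> low_degree_ideal b"
  proof -
    have "(\<chi> i j. Poly_Mapping.lookup (x + y) (Word [i, j])) = (\<chi> i j. Poly_Mapping.lookup x (Word [i, j])) + (\<chi> i j. Poly_Mapping.lookup y (Word [i, j]))"
      by (simp add: vec_eq_iff lookup_add)
    then show ?thesis using that quad_relations_linear(2) by (auto simp: low_degree_ideal_def lookup_add)
  qed
  assume x: "x \<in> low_degree_ideal b"
  then have low: "\<And>l. length l < 2 \<Longrightarrow> Poly_Mapping.lookup x (Word l) = 0" by (simp add: low_degree_ideal_def)
  have sc: "(\<chi> i j. c * Poly_Mapping.lookup x (Word [i, j])) \<in> quad_relations b" for c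
    using quad_relations_linear(3)[of "\<chi> i j. Poly_Mapping.lookup x (Word [i, j])" b c] x by (simp add: low_degree_ideal_def)
  show "r * x \<in> low_degree_ideal b"
    using sc[of "Poly_Mapping.lookup r 0"] low by (simp add: low_degree_ideal_def lookup_mult_low_right[OF low])
  show "x * r \<in> low_degree_ideal b"
    using sc[of "Poly_Mapping.lookup r 0"] low by (simp add: low_degree_ideal_def lookup_mult_low_left[OF low] mult.commute)
qed

lemma ideal_low_degree_ideal: "ideal (low_degree_ideal b) free_alg_ring"
proof (rule idealI)
  interpret R: ring "free_alg_ring :: 'a mod_ring free_alg ring" by (rule ring_free_alg)
  have neg: "\<ominus>\<^bsub>free_alg_ring\<^esub> x = - x" for x :: "'a mod_ring free_alg"
    by (rule R.minus_equality) (simp_all add: free_alg_ring_def)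
  have "- x \<in> low_degree_ideal b" if "x \<in> low_degree_ideal b" for x
    using low_degree_ideal_lin(3)[OF that, of "- 1"] by simp
  then show "subgroup (low_degree_ideal b) (add_monoid free_alg_ring)"
    using low_degree_ideal_lin(1)[of b] low_degree_ideal_lin(2)[where b = b]
    by (intro R.add.subgroupI) (auto simp: neg[unfolded a_inv_def] a_inv_def[symmetric] neg, auto simp: free_alg_ring_def)
qed (use low_degree_ideal_lin(3,4) ring_free_alg in \<open>auto simp: free_alg_ring_def\<close>)

lemma lookup_quad_xgen:
  "Poly_Mapping.lookup (quad xgen M) (Word [i, j]) = M $ i $ j"
  "length l < 2 \<Longrightarrow> Poly_Mapping.lookup (quad xgen M) (Word l) = 0"
proof -
  have "Poly_Mapping.lookup (quad xgen M) (Word [i, j]) = (\<Sum>u\<in>UNIV. \<Sum>v\<in>UNIV. if u = i then if v = j then M $ i $ j else 0 else 0)"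
    unfolding quad_xgen lookup_sum by (intro sum.cong refl) (simp add: lookup_single when_def)
  also have "\<dots> = (\<Sum>u\<in>UNIV. if u = i then M $ i $ j else 0)"
    by (rule sum.cong) auto
  finally show "Poly_Mapping.lookup (quad xgen M) (Word [i, j]) = M $ i $ j" by simp
  show "Poly_Mapping.lookup (quad xgen M) (Word l) = 0" if "length l < 2"
    unfolding quad_xgen lookup_sum using that by (intro sum.neutral ballI) (auto simp: lookup_single when_def)
qed

lemma quad_xgen_in_genideal_iff:
  fixes a :: "nat \<Rightarrow> complex" and M :: "complex ^ 'p::prime_card mod_ring ^ 'p mod_ring"
  assumes two: "(2 :: 'p mod_ring) \<noteq> 0" and a: "\<exists>i :: 'p mod_ring. even_param a i \<noteq> 0"
  shows "quad xgen M \<in> Idl\<^bsub>free_alg_ring\<^esub> (clifford_relators a xgen) \<longleftrightarrow> M \<in> quad_relations (even_param a)"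
proof
  interpret R: ring "free_alg_ring :: 'p mod_ring free_alg ring" by (rule ring_free_alg)
  have mem: "quad xgen N \<in> low_degree_ideal b \<longleftrightarrow> N \<in> quad_relations b" for N b
    by (simp add: low_degree_ideal_def lookup_quad_xgen)
  have "Idl\<^bsub>free_alg_ring\<^esub> (clifford_relators a xgen) \<subseteq> low_degree_ideal (even_param a :: 'p mod_ring \<Rightarrow> _)"
    using clifford_relators_in_quad[OF two, of a xgen] mem
    by (intro R.genideal_minimal[OF ideal_low_degree_ideal]) blast
  then show "M \<in> quad_relations (even_param a)"
    if "quad xgen M \<in> Idl\<^bsub>free_alg_ring\<^esub> (clifford_relators a xgen)" using that mem by blast
  have c: "S \<subseteq> carrier (free_alg_ring :: 'p mod_ring free_alg ring)" for S by (simp add: free_alg_ring_def)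
  show "quad xgen M \<in> Idl\<^bsub>free_alg_ring\<^esub> (clifford_relators a xgen)" if "M \<in> quad_relations (even_param a)"
    unfolding genideal_clifford_relators[OF two a] using R.genideal_self[OF c] that by blast
qed

text \<open>The ideal is recovered from the quotient ring as its zero element.\<close>

lemma clifford_presented_eq_iff:
  "clifford_presented a g = clifford_presented a' g' \<longleftrightarrow>
    Idl\<^bsub>free_alg_ring\<^esub> (clifford_relators a g) = Idl\<^bsub>free_alg_ring\<^esub> (clifford_relators a' g')"
proof
  assume "clifford_presented a g = clifford_presented a' g'"
  then have "\<zero>\<^bsub>clifford_presented a g\<^esub> = \<zero>\<^bsub>clifford_presented a' g'\<^esub>" by (rule arg_cong)
  then show "Idl\<^bsub>free_alg_ring\<^esub> (clifford_relators a g) = Idl\<^bsub>free_alg_ring\<^esub> (clifford_relators a' g')"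
    by (simp add: clifford_presented_def FactRing_def)
qed (simp add: clifford_presented_def)

text \<open>The quadratic form \<open>b(m) s_i - b(i) s_m\<close>, with \<open>s_i\<close> the symmetrised product of difference \<open>i\<close> and midpoint
  \<open>0\<close>, is a relation for \<open>b\<close>. That it is one for \<open>b'\<close> says \<open>b(m) b'(i) = b(i) b'(m)\<close>.\<close>

lemma quad_relations_subset_proportional:
  assumes two: "(2 :: 'p::prime_card mod_ring) \<noteq> 0" and even: "\<And>i :: 'p mod_ring. b (- i) = b i" "\<And>i. b' (- i) = b' i"
    and nz: "\<exists>i. b i \<noteq> 0" "\<exists>i. b' i \<noteq> 0" and sub: "quad_relations b \<subseteq> quad_relations b'"
  shows "\<exists>c. c \<noteq> 0 \<and> (\<forall>i. b i = c * b' i)"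
proof -
  have cross: "b m * b' i = b i * b' m" for i m
  proof -
    have "anticomm_matrix (b m) 0 i - anticomm_matrix (b i) 0 m \<in> quad_relations b"
      by (simp add: quad_relations_def transpose_linear transpose_anticomm_matrix contract_linear
          contract_anticomm_matrix[of b, OF two even(1)] mult_ac)
    then have "contract b' (anticomm_matrix (b m) 0 i - anticomm_matrix (b i) 0 m) = 0"
      using sub by (auto simp: quad_relations_def)
    then have "(2 * b m * b' i) *s axis 0 1 = (2 * b i * b' m) *s axis (0 :: 'p mod_ring) 1"
      by (simp add: contract_linear contract_anticomm_matrix[of b', OF two even(2)])
    then show ?thesis by (simp add: axis_eq_0_iff)
  qed
  obtain m where m: "b' m \<noteq> 0" using nz by blast
  define c where "c = b m / b' m"
  have *: "b i = c * b' i" for i using cross[of m i] m unfolding c_def by (metis mult.commute nonzero_eq_divide_eq times_divide_eq_left)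
  then have "c \<noteq> 0" using nz(1) by (metis mult_zero_left)
  then show ?thesis using * by blast
qed

section \<open>Change of generators and change of parameters\<close>

text \<open>Every \<open>T\<close> that intertwines is a multiple of the one in the definition of \<^const>\<open>moves\<close>, and the intertwiner on the
  side of the contractions is injective, so that the two kernels correspond.\<close>

lemma moves_quad_relations:
  assumes mv: "intertwiner (1 :: 'p::prime_card mod_ring) f T" "f \<in> heis_auts" "moves f b b'"
    and two: "(2 :: 'p mod_ring) \<noteq> 0"
  shows "quad_relations b = (\<lambda>M. T ** M ** transpose T) ` quad_relations b'"
proof -
  obtain S S' where S: "intertwiner (1 :: 'p mod_ring) f S" "intertwiner 2 f S'"
    "\<And>M. contract b (S ** M ** transpose S) = S' *v contract b' M"
    using mv(3) unfolding moves_def by blast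
  obtain c where c: "c \<noteq> 0" "\<forall>j k. S $ j $ k = c * T $ j $ k"
    using intertwiner_unique[OF _ mv(2) mv(1) S(1)] by auto
  have "contract b (S ** M ** transpose S) = (c * c) *s contract b (T ** M ** transpose T)" for M
    unfolding contract_congruence matrix_entries_scale[OF c(2)] contract_outer_scale
    by (simp add: vec_eq_iff sum_distrib_left mult_ac)
  then have eq: "contract b (T ** M ** transpose T) = 0 \<longleftrightarrow> contract b' M = 0" for M
    using S(3)[of M] c(1) intertwiner_inj[OF two S(2)] by auto
  obtain R where R: "T ** R = mat 1" "R ** T = mat 1"
    using intertwiner_invertible[OF _ mv(1)] by (auto simp: invertible_def)
  have R': "transpose R ** transpose T = mat 1" "transpose T ** transpose R = mat 1"
    using R by (simp_all add: matrix_transpose_mul[symmetric])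
  show ?thesis
  proof (intro equalityI subsetI)
    fix M assume M: "M \<in> quad_relations b"
    have TR: "T ** (R ** M ** transpose R) ** transpose T = M"
    proof -
      have "T ** (R ** M ** transpose R) ** transpose T = (T ** R) ** M ** (transpose R ** transpose T)"
        by (simp add: matrix_mul_assoc)
      then show ?thesis by (simp add: R R')
    qed
    then have "R ** M ** transpose R \<in> quad_relations b'"
      using M eq[of "R ** M ** transpose R"]
      by (simp add: quad_relations_def matrix_transpose_mul matrix_mul_assoc)
    then show "M \<in> (\<lambda>M. T ** M ** transpose T) ` quad_relations b'" using TR by (metis image_eqI)
  next
    fix M assume "M \<in> (\<lambda>M. T ** M ** transpose T) ` quad_relations b'"
    then show "M \<in> quad_relations b"
      using eq by (auto simp: quad_relations_def matrix_transpose_mul matrix_mul_assoc)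
  qed
qed

text \<open>Equality of the ideals only yields that the relations for \<open>a'\<close>, rewritten in the \<open>y_k\<close>, are among those
  for \<open>a\<close>. The latter are the rewritten relations for the transformed parameters \<open>b'\<close>, and an inclusion
  between two such spaces of relations forces \<open>a'\<close> to be proportional to \<open>b'\<close>.\<close>

lemma clifford_presentations_agree_iff:
  assumes two: "(2 :: 'p::prime_card mod_ring) \<noteq> 0" and f: "f \<in> heis_auts" and T: "intertwiner (1 :: 'p mod_ring) f T"
    and a: "\<exists>i :: 'p mod_ring. even_param a i \<noteq> 0" "\<exists>i :: 'p mod_ring. even_param a' i \<noteq> 0"
  shows "heis_clifford_algebra a = clifford_presented a' (\<lambda>k. lin_form (T *v axis k 1)) \<longleftrightarrow>
    moves f (even_param a) (even_param a')"
proof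
  interpret R: ring "free_alg_ring :: 'p mod_ring free_alg ring" by (rule ring_free_alg)
  let ?y = "\<lambda>k. lin_form (T *v axis k 1)"
  have img: "quad ?y ` S = quad xgen ` (\<lambda>M. T ** M ** transpose T) ` S" for S
    by (simp add: image_image quad_lin_form)
  {
    assume "moves f (even_param a) (even_param a')"
    from moves_quad_relations[OF T f this two] show "heis_clifford_algebra a = clifford_presented a' ?y"
      unfolding heis_clifford_algebra_def clifford_presented_eq_iff
        genideal_clifford_relators[OF two a(1)] genideal_clifford_relators[OF two a(2)] img
      by (simp only:)
  }
  assume "heis_clifford_algebra a = clifford_presented a' ?y"
  then have eq: "Idl\<^bsub>free_alg_ring\<^esub> (clifford_relators a xgen) = Idl\<^bsub>free_alg_ring\<^esub> (quad ?y ` quad_relations (even_param a'))"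
    unfolding heis_clifford_algebra_def clifford_presented_eq_iff genideal_clifford_relators[OF two a(2)] .
  have c: "S \<subseteq> carrier (free_alg_ring :: 'p mod_ring free_alg ring)" for S by (simp add: free_alg_ring_def)
  have gens: "quad ?y ` quad_relations (even_param a') \<subseteq> Idl\<^bsub>free_alg_ring\<^esub> (clifford_relators a xgen)"
    unfolding eq by (rule R.genideal_self[OF c])
  have sub: "T ** M ** transpose T \<in> quad_relations (even_param a)" if "M \<in> quad_relations (even_param a')" for M
  proof -
    have "quad ?y M \<in> Idl\<^bsub>free_alg_ring\<^esub> (clifford_relators a xgen)"
      using that gens by blast
    then show ?thesis unfolding quad_lin_form quad_xgen_in_genideal_iff[OF two a(1)] .
  qed
  obtain b' where b': "\<And>i :: 'p mod_ring. b' (- i) = b' i" "\<exists>i. b' i \<noteq> 0" "moves f (even_param a) b'"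
    using moves_exists[OF two f even_param_minus a(1)] by metis
  obtain R where R: "R ** T = mat 1"
    using intertwiner_invertible[OF _ T] by (auto simp: invertible_def)
  have inj: "M = N" if "T ** M ** transpose T = T ** N ** transpose T" for M N
  proof -
    have "R ** (T ** L ** transpose T) ** transpose R = (R ** T) ** L ** transpose (R ** T)" for L
      by (simp add: matrix_mul_assoc matrix_transpose_mul)
    then have L: "R ** (T ** L ** transpose T) ** transpose R = L" for L by (simp add: R)
    show ?thesis using L[of M] unfolding that L[of N] by (rule sym)
  qed
  have "quad_relations (even_param a') \<subseteq> quad_relations b'"
  proof
    fix M :: "complex ^ 'p mod_ring ^ 'p mod_ring" assume "M \<in> quad_relations (even_param a')"
    from sub[OF this] obtain N where eq: "T ** M ** transpose T = T ** N ** transpose T" and N: "N \<in> quad_relations b'"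
      unfolding moves_quad_relations[OF T f b'(3) two] by (rule imageE)
    have "M = N" by (rule inj[OF eq])
    show "M \<in> quad_relations b'" unfolding \<open>M = N\<close> by (rule N)
  qed
  then obtain c where "c \<noteq> 0" "\<And>i :: 'p mod_ring. even_param a' i = c * b' i"
    using quad_relations_subset_proportional[OF two even_param_minus b'(1) a(2) b'(2)] by metis
  moreover from this have "even_param a' = (\<lambda>i. c * b' i)" by (intro ext)
  ultimately show "moves f (even_param a) (even_param a')"
    using moves_scale[OF b'(3), of 1 c] by simp
qed

section \<open>Lifts of matrices to the Heisenberg group\<close>

lemma heis_ab_eq: "heis_ab (a, b, c) = vector [a, b]"
  by (simp add: heis_ab_def)

lemma matrix2_apply: "(A :: 'a::comm_semiring_1 ^ 2 ^ 2) *v vector [a, b] = vector [A $ 1 $ 1 * a + A $ 1 $ 2 * b, A $ 2 $ 1 * a + A $ 2 $ 2 * b]"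
  by (simp add: vec_eq_iff forall_2 matrix_vector_mult_def sum_2)

lemma vector2_eq_iff: "vector [a, b] = (vector [c, d] :: 'a::zero ^ 2) \<longleftrightarrow> a = c \<and> b = d"
  by (auto simp: vec_eq_iff forall_2)

lemma heis_lift_apply:
  assumes "f \<in> heis_lifts A"
  shows "\<exists>c'. f (a, b, c) = (A $ 1 $ 1 * a + A $ 1 $ 2 * b, A $ 2 $ 1 * a + A $ 2 $ 2 * b, c')"
proof -
  obtain x y z where f: "f (a, b, c) = (x, y, z)" by (cases "f (a, b, c)")
  have "heis_ab (f (a, b, c)) = A *v heis_ab (a, b, c)" using assms unfolding heis_lifts_def by blast
  then show ?thesis by (simp add: f heis_ab_eq matrix2_apply vector2_eq_iff)
qed

lemma heis_lift_e2:
  assumes "f \<in> heis_lifts A" obtains c where "f e2 = (A $ 1 $ 2, A $ 2 $ 2, c)"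
  using heis_lift_apply[OF assms, of 0 1 0] by (auto simp: e2_def)

text \<open>The lift is linear in \<open>(a, b)\<close> with a quadratic correction \<open>q\<close> in the central coordinate. That \<open>q\<close> exists
  rests on the determinant being 1: it makes the difference of the two cocycles symmetric, hence the
  polarisation of a quadratic form.\<close>

lemma heis_lift_exists:
  fixes A :: "'p::prime_card mod_ring ^ 2 ^ 2"
  assumes two: "(2 :: 'p mod_ring) \<noteq> 0" and "det A = 1"
  shows "\<exists>f. f \<in> heis_lifts A"
proof -
  define \<alpha> \<beta> \<gamma> \<delta> where "\<alpha> = A $ 1 $ 1" and "\<beta> = A $ 1 $ 2" and "\<gamma> = A $ 2 $ 1" and "\<delta> = A $ 2 $ 2"
  have det: "\<alpha> * \<delta> = 1 + \<beta> * \<gamma>"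
    using assms(2) by (simp add: det_2 \<alpha>_def \<beta>_def \<gamma>_def \<delta>_def diff_eq_eq)
  \<comment> \<open>The polarisation of \<open>q\<close> is the difference of the pullback under \<open>A\<close> of the form \<open>b a'\<close> and this form itself.\<close>
  define q where "q a b = (\<alpha> * \<gamma> * a\<^sup>2 + 2 * (\<beta> * \<gamma>) * a * b + \<beta> * \<delta> * b\<^sup>2) / 2" for a b
  define f where "f h = (case h of (a, b, c) \<Rightarrow> (\<alpha> * a + \<beta> * b, \<gamma> * a + \<delta> * b, c - q a b))" for h
  have polar: "q (a + a') (b + b') = q a b + q a' b' + (\<gamma> * a + \<delta> * b) * (\<alpha> * a' + \<beta> * b') - b * a'" for a b a' b'
  proof -
    define r where "r a b = \<alpha> * \<gamma> * a\<^sup>2 + 2 * (\<beta> * \<gamma>) * a * b + \<beta> * \<delta> * b\<^sup>2" for a b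
    have "(\<gamma> * a + \<delta> * b) * (\<alpha> * a' + \<beta> * b') - b * a'
        = \<alpha> * \<gamma> * a * a' + \<beta> * \<gamma> * (a * b') + \<beta> * \<delta> * b * b' + (\<alpha> * \<delta> - 1) * (b * a')"
      by (simp add: algebra_simps)
    then have "r (a + a') (b + b') = r a b + r a' b' + ((\<gamma> * a + \<delta> * b) * (\<alpha> * a' + \<beta> * b') - b * a') * 2"
      unfolding det r_def by (simp add: power2_eq_square algebra_simps)
    then have "r (a + a') (b + b') / 2 = (r a b + r a' b' + ((\<gamma> * a + \<delta> * b) * (\<alpha> * a' + \<beta> * b') - b * a') * 2) / 2"
      by simp
    also have "\<dots> = r a b / 2 + r a' b' / 2 + ((\<gamma> * a + \<delta> * b) * (\<alpha> * a' + \<beta> * b') - b * a')"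
      unfolding add_divide_distrib using two by simp
    finally show ?thesis unfolding q_def r_def by (simp only: add_diff_eq)
  qed
  have "f \<in> hom heis heis"
  proof (rule homI)
    fix g h :: "'p heis"
    obtain a b c a' b' c' where "g = (a, b, c)" "h = (a', b', c')" by (cases g; cases h) auto
    then show "f (g \<otimes>\<^bsub>heis\<^esub> h) = f g \<otimes>\<^bsub>heis\<^esub> f h"
      by (simp add: f_def polar) (simp add: algebra_simps)
  qed simp
  moreover have "inj f"
  proof (rule injI)
    fix g h :: "'p heis" assume eq: "f g = f h"
    obtain a b c a' b' c' where gh: "g = (a, b, c)" "h = (a', b', c')" by (cases g; cases h) auto
    have 1: "\<alpha> * a + \<beta> * b = \<alpha> * a' + \<beta> * b'" and 2: "\<gamma> * a + \<delta> * b = \<gamma> * a' + \<delta> * b'"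
      and 3: "c - q a b = c' - q a' b'" using eq by (simp_all add: gh f_def)
    have "x = \<delta> * (\<alpha> * x + \<beta> * y) - \<beta> * (\<gamma> * x + \<delta> * y)" "y = \<alpha> * (\<gamma> * x + \<delta> * y) - \<gamma> * (\<alpha> * x + \<beta> * y)" for x y
    proof -
      have "\<delta> * (\<alpha> * x + \<beta> * y) - \<beta> * (\<gamma> * x + \<delta> * y) = (\<alpha> * \<delta> - \<beta> * \<gamma>) * x" by (simp add: algebra_simps)
      then show "x = \<delta> * (\<alpha> * x + \<beta> * y) - \<beta> * (\<gamma> * x + \<delta> * y)" by (simp add: det)
      have "\<alpha> * (\<gamma> * x + \<delta> * y) - \<gamma> * (\<alpha> * x + \<beta> * y) = (\<alpha> * \<delta> - \<beta> * \<gamma>) * y" by (simp add: algebra_simps)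
      then show "y = \<alpha> * (\<gamma> * x + \<delta> * y) - \<gamma> * (\<alpha> * x + \<beta> * y)" by (simp add: det)
    qed
    then have "a = a'" "b = b'" using 1 2 by metis+
    then show "g = h" using 3 by (simp add: gh)
  qed
  then have "bij f" by (simp add: bij_def finite_UNIV_inj_surj)
  moreover have "f hz = hz" by (simp add: f_def hz_def q_def)
  moreover have "heis_ab (f h) = A *v heis_ab h" for h
    by (cases h) (simp add: f_def heis_ab_eq matrix2_apply vector2_eq_iff \<alpha>_def \<beta>_def \<gamma>_def \<delta>_def)
  ultimately show ?thesis by (auto simp: heis_lifts_def iso_def)
qed

lemma heis_lifts_comp:
  assumes "f \<in> heis_lifts A" "g \<in> heis_lifts B" shows "f \<circ> g \<in> heis_lifts (A ** B)"
proof -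
  have "f \<circ> g \<in> hom heis heis"
    by (rule homI) (simp_all add: heis_aut_mult[OF heis_lifts_auts[OF assms(1)]] heis_aut_mult[OF heis_lifts_auts[OF assms(2)]] del: heis_simps(3))
  moreover have "heis_ab ((f \<circ> g) h) = (A ** B) *v heis_ab h" for h
    using assms unfolding heis_lifts_def by (simp only: mem_Collect_eq o_apply matrix_vector_mul_assoc[symmetric])
  ultimately show ?thesis
    using assms bij_comp[of g f] by (auto simp: heis_lifts_def iso_def)
qed

lemma heis_lifts_inv:
  assumes "f \<in> heis_lifts A" "B ** A = mat 1" shows "inv_into UNIV f \<in> heis_lifts B"
proof -
  have f: "f \<in> heis_auts" by (rule heis_lifts_auts[OF assms(1)])
  have bij: "bij f" by (rule heis_aut_bij[OF f])
  have fi: "f (inv_into UNIV f x) = x" for x using bij by (simp add: bij_def surj_f_inv_f)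
  have inv_eq: "inv_into UNIV f y = x" if "f x = y" for x y using bij that by (simp add: bij_def inv_f_eq)
  have "inv_into UNIV f \<in> hom heis heis"
  proof (rule homI)
    show "inv_into UNIV f (x \<otimes>\<^bsub>heis\<^esub> y) = inv_into UNIV f x \<otimes>\<^bsub>heis\<^esub> inv_into UNIV f y" for x y
      by (rule inv_eq) (simp only: heis_aut_mult[OF f] fi)
  qed simp
  moreover have "inv_into UNIV f hz = hz" using f by (intro inv_eq) (simp add: heis_auts_def)
  moreover have "heis_ab (inv_into UNIV f h) = B *v heis_ab h" for h
  proof -
    have "heis_ab h = A *v heis_ab (inv_into UNIV f h)" using assms(1) fi[of h] unfolding heis_lifts_def by (metis (mono_tags, lifting) mem_Collect_eq)
    then show ?thesis by (simp add: matrix_vector_mul_assoc assms(2))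
  qed
  ultimately show ?thesis using bij_imp_bij_inv[OF bij] by (auto simp: heis_lifts_def iso_def)
qed

lemma heis_lifts_id: "id \<in> heis_lifts (mat 1)"
  by (auto simp: heis_lifts_def iso_def hom_def)

lemma e1_power_in_hom:
  fixes f :: "'p::prime_card heis \<Rightarrow> 'p heis"
  assumes f: "f \<in> heis_auts"
  shows "f e1 [^]\<^bsub>heis\<^esub> (- to_int_mod_ring k) = f (- k, 0, 0)"
proof -
  interpret group_hom heis heis f by (rule heis_aut_hom[OF f])
  obtain n where n: "to_int_mod_ring k = int n" "k = of_nat n"
  proof -
    have "0 \<le> to_int_mod_ring k" by transfer auto
    then show ?thesis using that[of "nat (to_int_mod_ring k)"] by (simp add: of_nat_of_int_mod_ring)
  qed
  have "(e1 :: 'p heis) [^]\<^bsub>heis\<^esub> (- int n) = (- of_nat n, 0, 0)"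
    by (subst G.int_pow_neg_int) (simp_all add: e1_def heis_pow heis_inv)
  moreover have "f e1 [^]\<^bsub>heis\<^esub> (- to_int_mod_ring k) = f (e1 [^]\<^bsub>heis\<^esub> (- to_int_mod_ring k))"
    by (simp add: hom_int_pow)
  ultimately show ?thesis unfolding n(1) by (simp add: n(2))
qed

text \<open>For a fixed lift \<open>f\<close> each \<open>y_0\<close> is column \<open>0\<close> of an intertwiner, and \<^const>\<open>moves\<close> does not depend on which
  intertwiner is used.\<close>

lemma sl2_moves_iff:
  fixes A :: "'p::prime_card mod_ring ^ 2 ^ 2"
  assumes two: "(2 :: 'p mod_ring) \<noteq> 0"
  shows "sl2_moves A P Q \<longleftrightarrow>
    (\<exists>a\<in>coord_vecs ((CARD('p) - 1) div 2). \<exists>a'\<in>coord_vecs ((CARD('p) - 1) div 2).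
       P = proj_pt a \<and> Q = proj_pt a' \<and>
       (\<exists>f\<in>heis_lifts A. moves f (even_param a) (even_param a' :: 'p mod_ring \<Rightarrow> complex)))"
proof -
  have "(\<exists>y0. y0 \<noteq> 0 \<and> heis_rep (f e2) y0 = y0 \<and> heis_clifford_algebra a =
             clifford_presented a' (\<lambda>i. lin_form (heis_rep (f e1 [^]\<^bsub>heis\<^esub> (- to_int_mod_ring i)) y0)))
        \<longleftrightarrow> moves f (even_param a) (even_param a' :: 'p mod_ring \<Rightarrow> complex)"
    if a: "a \<in> coord_vecs ((CARD('p) - 1) div 2)" "a' \<in> coord_vecs ((CARD('p) - 1) div 2)"
      and fA: "f \<in> heis_lifts A" for a a' f
  proof -
    have f: "f \<in> heis_auts" by (rule heis_lifts_auts[OF fA])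
    define T where "T y = (\<chi> j k. hrep 1 (f (- k, 0, 0)) y $ j)" for y
    have y: "heis_clifford_algebra a =
             clifford_presented a' (\<lambda>i. lin_form (heis_rep (f e1 [^]\<^bsub>heis\<^esub> (- to_int_mod_ring i)) y0))
        \<longleftrightarrow> moves f (even_param a) (even_param a' :: 'p mod_ring \<Rightarrow> complex)"
      if "y0 \<noteq> 0" "heis_rep (f e2) y0 = y0" for y0
    proof -
      have "intertwiner 1 f (T y0)"
        using intertwiner_from_fixed_vec[OF f that(1), of 1] that(2) by (simp add: T_def heis_rep_eq_hrep)
      moreover have "heis_rep (f e1 [^]\<^bsub>heis\<^esub> (- to_int_mod_ring k)) y0 = T y0 *v axis k 1" for k
        unfolding e1_power_in_hom[OF f] heis_rep_eq_hrep by (simp add: vec_eq_iff matrix_vec_axis T_def)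
      ultimately show ?thesis
        using clifford_presentations_agree_iff[OF two f _ even_param_nonzero[OF two a(1)] even_param_nonzero[OF two a(2)], of "T y0"]
        by simp
    qed
    obtain x y z where e2: "f e2 = (x, y, z)" by (cases "f e2")
    obtain t where "t \<noteq> 0" "heis_rep (f e2) t = t"
      using fixed_vec_exists[OF two heis_aut_e2_noncentral[OF f e2], of 1] unfolding e2 heis_rep_eq_hrep by blast
    then show ?thesis using y by blast
  qed
  then show ?thesis unfolding sl2_moves_def by blast
qed

section \<open>The group PSL(2,p)\<close>

definition psl :: "'p::prime_card mod_ring ^ 2 ^ 2 \<Rightarrow> ('p mod_ring ^ 2 ^ 2) set" where
  "psl A = {A, - A}"

lemma matrix_mul_uminus: "(- A) ** B = - (A ** B)" "A ** (- B) = - (A ** B)"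
  for A :: "'a::comm_ring_1 ^ 'n::finite ^ 'm" and B :: "'a ^ 'k ^ 'n"
  by (simp_all add: vec_eq_iff matrix_matrix_mult_def sum_negf)

lemma carrier_PSL2: "carrier (PSL2 :: ('p::prime_card mod_ring ^ 2 ^ 2) set monoid) = psl ` {A. det A = 1}"
  by (auto simp: PSL2_def FactGroup_def RCOSETS_def r_coset_def SL2_def psl_def matrix_mul_uminus)

lemma psl_mult: "psl A \<otimes>\<^bsub>PSL2\<^esub> psl B = psl (A ** B)"
  by (auto simp: PSL2_def FactGroup_def set_mult_def SL2_def psl_def matrix_mul_uminus)

lemma psl_one: "\<one>\<^bsub>PSL2\<^esub> = psl (mat 1)"
  by (simp add: PSL2_def FactGroup_def psl_def)

lemma SL2_inverse:
  fixes A :: "'p::prime_card mod_ring ^ 2 ^ 2"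
  assumes "det A = 1"
  obtains B where "det B = 1" "A ** B = mat 1" "B ** A = mat 1"
proof -
  have "invertible A" using assms by (simp add: invertible_det_nz)
  then obtain B where B: "A ** B = mat 1" "B ** A = mat 1" unfolding invertible_def by blast
  then have "det A * det B = 1" by (metis det_I det_mul)
  then show ?thesis using that[OF _ B] assms by simp
qed

lemma group_PSL2: "group (PSL2 :: ('p::prime_card mod_ring ^ 2 ^ 2) set monoid)"
proof (rule groupI)
  show "\<exists>y\<in>carrier PSL2. y \<otimes>\<^bsub>PSL2\<^esub> x = \<one>\<^bsub>PSL2\<^esub>" if "x \<in> carrier PSL2" for x :: "('p mod_ring ^ 2 ^ 2) set"
  proof -
    obtain A where A: "det A = 1" "x = psl A" using \<open>x \<in> carrier PSL2\<close> by (auto simp: carrier_PSL2)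
    obtain B where B: "det B = 1" "B ** A = mat 1" using SL2_inverse[OF A(1)] by blast
    show ?thesis
      by (rule bexI[of _ "psl B"]) (use A(2) B in \<open>auto simp: carrier_PSL2 psl_mult psl_one\<close>)
  qed
qed (auto simp: carrier_PSL2 psl_mult psl_one matrix_mul_assoc det_mul)

lemma psl_inv:
  assumes "det A = 1" "det B = 1" "B ** A = mat 1"
  shows "inv\<^bsub>PSL2\<^esub> psl A = psl B"
  by (rule group.inv_equality[OF group_PSL2]) (use assms in \<open>auto simp: carrier_PSL2 psl_mult psl_one\<close>)

section \<open>The action on projective space\<close>

text \<open>Two lifts of \<open>A\<close> and \<open>\<plusminus> A\<close> differ by a lift of \<open>\<plusminus> 1\<close>, which leaves the parameters unchanged.\<close>

lemma moves_unique_psl: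
  fixes A B :: "'p::prime_card mod_ring ^ 2 ^ 2"
  assumes two: "(2 :: 'p mod_ring) \<noteq> 0" and A: "det A = 1" "B \<in> psl A"
    and f: "f \<in> heis_lifts A" "g \<in> heis_lifts B" and mv: "moves f b b1" "moves g b b2"
    and b1: "\<And>i. b1 (- i) = b1 i" "\<exists>i. b1 i \<noteq> 0"
  shows "\<exists>c. c \<noteq> 0 \<and> (\<forall>i :: 'p mod_ring. b2 i = c * b1 i)"
proof -
  obtain A' where A': "A' ** A = mat 1" using SL2_inverse[OF A(1)] by blast
  \<comment> \<open>The lift of \<open>\<plusminus> 1\<close> by which \<open>f\<close> and \<open>g\<close> differ.\<close>
  define h where "h = inv_into UNIV f \<circ> g"
  define \<epsilon> :: "'p mod_ring" where "\<epsilon> = (if B = A then 1 else - 1)"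
  have h: "h \<in> heis_lifts (A' ** B)"
    unfolding h_def by (rule heis_lifts_comp[OF heis_lifts_inv[OF f(1) A'] f(2)])
  have "A' ** B = (if B = A then mat 1 else - mat 1)"
    using A(2) A' by (auto simp: psl_def matrix_mul_uminus)
  then have "\<exists>c'. h (x, y, z) = (\<epsilon> * x, \<epsilon> * y, c')" for x y z
    using heis_lift_apply[OF h, of x y z] by (auto simp: \<epsilon>_def mat_def split: if_splits)
  then have "moves h b1 b1"
    by (intro moves_lift_of_sign[OF two heis_lifts_auts[OF h], of \<epsilon>]) (auto simp: \<epsilon>_def b1)
  then have "moves (f \<circ> h) b b1" by (rule moves_comp[OF two mv(1)])
  moreover have "f \<circ> h = g"
    using heis_aut_bij[OF heis_lifts_auts[OF f(1)]] by (simp add: h_def fun_eq_iff bij_def surj_f_inv_f)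
  ultimately have "moves g b b1" by simp
  then show ?thesis using moves_unique[OF two heis_lifts_auts[OF f(2)]] mv(2) by blast
qed

lemma proj_pt_eq_iff_even_param:
  assumes two: "(2 :: 'p::prime_card mod_ring) \<noteq> 0"
    and a: "a \<in> coord_vecs ((CARD('p) - 1) div 2)" "a' \<in> coord_vecs ((CARD('p) - 1) div 2)"
  shows "proj_pt a = proj_pt a' \<longleftrightarrow> (\<exists>c. c \<noteq> 0 \<and> (\<forall>i :: 'p mod_ring. even_param a' i = c * even_param a i))"
proof
  assume "proj_pt a = proj_pt a'"
  then obtain c where "c \<noteq> 0" "\<forall>n. a' n = c * a n" unfolding proj_pt_eq_iff by blast
  then show "\<exists>c. c \<noteq> 0 \<and> (\<forall>i :: 'p mod_ring. even_param a' i = c * even_param a i)"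
    by (intro exI[of _ c]) (simp add: even_param_def)
next
  assume "\<exists>c. c \<noteq> 0 \<and> (\<forall>i :: 'p mod_ring. even_param a' i = c * even_param a i)"
  then show "proj_pt a = proj_pt a'"
    unfolding proj_pt_eq_iff using even_param_proportional[OF two a] by blast
qed

text \<open>One lift and one choice of parameters suffice to evaluate the definite description in
  \<^const>\<open>pt_act\<close>.\<close>

lemma pt_act_eqI:
  fixes A :: "'p::prime_card mod_ring ^ 2 ^ 2"
  assumes two: "(2 :: 'p mod_ring) \<noteq> 0" and A: "det A = 1"
    and a: "a \<in> coord_vecs ((CARD('p) - 1) div 2)" "a' \<in> coord_vecs ((CARD('p) - 1) div 2)"
    and f: "f \<in> heis_lifts A" and mv: "moves f (even_param a) (even_param a' :: 'p mod_ring \<Rightarrow> complex)"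
  shows "pt_act (proj_pt a) (psl A) = proj_pt a'"
  unfolding pt_act_def
proof (rule the_equality)
  show "\<exists>A\<in>psl A. sl2_moves A (proj_pt a) (proj_pt a')"
    unfolding sl2_moves_iff[OF two] using a f mv by (intro bexI[of _ A]) (auto simp: psl_def)
  fix Q assume "\<exists>A\<in>psl A. sl2_moves A (proj_pt a) Q"
  then obtain B x x' g where B: "B \<in> psl A" and x: "x \<in> coord_vecs ((CARD('p) - 1) div 2)"
      "x' \<in> coord_vecs ((CARD('p) - 1) div 2)" "proj_pt a = proj_pt x" "Q = proj_pt x'"
    and g: "g \<in> heis_lifts B" "moves g (even_param x) (even_param x' :: 'p mod_ring \<Rightarrow> complex)"
    unfolding sl2_moves_iff[OF two] by blast
  obtain c where c: "c \<noteq> 0" "\<forall>i :: 'p mod_ring. even_param x i = c * even_param a i"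
    using x(3) unfolding proj_pt_eq_iff_even_param[OF two a(1) x(1)] by blast
  then have "even_param x = (\<lambda>i :: 'p mod_ring. c * even_param a i)" by blast
  then have "moves g (even_param a) (even_param x' :: 'p mod_ring \<Rightarrow> complex)"
    using moves_scale[OF g(2), of "1 / c" 1] c(1) by simp
  then have "\<exists>c. c \<noteq> 0 \<and> (\<forall>i :: 'p mod_ring. even_param x' i = c * even_param a' i)"
    by (rule moves_unique_psl[OF two A B f g(1) mv _ even_param_minus even_param_nonzero[OF two a(2)]])
  then show "Q = proj_pt a'"
    unfolding x(4) using proj_pt_eq_iff_even_param[OF two a(2) x(2)] by simp
qed

lemma pt_act_obtain:
  fixes A :: "'p::prime_card mod_ring ^ 2 ^ 2"
  assumes two: "(2 :: 'p mod_ring) \<noteq> 0" and A: "det A = 1"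
    and a: "a \<in> coord_vecs ((CARD('p) - 1) div 2)"
  obtains f a' where "f \<in> heis_lifts A" "a' \<in> coord_vecs ((CARD('p) - 1) div 2)"
    "moves f (even_param a) (even_param a' :: 'p mod_ring \<Rightarrow> complex)" "pt_act (proj_pt a) (psl A) = proj_pt a'"
proof -
  obtain f where f: "f \<in> heis_lifts A" using heis_lift_exists[OF two A] by blast
  obtain b' :: "'p mod_ring \<Rightarrow> complex" where b': "\<And>i. b' (- i) = b' i" "\<exists>i. b' i \<noteq> 0" "moves f (even_param a) b'"
    using moves_exists[OF two heis_lifts_auts[OF f] even_param_minus even_param_nonzero[OF two a]] by metis
  obtain a' where a': "a' \<in> coord_vecs ((CARD('p) - 1) div 2)" "even_param a' = b'"
    using even_param_surj[OF two b'(1,2)] by metis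
  have mv: "moves f (even_param a) (even_param a' :: 'p mod_ring \<Rightarrow> complex)" using b'(3) a'(2) by simp
  show ?thesis using that[OF f a'(1) mv pt_act_eqI[OF two A a a'(1) f mv]] .
qed

definition proj_points :: "nat \<Rightarrow> (nat \<Rightarrow> complex) set set" where
  "proj_points n = proj_pt ` coord_vecs n"

lemma right_action_pt_act:
  assumes two: "(2 :: 'p::prime_card mod_ring) \<noteq> 0"
  shows "right_action (PSL2 :: ('p mod_ring ^ 2 ^ 2) set monoid) (proj_points ((CARD('p) - 1) div 2)) pt_act"
  unfolding right_action_def
proof (intro conjI ballI)
  show "group (PSL2 :: ('p mod_ring ^ 2 ^ 2) set monoid)" by (rule group_PSL2)
  fix P assume "P \<in> proj_points ((CARD('p) - 1) div 2)"
  then obtain a where a: "a \<in> coord_vecs ((CARD('p) - 1) div 2)" "P = proj_pt a" by (auto simp: proj_points_def)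
  have id: "moves id (even_param a) (even_param a :: 'p mod_ring \<Rightarrow> complex)"
    by (rule moves_lift_of_sign[OF two heis_lifts_auts[OF heis_lifts_id], of 1])
       (auto simp: even_param_minus even_param_nonzero[OF two a(1)])
  show "pt_act P \<one>\<^bsub>PSL2 :: ('p mod_ring ^ 2 ^ 2) set monoid\<^esub> = P"
    unfolding psl_one a(2) by (rule pt_act_eqI[OF two _ a(1) a(1) heis_lifts_id id]) (simp add: det_I)
  fix g :: "('p mod_ring ^ 2 ^ 2) set" assume "g \<in> carrier PSL2"
  then obtain A where A: "det A = 1" "g = psl A" by (auto simp: carrier_PSL2)
  obtain f a' where f: "f \<in> heis_lifts A" "a' \<in> coord_vecs ((CARD('p) - 1) div 2)"
    "moves f (even_param a) (even_param a' :: 'p mod_ring \<Rightarrow> complex)" "pt_act (proj_pt a) (psl A) = proj_pt a'"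
    using pt_act_obtain[OF two A(1) a(1)] by blast
  then show "pt_act P g \<in> proj_points ((CARD('p) - 1) div 2)" by (simp add: a A proj_points_def)
  fix h :: "('p mod_ring ^ 2 ^ 2) set" assume "h \<in> carrier PSL2"
  then obtain B where B: "det B = 1" "h = psl B" by (auto simp: carrier_PSL2)
  obtain k a'' where k: "k \<in> heis_lifts B" "a'' \<in> coord_vecs ((CARD('p) - 1) div 2)"
    "moves k (even_param a') (even_param a'' :: 'p mod_ring \<Rightarrow> complex)" "pt_act (proj_pt a') (psl B) = proj_pt a''"
    using pt_act_obtain[OF two B(1) f(2)] by blast
  have "pt_act (proj_pt a) (psl (A ** B)) = proj_pt a''"
    by (rule pt_act_eqI[OF two _ a(1) k(2) heis_lifts_comp[OF f(1) k(1)] moves_comp[OF two f(3) k(3)]])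
       (simp add: det_mul A B)
  then show "pt_act P (g \<otimes>\<^bsub>PSL2\<^esub> h) = pt_act (pt_act P g) h"
    by (simp add: a A B psl_mult f k)
qed

section \<open>Right actions and stabilisers\<close>

lemma right_action_image:
  "right_action G X act \<Longrightarrow> right_action G (Pow X) (\<lambda>H g. (\<lambda>x. act x g) ` H)"
  unfolding right_action_def by (fastforce simp: image_image image_subset_iff subset_iff)

lemma right_action_orbit:
  assumes "right_action G X act" "x \<in> X"
  shows "right_action G (right_orbit G act x) act"
proof -
  interpret group G using assms(1) by (simp add: right_action_def)
  have sub: "right_orbit G act x \<subseteq> X" using assms by (auto simp: right_orbit_def right_action_def)
  have "act y g \<in> right_orbit G act x" if "y \<in> right_orbit G act x" "g \<in> carrier G" for y g
  proof -
    obtain h where h: "h \<in> carrier G" "y = act x h" using \<open>y \<in> _\<close> by (auto simp: right_orbit_def)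
    then have "act y g = act x (h \<otimes>\<^bsub>G\<^esub> g)" using assms that(2) by (simp add: right_action_def)
    then show ?thesis using h(1) that(2) by (auto simp: right_orbit_def)
  qed
  then show ?thesis using assms(1) sub unfolding right_action_def by (meson subsetD)
qed

lemma right_action_eq_iff:
  assumes act: "right_action G X act" and x: "x \<in> X" and g: "g \<in> carrier G" and h: "h \<in> carrier G"
  shows "act x g = act x h \<longleftrightarrow> act x (g \<otimes>\<^bsub>G\<^esub> inv\<^bsub>G\<^esub> h) = x"
proof -
  interpret group G using act by (simp add: right_action_def)
  have mult: "act y (k \<otimes>\<^bsub>G\<^esub> l) = act (act y k) l" if "y \<in> X" "k \<in> carrier G" "l \<in> carrier G" for y k l
    using act that by (simp add: right_action_def)
  have one: "act x \<one>\<^bsub>G\<^esub> = x" using act x by (simp add: right_action_def)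
  show ?thesis
  proof
    assume "act x g = act x h"
    then have "act x (g \<otimes>\<^bsub>G\<^esub> inv\<^bsub>G\<^esub> h) = act (act x h) (inv\<^bsub>G\<^esub> h)" using x g h by (simp add: mult)
    also have "\<dots> = act x (h \<otimes>\<^bsub>G\<^esub> inv\<^bsub>G\<^esub> h)" using x h by (intro mult[symmetric]) auto
    finally show "act x (g \<otimes>\<^bsub>G\<^esub> inv\<^bsub>G\<^esub> h) = x" using h one by simp
  next
    assume "act x (g \<otimes>\<^bsub>G\<^esub> inv\<^bsub>G\<^esub> h) = x"
    then have "act x h = act (act x (g \<otimes>\<^bsub>G\<^esub> inv\<^bsub>G\<^esub> h)) h" by simp
    also have "\<dots> = act x (g \<otimes>\<^bsub>G\<^esub> inv\<^bsub>G\<^esub> h \<otimes>\<^bsub>G\<^esub> h)" using x g h by (intro mult[symmetric]) auto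
    finally have "act x h = act x (g \<otimes>\<^bsub>G\<^esub> inv\<^bsub>G\<^esub> h \<otimes>\<^bsub>G\<^esub> h)" .
    then show "act x g = act x h" using g h by (simp add: m_assoc)
  qed
qed

text \<open>The map sends \<open>x g\<close> to \<open>y g\<close>. It is well defined and injective since in both orbits \<open>g\<close> and \<open>h\<close> lead to the
  same point if and only if \<open>g h\<inverse>\<close> stabilises the base point.\<close>

lemma orbits_iso_of_equal_stabilizers:
  assumes X: "right_action G X actX" "x \<in> X" and Y: "right_action G Y actY" "y \<in> Y"
    and stab: "\<And>g. g \<in> carrier G \<Longrightarrow> actX x g = x \<longleftrightarrow> actY y g = y"
  shows "\<exists>f. gset_iso G (right_orbit G actX x) actX (right_orbit G actY y) actY f"
proof -
  interpret group G using X(1) by (simp add: right_action_def)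
  have iff: "actX x g = actX x h \<longleftrightarrow> actY y g = actY y h" if "g \<in> carrier G" "h \<in> carrier G" for g h
    using that stab[of "g \<otimes>\<^bsub>G\<^esub> inv\<^bsub>G\<^esub> h"] by (simp add: right_action_eq_iff[OF X] right_action_eq_iff[OF Y])
  define r where "r z = (SOME g. g \<in> carrier G \<and> actX x g = z)" for z
  define f where "f z = actY y (r z)" for z
  have f: "f (actX x g) = actY y g" if g: "g \<in> carrier G" for g
  proof -
    have "r (actX x g) \<in> carrier G \<and> actX x (r (actX x g)) = actX x g"
      unfolding r_def by (rule someI[of _ g]) (simp add: g)
    then show ?thesis using iff[of "r (actX x g)" g] g by (simp add: f_def)
  qed
  have "bij_betw f (right_orbit G actX x) (right_orbit G actY y)"
    unfolding bij_betw_def inj_on_def right_orbit_def using f iff by (auto simp: image_iff) metis+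
  moreover have "f (actX z g) = actY (f z) g" if z: "z \<in> right_orbit G actX x" and g: "g \<in> carrier G" for z g
  proof -
    obtain h where h: "h \<in> carrier G" "z = actX x h" using z by (auto simp: right_orbit_def)
    have "actX z g = actX x (h \<otimes>\<^bsub>G\<^esub> g)" "actY (actY y h) g = actY y (h \<otimes>\<^bsub>G\<^esub> g)"
      using X Y h g by (simp_all add: right_action_def)
    then show ?thesis using f h g by simp
  qed
  ultimately show ?thesis
    using right_action_orbit[OF X] right_action_orbit[OF Y] unfolding gset_iso_def by blast
qed

section \<open>The action on lines\<close>

lemma proj_line_eq: "proj_line = {vec.span {v} | v :: 'p::prime_card mod_ring ^ 2. v \<noteq> 0}"
proof (intro equalityI subsetI)
  fix L :: "('p mod_ring ^ 2) set" assume "L \<in> proj_line"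
  then have L: "vec.subspace L" "vec.dim L = 1" by (auto simp: proj_line_def)
  obtain B where B: "B \<subseteq> L" "vec.independent B" "L \<subseteq> vec.span B" "card B = 1"
    using vec.basis_exists[of L] L(2) by metis
  then obtain v where v: "B = {v}" by (meson card_1_singletonE)
  have "L = vec.span {v}" using B v vec.span_minimal[OF _ L(1)] by blast
  moreover have "v \<noteq> 0" using B(2) v by (simp add: vec.dependent_single)
  ultimately show "L \<in> {vec.span {v} | v. v \<noteq> 0}" by blast
next
  fix L :: "('p mod_ring ^ 2) set" assume "L \<in> {vec.span {v} | v. v \<noteq> 0}"
  then obtain v where v: "L = vec.span {v}" "v \<noteq> 0" by blast
  then have "vec.dim L = 1"
    using vec.dim_span_eq_card_independent[of "{v}"] by (simp add: vec.dependent_single)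
  then show "L \<in> proj_line" using v by (simp add: proj_line_def vec.subspace_span)
qed

lemma matrix_image_span_single:
  "(*v) A ` vec.span {v} = vec.span {(A :: 'a::field ^ 'n::finite ^ 'm::finite) *v v}"
  by (auto simp: vec.span_singleton image_iff vector_scalar_commute)

lemma uminus_matrix_image_subspace:
  assumes "vec.subspace L"
  shows "(*v) (- A) ` L = (*v) (A :: 'a::field ^ 'n::finite ^ 'm::finite) ` L"
proof -
  have neg: "(- A) *v v = A *v (- v)" for v
    by (simp add: vec_eq_iff matrix_vector_mult_def)
  have "uminus ` L = L"
    using vec.subspace_neg[OF assms] by (force simp: image_iff)
  then show ?thesis by (metis (no_types, lifting) neg image_cong image_image)
qed

lemma line_act_psl:
  assumes L: "L \<in> proj_line" and A: "det A = 1" "det B = 1" "B ** A = mat 1"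
  shows "line_act L (psl A) = (*v) B ` L"
proof -
  have "(*v) (- B) ` L = (*v) B ` L" using L by (intro uminus_matrix_image_subspace) (simp add: proj_line_def)
  then show ?thesis unfolding line_act_def line_left_act_def psl_inv[OF A]
    by (intro the_equality) (auto simp: psl_def)
qed

lemma right_action_line_act:
  "right_action (PSL2 :: ('p::prime_card mod_ring ^ 2 ^ 2) set monoid) proj_line line_act"
  unfolding right_action_def
proof (intro conjI ballI)
  show "group (PSL2 :: ('p mod_ring ^ 2 ^ 2) set monoid)" by (rule group_PSL2)
  fix L :: "('p mod_ring ^ 2) set" assume L: "L \<in> proj_line"
  show "line_act L \<one>\<^bsub>PSL2\<^esub> = L"
    unfolding psl_one by (subst line_act_psl[OF L, of _ "mat 1"]) (simp_all add: det_I)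
  fix g :: "('p mod_ring ^ 2 ^ 2) set" assume "g \<in> carrier PSL2"
  then obtain A where A: "det A = 1" "g = psl A" by (auto simp: carrier_PSL2)
  obtain A' where A': "det A' = 1" "A ** A' = mat 1" "A' ** A = mat 1" using SL2_inverse[OF A(1)] by blast
  have Lg: "line_act L g = (*v) A' ` L" unfolding A by (rule line_act_psl[OF L A(1) A'(1,3)])
  have inj: "A' *v v \<noteq> 0" if "v \<noteq> 0" for v
    using that A'(2) by (metis matrix_vector_mul_assoc matrix_vector_mul_lid matrix_vector_mult_0_right)
  show Lg': "line_act L g \<in> proj_line"
  proof -
    obtain v where v: "v \<noteq> 0" "L = vec.span {v}" using L by (auto simp: proj_line_eq)
    then have "line_act L g = vec.span {A' *v v}" unfolding Lg by (simp only: matrix_image_span_single)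
    then show ?thesis using inj[OF v(1)] unfolding proj_line_eq by blast
  qed
  fix h :: "('p mod_ring ^ 2 ^ 2) set" assume "h \<in> carrier PSL2"
  then obtain B where B: "det B = 1" "h = psl B" by (auto simp: carrier_PSL2)
  obtain B' where B': "det B' = 1" "B' ** B = mat 1" using SL2_inverse[OF B(1)] by blast
  have "(B' ** A') ** (A ** B) = B' ** (A' ** A) ** B" by (simp add: matrix_mul_assoc)
  then have inv: "(B' ** A') ** (A ** B) = mat 1" by (simp add: A' B')
  have "line_act L (psl (A ** B)) = (*v) (B' ** A') ` L"
    by (rule line_act_psl[OF L _ _ inv]) (simp_all add: det_mul A B A' B')
  also have "\<dots> = (*v) B' ` (*v) A' ` L" by (simp add: image_image matrix_vector_mul_assoc)
  also have "\<dots> = line_act (line_act L g) h"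
    unfolding B(2) line_act_psl[OF Lg' B(1) B'] unfolding Lg ..
  finally show "line_act L (g \<otimes>\<^bsub>PSL2\<^esub> h) = line_act (line_act L g) h" by (simp add: A B psl_mult)
qed

definition base_line :: "('p::prime_card mod_ring ^ 2) set" where
  "base_line = vec.span {vector [0, 1]}"

lemma base_line_in_proj_line: "base_line \<in> proj_line"
  unfolding proj_line_eq base_line_def
  by (auto intro!: exI[of _ "vector [0, 1]"] simp: vec_eq_iff forall_2)

lemma proj_line_orbit: "proj_line = right_orbit PSL2 line_act (base_line :: ('p::prime_card mod_ring ^ 2) set)"
proof (intro equalityI subsetI)
  fix L :: "('p mod_ring ^ 2) set" assume "L \<in> right_orbit PSL2 line_act base_line"
  then show "L \<in> proj_line"
    using right_action_line_act base_line_in_proj_line by (auto simp: right_orbit_def right_action_def)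
next
  fix L :: "('p mod_ring ^ 2) set" assume "L \<in> proj_line"
  then obtain v where v: "v \<noteq> 0" "L = vec.span {v}" by (auto simp: proj_line_eq)
  obtain A :: "'p mod_ring ^ 2 ^ 2" where A: "det A = 1" "A *v vector [0, 1] = v"
  proof (cases "v $ 2 = 0")
    case True
    then have "v $ 1 \<noteq> 0" using v(1) by (auto simp: vec_eq_iff forall_2)
    then show ?thesis using True
      by (intro that[of "vector [vector [0, v $ 1], vector [- 1 / v $ 1, v $ 2]]"])
         (auto simp: det_2 vec_eq_iff forall_2 matrix2_apply)
  next
    case False
    then show ?thesis
      by (intro that[of "vector [vector [1 / v $ 2, v $ 1], vector [0, v $ 2]]"])
         (auto simp: det_2 vec_eq_iff forall_2 matrix2_apply)
  qed
  obtain B where B: "det B = 1" "A ** B = mat 1" using SL2_inverse[OF A(1)] by blast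
  have "line_act base_line (psl B) = L"
    unfolding line_act_psl[OF base_line_in_proj_line B(1) A(1) B(2)]
    unfolding base_line_def matrix_image_span_single A(2) v(2) ..
  then show "L \<in> right_orbit PSL2 line_act base_line" using B(1) by (auto simp: right_orbit_def carrier_PSL2)
qed

lemma base_line_stabilizer:
  fixes A :: "'p::prime_card mod_ring ^ 2 ^ 2"
  assumes A: "det A = 1"
  shows "line_act base_line (psl A) = base_line \<longleftrightarrow> A $ 1 $ 2 = 0"
proof -
  obtain B where B: "det B = 1" "A ** B = mat 1" "B ** A = mat 1" using SL2_inverse[OF A] by blast
  have "line_act base_line (psl A) = base_line \<longleftrightarrow> (*v) A ` base_line = base_line"
  proof -
    have "(*v) A ` (*v) B ` M = M" "(*v) B ` (*v) A ` M = M" for M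
      by (simp_all add: image_image matrix_vector_mul_assoc B)
    then show ?thesis unfolding line_act_psl[OF base_line_in_proj_line A B(1,3)] by metis
  qed
  also have "\<dots> \<longleftrightarrow> vec.span {vector [A $ 1 $ 2, A $ 2 $ 2]} = vec.span {vector [0, 1 :: 'p mod_ring] :: _ ^ 2}"
    unfolding base_line_def matrix_image_span_single matrix2_apply by simp
  also have "\<dots> \<longleftrightarrow> A $ 1 $ 2 = 0"
  proof
    assume "vec.span {vector [A $ 1 $ 2, A $ 2 $ 2]} = vec.span {vector [0, 1 :: 'p mod_ring] :: _ ^ 2}"
    then have "vector [A $ 1 $ 2, A $ 2 $ 2] \<in> vec.span {vector [0, 1 :: 'p mod_ring] :: _ ^ 2}"
      by (metis insertI1 vec.span_base)
    then show "A $ 1 $ 2 = 0" by (auto simp: vec.span_singleton vec_eq_iff forall_2)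
  next
    assume 0: "A $ 1 $ 2 = 0"
    then have nz: "A $ 2 $ 2 \<noteq> 0" using A by (auto simp: det_2)
    have 1: "vector [A $ 1 $ 2, A $ 2 $ 2] = A $ 2 $ 2 *s (vector [0, 1] :: _ ^ 2)"
      by (simp add: vec_eq_iff forall_2 0)
    show "vec.span {vector [A $ 1 $ 2, A $ 2 $ 2]} = vec.span {vector [0, 1 :: 'p mod_ring] :: _ ^ 2}"
      unfolding 1 by (rule vec.span_image_scale[of "{_}" "\<lambda>_. A $ 2 $ 2", simplified]) (use nz in auto)
  qed
  finally show ?thesis .
qed

section \<open>The stabilisers of the base point and the base hyperplane\<close>

definition base_coords :: "nat \<Rightarrow> complex" where "base_coords i = (if i = 0 then 1 else 0)"

lemma base_pt_eq: "base_pt = proj_pt base_coords"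
  by (simp add: base_pt_def base_coords_def[abs_def])

lemma base_coords_in_coord_vecs: "base_coords \<in> coord_vecs n"
  by (auto simp: coord_vecs_def base_coords_def)

lemma even_param_base_coords:
  assumes two: "(2 :: 'p::prime_card mod_ring) \<noteq> 0"
  shows "even_param base_coords (i :: 'p mod_ring) = (if i = 0 then 2 else 0)"
proof (cases "i = 0")
  case False
  then obtain n where n: "n \<in> {1..(CARD('p) - 1) div 2}" "i = of_nat n \<or> i = - of_nat n"
    using half_abs_cases[OF two] by blast
  then show ?thesis
    using False even_param_of_nat[OF n(1), of base_coords] even_param_minus[of base_coords "of_nat n :: 'p mod_ring"]
    by (auto simp: base_coords_def)
qed (simp add: even_param_0 base_coords_def)

lemma base_pt_stabilizer:
  fixes A :: "'p::prime_card mod_ring ^ 2 ^ 2"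
  assumes two: "(2 :: 'p mod_ring) \<noteq> 0" and A: "det A = 1"
  shows "pt_act base_pt (psl A) = base_pt \<longleftrightarrow> A $ 1 $ 2 = 0"
proof -
  obtain f a' where f: "f \<in> heis_lifts A" "a' \<in> coord_vecs ((CARD('p) - 1) div 2)"
    "moves f (even_param base_coords) (even_param a' :: 'p mod_ring \<Rightarrow> complex)" "pt_act base_pt (psl A) = proj_pt a'"
    using pt_act_obtain[OF two A base_coords_in_coord_vecs] unfolding base_pt_eq by blast
  obtain c where e2: "f e2 = (A $ 1 $ 2, A $ 2 $ 2, c)" using heis_lift_e2[OF f(1)] .
  have "proj_pt base_coords = proj_pt a' \<longleftrightarrow> A $ 1 $ 2 = 0"
  proof
    assume eq: "proj_pt base_coords = proj_pt a'"
    show "A $ 1 $ 2 = 0"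
    proof (rule ccontr)
      assume "A $ 1 $ 2 \<noteq> 0"
      then have "even_param a' (1 :: 'p mod_ring) \<noteq> 0"
        by (intro moves_base_nonmonomial[OF two f(3) e2]) (auto simp: even_param_base_coords[OF two])
      then show False
        using eq proj_pt_eq_iff_even_param[OF two base_coords_in_coord_vecs f(2)] by (auto simp: even_param_base_coords[OF two])
    qed
  next
    assume 0: "A $ 1 $ 2 = 0"
    have off: "even_param a' i = 0" if "i \<noteq> 0" for i :: "'p mod_ring"
      using moves_base_monomial[OF two f(3), of "A $ 2 $ 2" c i] that e2 0 by (auto simp: even_param_base_coords[OF two])
    then have "even_param a' (0 :: 'p mod_ring) \<noteq> 0" using even_param_nonzero[OF two f(2)] by metis
    then show "proj_pt base_coords = proj_pt a'"
      unfolding proj_pt_eq_iff_even_param[OF two base_coords_in_coord_vecs f(2)]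
      by (intro exI[of _ "even_param a' (0 :: 'p mod_ring) / 2"]) (auto simp: even_param_base_coords[OF two] off)
  qed
  then show ?thesis unfolding f(4) by (auto simp: base_pt_eq)
qed

lemma base_hyperplane_subset: "base_hyperplane n \<subseteq> proj_points n"
  by (auto simp: base_hyperplane_def proj_points_def)

lemma proj_pt_in_base_hyperplane_iff:
  assumes "a \<in> coord_vecs n" shows "proj_pt a \<in> base_hyperplane n \<longleftrightarrow> a 0 = 0"
  using assms by (auto simp: base_hyperplane_def proj_pt_eq_iff)

text \<open>Applied to \<open>A\<close> and to its inverse, this inclusion becomes an equality.\<close>

lemma hyperplane_act_monomial:
  fixes A :: "'p::prime_card mod_ring ^ 2 ^ 2"
  assumes two: "(2 :: 'p mod_ring) \<noteq> 0" and A: "det A = 1" "A $ 1 $ 2 = 0"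
  shows "hyperplane_act (base_hyperplane ((CARD('p) - 1) div 2)) (psl A) \<subseteq> base_hyperplane ((CARD('p) - 1) div 2)"
proof -
  have "pt_act (proj_pt a) (psl A) \<in> base_hyperplane ((CARD('p) - 1) div 2)"
    if a: "a \<in> coord_vecs ((CARD('p) - 1) div 2)" "a 0 = 0" for a
  proof -
    obtain f a' where f: "f \<in> heis_lifts A" "a' \<in> coord_vecs ((CARD('p) - 1) div 2)"
      "moves f (even_param a) (even_param a' :: 'p mod_ring \<Rightarrow> complex)" "pt_act (proj_pt a) (psl A) = proj_pt a'"
      using pt_act_obtain[OF two A(1) a(1)] by blast
    obtain c where e2: "f e2 = (A $ 1 $ 2, A $ 2 $ 2, c)" using heis_lift_e2[OF f(1)] .
    have "even_param a' (0 :: 'p mod_ring) = 0"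
      using moves_hyperplane_monomial[OF two heis_lifts_auts[OF f(1)] f(3), of "A $ 2 $ 2" c] e2 A(2) a(2)
      by (simp add: even_param_0)
    then show ?thesis unfolding f(4) proj_pt_in_base_hyperplane_iff[OF f(2)] by (simp add: even_param_0)
  qed
  then have "pt_act P (psl A) \<in> base_hyperplane ((CARD('p) - 1) div 2)"
    if "P \<in> base_hyperplane ((CARD('p) - 1) div 2)" for P
    using that by (auto simp: base_hyperplane_def[of "(CARD('p) - 1) div 2"] simp del: One_nat_def)
  then show ?thesis by (auto simp: hyperplane_act_def)
qed

lemma base_hyperplane_stabilizer:
  fixes A :: "'p::prime_card mod_ring ^ 2 ^ 2"
  assumes two: "(2 :: 'p mod_ring) \<noteq> 0" and A: "det A = 1"
  shows "hyperplane_act (base_hyperplane ((CARD('p) - 1) div 2)) (psl A) = base_hyperplane ((CARD('p) - 1) div 2)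
    \<longleftrightarrow> A $ 1 $ 2 = 0"
    (is "hyperplane_act ?H _ = _ \<longleftrightarrow> _")
proof
  assume 0: "A $ 1 $ 2 = 0"
  obtain B where B: "det B = 1" "A ** B = mat 1" "B ** A = mat 1" using SL2_inverse[OF A] by blast
  have "(A ** B) $ 1 $ 2 = 0" unfolding B(2) by (simp add: mat_def)
  then have "A $ 1 $ 1 * B $ 1 $ 2 = 0" by (simp add: matrix_matrix_mult_def sum_2 0)
  moreover have "A $ 1 $ 1 \<noteq> 0" using A 0 by (auto simp: det_2)
  ultimately have B12: "B $ 1 $ 2 = 0" by simp
  have act: "right_action (PSL2 :: ('p mod_ring ^ 2 ^ 2) set monoid) (Pow (proj_points ((CARD('p) - 1) div 2))) hyperplane_act"
    using right_action_image[OF right_action_pt_act[OF two]] by (simp add: hyperplane_act_def[abs_def])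
  have "?H = hyperplane_act ?H (psl B \<otimes>\<^bsub>PSL2\<^esub> psl A)"
    using act base_hyperplane_subset by (simp add: psl_mult B psl_one[symmetric] right_action_def)
  also have "\<dots> = hyperplane_act (hyperplane_act ?H (psl B)) (psl A)"
    using act base_hyperplane_subset A B(1) unfolding right_action_def by (simp add: carrier_PSL2)
  also have "\<dots> \<subseteq> hyperplane_act ?H (psl A)"
    using hyperplane_act_monomial[OF two B(1) B12] unfolding hyperplane_act_def by (rule image_mono)
  finally show "hyperplane_act ?H (psl A) = ?H" using hyperplane_act_monomial[OF two A 0] by simp
next
  assume eq: "hyperplane_act ?H (psl A) = ?H"
  show "A $ 1 $ 2 = 0"
  proof (rule ccontr)
    assume nz: "A $ 1 $ 2 \<noteq> 0"
    \<comment> \<open>The point of the hyperplane whose only nonzero coordinate is \<open>a_1\<close>.\<close>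
    define b where "b i = (if i = 1 \<or> i = - 1 then 1 else 0 :: complex)" for i :: "'p mod_ring"
    have "b (- i) = b i" for i by (auto simp: b_def minus_equation_iff)
    moreover have "b 1 \<noteq> 0" by (simp add: b_def)
    ultimately obtain a where a: "a \<in> coord_vecs ((CARD('p) - 1) div 2)" "even_param a = b"
      using even_param_surj[OF two, of b] by metis
    obtain f a' where f: "f \<in> heis_lifts A" "a' \<in> coord_vecs ((CARD('p) - 1) div 2)"
      "moves f (even_param a) (even_param a' :: 'p mod_ring \<Rightarrow> complex)" "pt_act (proj_pt a) (psl A) = proj_pt a'"
      using pt_act_obtain[OF two A(1) a(1)] by blast
    obtain c where e2: "f e2 = (A $ 1 $ 2, A $ 2 $ 2, c)" using heis_lift_e2[OF f(1)] .
    have mv: "moves f b (even_param a')" using f(3) a(2) by simp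
    have "even_param a' (0 :: 'p mod_ring) \<noteq> 0"
      by (rule moves_hyperplane_nonmonomial[where b = b, OF two mv e2 nz]) (simp add: b_def)
    moreover have "a 0 = 0" using fun_cong[OF a(2), of 0] by (simp add: even_param_0 b_def)
    then have "proj_pt a \<in> ?H" using a(1) proj_pt_in_base_hyperplane_iff by blast
    then have "proj_pt a' \<in> ?H" using eq f(4) unfolding hyperplane_act_def by (metis image_eqI)
    then have "a' 0 = 0" using proj_pt_in_base_hyperplane_iff[OF f(2)] by simp
    ultimately show False by (simp add: even_param_0)
  qed
qed

theorem theorem1p2:
  assumes "CARD('p::prime_card) \<ge> 5"
  shows "let G = (PSL2 :: ('p mod_ring ^ 2 ^ 2) set monoid);
             X = right_orbit G pt_act base_pt;
             Y = right_orbit G hyperplane_act (base_hyperplane ((CARD('p) - 1) div 2))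
         in (\<exists>f. gset_iso G X pt_act Y hyperplane_act f) \<and>
            (\<exists>f. gset_iso G X pt_act proj_line line_act f) \<and>
            (\<exists>f. gset_iso G Y hyperplane_act proj_line line_act f)"
proof -
  let ?G = "PSL2 :: ('p mod_ring ^ 2 ^ 2) set monoid"
  let ?n = "(CARD('p) - 1) div 2"
  have two: "(2 :: 'p mod_ring) \<noteq> 0"
    using of_nat_mod_ring_eq_iff[of 2 0, where 'p = 'p] assms by simp
  note X = right_action_pt_act[OF two]
  have x: "base_pt \<in> proj_points ?n" by (simp add: base_pt_eq proj_points_def base_coords_in_coord_vecs)
  have Y: "right_action ?G (Pow (proj_points ?n)) hyperplane_act"
    using right_action_image[OF X] by (simp add: hyperplane_act_def[abs_def])
  have y: "base_hyperplane ?n \<in> Pow (proj_points ?n)" using base_hyperplane_subset by blast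
  note Z = right_action_line_act[where 'p = 'p] and z = base_line_in_proj_line[where 'a = 'p]
  have stab: "(pt_act base_pt g = base_pt \<longleftrightarrow> line_act base_line g = base_line) \<and>
      (hyperplane_act (base_hyperplane ?n) g = base_hyperplane ?n \<longleftrightarrow> line_act base_line g = base_line)"
    if "g \<in> carrier ?G" for g
  proof -
    obtain A :: "'p mod_ring ^ 2 ^ 2" where A: "det A = 1" and g: "g = psl A"
      using \<open>g \<in> carrier ?G\<close> by (auto simp: carrier_PSL2)
    show ?thesis
      unfolding g base_pt_stabilizer[OF two A] base_hyperplane_stabilizer[OF two A] base_line_stabilizer[OF A]
      by simp
  qed
  show ?thesis
    unfolding Let_def proj_line_orbit
    using orbits_iso_of_equal_stabilizers[OF X x Y y] orbits_iso_of_equal_stabilizers[OF X x Z z]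
      orbits_iso_of_equal_stabilizers[OF Y y Z z] stab by blast
qed

end
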